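(* Let $\Bbbk$ be an algebraically closed field, $\lambda\in\Bbbk\setminus\{0,1\}$, and let $R=\Bbbk[[X,Y]]/(F)$ with $F=XY(X-Y)(X-\lambda Y)$, with projections $R_{12}$ and $R_{34}$ as defined in the context. Then the category $\mathrm{CM}(R)$ of (maximal) Cohen--Macaulay $R$-modules is equivalent to the category $\mathcal{E}$ of elements of the $\mathrm{CM}(R_{12})$-$\mathrm{CM}(R_{34})$-bimodule $\mathrm{Ext}^1_R$.
   Context: The ring $R$ is identified with the (complete) subring of $R_1\times R_2\times R_3\times R_4$, where each $R_i=\Bbbk[[t]]$, generated by $x=(t,0,t,\lambda t)$ and $y=(0,t,t,t)$ (the images of $X$ and $Y$); that is, $R$ is the image of $\Bbbk[[X,Y]]$ under $X\mapsto x$, $Y\mapsto y$. For $i\ne j$, $R_{ij}$ denotes the projection (image) of $R$ in $R_i\times R_j$; each $R_{ij}$ is isomorphic to $\Bbbk[[X,Y]]/(XY)$. Modules over $R_{ij}$ are regarded as $R$-modules via the surjection $R\to R_{ij}$. For a ring $A$ among $R,R_{12},R_{34}$, $\mathrm{CM}(A)$ denotes the category of finitely generated maximal Cohen--Macaulay $A$-modules (including $0$) with all $A$-homomorphisms. The category $\mathcal{E}$ of elements of the bimodule $\mathrm{Ext}^1_R$ is defined as follows. Its objects are the elements $\xi\in\mathrm{Ext}^1_R(N,L)$, where $N$ runs through $\mathrm{CM}(R_{12})$ and $L$ runs through $\mathrm{CM}(R_{34})$. A morphism from $\xi\in\mathrm{Ext}^1_R(N,L)$ to $\xi'\in\mathrm{Ext}^1_R(N',L')$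 is a pair $(\alpha,\beta)$ with $\alpha\in\mathrm{Hom}_R(N,N')$ and $\beta\in\mathrm{Hom}_R(L,L')$ such that $\beta\xi=\xi'\alpha$ in $\mathrm{Ext}^1_R(N,L')$, where $\beta\xi$ is the push-forward of $\xi$ along $\beta$ and $\xi'\alpha$ is the pull-back of $\xi'$ along $\alpha$. Composition is componentwise. *)

theory Defs
  imports
    "HOL-Algebra.Algebra"
    "HOL-Algebra.Algebraic_Closure_Type"
    "HOL-Library.Extended_Nat"
    "HOL-Library.FuncSet"
    "HOL-Computational_Algebra.Formal_Power_Series"
begin

section \<open>Categories and equivalence of categories\<close>

text \<open>
  Hom-sets belonging to different pairs of objects need not be disjoint, so composition and the
  arrow part of a functor carry their source and target objects as arguments.
  \<open>Comp C A B D g f\<close> is the composite of \<open>f : A \<rightarrow> B\<close> and \<open>g : B \<rightarrow> D\<close>.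
\<close>

record ('o, 'a) cat =
  Obj :: "'o set"
  Hom :: "'o \<Rightarrow> 'o \<Rightarrow> 'a set"
  Id :: "'o \<Rightarrow> 'a"
  Comp :: "'o \<Rightarrow> 'o \<Rightarrow> 'o \<Rightarrow> 'a \<Rightarrow> 'a \<Rightarrow> 'a"

locale category =
  fixes C :: "('o, 'a) cat"
  assumes Id_closed: "A \<in> Obj C \<Longrightarrow> Id C A \<in> Hom C A A"
    and Comp_closed: "\<lbrakk>A \<in> Obj C; B \<in> Obj C; D \<in> Obj C; f \<in> Hom C A B; g \<in> Hom C B D\<rbrakk>
      \<Longrightarrow> Comp C A B D g f \<in> Hom C A D"
    and Comp_Id_right: "\<lbrakk>A \<in> Obj C; B \<in> Obj C; f \<in> Hom C A B\<rbrakk>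
      \<Longrightarrow> Comp C A A B f (Id C A) = f"
    and Comp_Id_left: "\<lbrakk>A \<in> Obj C; B \<in> Obj C; f \<in> Hom C A B\<rbrakk>
      \<Longrightarrow> Comp C A B B (Id C B) f = f"
    and Comp_assoc: "\<lbrakk>A \<in> Obj C; B \<in> Obj C; D \<in> Obj C; E \<in> Obj C;
        f \<in> Hom C A B; g \<in> Hom C B D; h \<in> Hom C D E\<rbrakk>
      \<Longrightarrow> Comp C A D E h (Comp C A B D g f) = Comp C A B E (Comp C B D E h g) f"

definition is_iso :: "('o, 'a) cat \<Rightarrow> 'o \<Rightarrow> 'o \<Rightarrow> 'a \<Rightarrow> bool" where
  "is_iso C A B f \<longleftrightarrow> f \<in> Hom C A B \<and>
     (\<exists>g \<in> Hom C B A. Comp C A B A g f = Id C A \<and> Comp C B A B f g = Id C B)"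

record ('o, 'a, 'p, 'b) func =
  obj_map :: "'o \<Rightarrow> 'p"
  hom_map :: "'o \<Rightarrow> 'o \<Rightarrow> 'a \<Rightarrow> 'b"

locale is_functor =
  fixes C :: "('o, 'a) cat" and D :: "('p, 'b) cat" and F :: "('o, 'a, 'p, 'b) func"
  assumes obj_closed: "A \<in> Obj C \<Longrightarrow> obj_map F A \<in> Obj D"
    and hom_closed: "\<lbrakk>A \<in> Obj C; B \<in> Obj C; f \<in> Hom C A B\<rbrakk>
      \<Longrightarrow> hom_map F A B f \<in> Hom D (obj_map F A) (obj_map F B)"
    and hom_Id: "A \<in> Obj C \<Longrightarrow> hom_map F A A (Id C A) = Id D (obj_map F A)"
    and hom_Comp: "\<lbrakk>A \<in> Obj C; B \<in> Obj C; E \<in> Obj C; f \<in> Hom C A B; g \<in> Hom C B E\<rbrakk>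
      \<Longrightarrow> hom_map F A E (Comp C A B E g f) =
          Comp D (obj_map F A) (obj_map F B) (obj_map F E) (hom_map F B E g) (hom_map F A B f)"

definition id_func :: "('o, 'a, 'o, 'a) func" where
  "id_func = \<lparr>obj_map = (\<lambda>A. A), hom_map = (\<lambda>A B f. f)\<rparr>"

definition comp_func ::
  "('p, 'b, 'q, 'c) func \<Rightarrow> ('o, 'a, 'p, 'b) func \<Rightarrow> ('o, 'a, 'q, 'c) func" where
  "comp_func G F = \<lparr>obj_map = (\<lambda>A. obj_map G (obj_map F A)),
     hom_map = (\<lambda>A B f. hom_map G (obj_map F A) (obj_map F B) (hom_map F A B f))\<rparr>"

definition natural_iso ::
  "('o, 'a) cat \<Rightarrow> ('p, 'b) cat \<Rightarrow> ('o, 'a, 'p, 'b) func \<Rightarrow> ('o, 'a, 'p, 'b) func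
    \<Rightarrow> ('o \<Rightarrow> 'b) \<Rightarrow> bool" where
  "natural_iso C D F G \<eta> \<longleftrightarrow>
     (\<forall>A \<in> Obj C. is_iso D (obj_map F A) (obj_map G A) (\<eta> A)) \<and>
     (\<forall>A \<in> Obj C. \<forall>B \<in> Obj C. \<forall>f \<in> Hom C A B.
        Comp D (obj_map F A) (obj_map F B) (obj_map G B) (\<eta> B) (hom_map F A B f) =
        Comp D (obj_map F A) (obj_map G A) (obj_map G B) (hom_map G A B f) (\<eta> A))"

definition equivalent_categories :: "('o, 'a) cat \<Rightarrow> ('p, 'b) cat \<Rightarrow> bool" where
  "equivalent_categories C D \<longleftrightarrow> category C \<and> category D \<and>
     (\<exists>F G \<eta> \<epsilon>. is_functor C D F \<and> is_functor D C G \<and>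
        natural_iso C C id_func (comp_func G F) \<eta> \<and>
        natural_iso D D (comp_func F G) id_func \<epsilon>)"


section \<open>Modules\<close>

text \<open>
  The records of HOL-Algebra's \<^locale>\<open>module\<close> extend ring records; their fields \<open>mult\<close> and
  \<open>one\<close> have no meaning for a module.  Below they are filled with whatever the library
  construction on the underlying ring record provides.
  Homomorphisms are extensional, so that they are equal iff they agree on the carrier.
\<close>

definition mod_hom ::
  "('r, 'x) ring_scheme \<Rightarrow> ('r, 'm) module \<Rightarrow> ('r, 'n) module \<Rightarrow> ('m \<Rightarrow> 'n) set" where
  "mod_hom R M N = {f \<in> carrier M \<rightarrow>\<^sub>E carrier N.
     (\<forall>x \<in> carrier M. \<forall>y \<in> carrier M. f (x \<oplus>\<^bsub>M\<^esub> y) = f x \<oplus>\<^bsub>N\<^esub> f y) \<and>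
     (\<forall>r \<in> carrier R. \<forall>x \<in> carrier M. f (r \<odot>\<^bsub>M\<^esub> x) = r \<odot>\<^bsub>N\<^esub> f x)}"

definition finitely_generated :: "('r, 'x) ring_scheme \<Rightarrow> ('r, 'm) module \<Rightarrow> bool" where
  "finitely_generated R M \<longleftrightarrow> (\<exists>S. finite S \<and> S \<subseteq> carrier M \<and>
     (\<forall>m \<in> carrier M. \<exists>c \<in> S \<rightarrow> carrier R. m = (\<Oplus>\<^bsub>M\<^esub>s\<in>S. c s \<odot>\<^bsub>M\<^esub> s)))"

definition restrict_scalars :: "('r \<Rightarrow> 's) \<Rightarrow> ('s, 'm) module \<Rightarrow> ('r, 'm) module" where
  "restrict_scalars h M = ring.extend (ring.truncate M) (module.fields (\<lambda>r x. h r \<odot>\<^bsub>M\<^esub> x))"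

definition direct_sum ::
  "('r, 'm) module \<Rightarrow> ('r, 'n) module \<Rightarrow> ('r, 'm \<times> 'n) module" where
  "direct_sum M N = ring.extend (RDirProd M N)
     (module.fields (\<lambda>r (x, y). (r \<odot>\<^bsub>M\<^esub> x, r \<odot>\<^bsub>N\<^esub> y)))"

definition quotient_module :: "('r, 'm) module \<Rightarrow> 'm set \<Rightarrow> ('r, 'm set) module" where
  "quotient_module M H = ring.extend (M Quot H)
     (module.fields (\<lambda>r C. \<Union>x\<in>C. H +>\<^bsub>M\<^esub> (r \<odot>\<^bsub>M\<^esub> x)))"


section \<open>Maximal Cohen--Macaulay modules\<close>

definition krull_dim :: "('r, 'x) ring_scheme \<Rightarrow> enat" where
  "krull_dim R = Sup {enat n | n. \<exists>p :: nat \<Rightarrow> 'r set.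
     (\<forall>i\<le>n. primeideal (p i) R) \<and> (\<forall>i<n. p i \<subset> p (Suc i))}"

text \<open>\<open>seq_mult M [a\<^sub>1, \<dots>, a\<^sub>n]\<close> is the submodule \<open>(a\<^sub>1, \<dots>, a\<^sub>n) M\<close>.\<close>

fun seq_mult :: "('r, 'm) module \<Rightarrow> 'r list \<Rightarrow> 'm set" where
  "seq_mult M [] = {\<zero>\<^bsub>M\<^esub>}"
| "seq_mult M (a # as) =
     {(a \<odot>\<^bsub>M\<^esub> x) \<oplus>\<^bsub>M\<^esub> y | x y. x \<in> carrier M \<and> y \<in> seq_mult M as}"

definition regular_sequence :: "('r, 'm) module \<Rightarrow> 'r list \<Rightarrow> bool" where
  "regular_sequence M as \<longleftrightarrow>
     (\<forall>i < length as. \<forall>x \<in> carrier M.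
        (as ! i) \<odot>\<^bsub>M\<^esub> x \<in> seq_mult M (take i as) \<longrightarrow> x \<in> seq_mult M (take i as)) \<and>
     seq_mult M as \<noteq> carrier M"

text \<open>For a local ring \<open>R\<close>; the \<open>THE\<close> picks out its maximal ideal.\<close>

definition depth :: "('r, 'x) ring_scheme \<Rightarrow> ('r, 'm) module \<Rightarrow> enat" where
  "depth R M = Sup {enat (length as) | as.
     set as \<subseteq> (THE I. maximalideal I R) \<and> regular_sequence M as}"

definition maximal_CM :: "('r, 'x) ring_scheme \<Rightarrow> ('r, 'm) module \<Rightarrow> bool" where
  "maximal_CM R M \<longleftrightarrow> module R M \<and> finitely_generated R M \<and>
     (carrier M = {\<zero>\<^bsub>M\<^esub>} \<or> depth R M = krull_dim R)"

text \<open>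
  The modules in this category are those whose carrier is a set of elements of the type \<open>'m\<close>,
  which plays the role of a universe.  If \<open>R\<close> injects into \<open>'m\<close> (and is infinite), every
  finitely generated \<open>R\<close>-module is isomorphic to one of these.
\<close>

definition CM :: "('r, 'x) ring_scheme \<Rightarrow> (('r, 'm) module, 'm \<Rightarrow> 'm) cat" where
  "CM R = \<lparr>Obj = {M. maximal_CM R M}, Hom = mod_hom R,
     Id = (\<lambda>M. \<lambda>x\<in>carrier M. x), Comp = (\<lambda>L M N g f. compose (carrier L) g f)\<rparr>"


section \<open>The bifunctor Ext\<close>

text \<open>
  An extension \<open>0 \<rightarrow> L \<rightarrow> E \<rightarrow> N \<rightarrow> 0\<close> is a triple \<open>(E, i, p)\<close>.  \<open>Ext1 R N L\<close> is the set of
  equivalence classes of those extensions whose middle term lives on the same type \<open>'m\<close> as \<open>N\<close>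
  and \<open>L\<close>.  The canonical push-out and pull-back are built on other types; \<open>ext_class\<close> therefore
  accepts a representative with a middle term on an arbitrary type.
\<close>

type_synonym ('r, 'm, 'e) ext = "('r, 'e) module \<times> ('m \<Rightarrow> 'e) \<times> ('e \<Rightarrow> 'm)"

definition extensions ::
  "('r, 'x) ring_scheme \<Rightarrow> ('r, 'm) module \<Rightarrow> ('r, 'm) module \<Rightarrow> ('r, 'm, 'e) ext set" where
  "extensions R N L = {(E, i, p). module R E \<and> i \<in> mod_hom R L E \<and> p \<in> mod_hom R E N \<and>
     inj_on i (carrier L) \<and> i ` carrier L = {e \<in> carrier E. p e = \<zero>\<^bsub>N\<^esub>} \<and>
     p ` carrier E = carrier N}"

definition ext_equiv ::
  "('r, 'x) ring_scheme \<Rightarrow> ('r, 'm) module \<Rightarrow> ('r, 'm, 'e) ext \<Rightarrow> ('r, 'm, 'd) ext \<Rightarrow> bool" where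
  "ext_equiv R L = (\<lambda>(E, i, p) (E', i', p'). \<exists>f \<in> mod_hom R E E'.
     bij_betw f (carrier E) (carrier E') \<and>
     (\<forall>l \<in> carrier L. f (i l) = i' l) \<and> (\<forall>e \<in> carrier E. p' (f e) = p e))"

definition ext_class ::
  "('r, 'x) ring_scheme \<Rightarrow> ('r, 'm) module \<Rightarrow> ('r, 'm) module \<Rightarrow> ('r, 'm, 'e) ext
    \<Rightarrow> ('r, 'm, 'm) ext set" where
  "ext_class R N L e = {e' \<in> extensions R N L. ext_equiv R L e e'}"

definition Ext1 ::
  "('r, 'x) ring_scheme \<Rightarrow> ('r, 'm) module \<Rightarrow> ('r, 'm) module \<Rightarrow> ('r, 'm, 'm) ext set set" where
  "Ext1 R N L = ext_class R N L ` (extensions R N L :: ('r, 'm, 'm) ext set)"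

text \<open>Push-out of an extension of \<open>N\<close> by \<open>L\<close> along \<open>\<beta> : L \<rightarrow> L'\<close>, with middle term
  \<open>(E \<oplus> L') / {(i l, - \<beta> l) | l \<in> L}\<close>.\<close>

definition pushout_ext ::
  "('r, 'm) module \<Rightarrow> ('r, 'm) module \<Rightarrow> ('m \<Rightarrow> 'm) \<Rightarrow> ('r, 'm, 'e) ext
    \<Rightarrow> ('r, 'm, ('e \<times> 'm) set) ext" where
  "pushout_ext L L' \<beta> = (\<lambda>(E, i, p).
     let S = direct_sum E L';
         H = {(i l, \<ominus>\<^bsub>L'\<^esub> \<beta> l) | l. l \<in> carrier L};
         Q = quotient_module S H
     in (Q, \<lambda>l'\<in>carrier L'. H +>\<^bsub>S\<^esub> (\<zero>\<^bsub>E\<^esub>, l'), \<lambda>C\<in>carrier Q. the_elem ((\<lambda>(e, l'). p e) ` C)))"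

text \<open>Pull-back of an extension of \<open>N'\<close> by \<open>L\<close> along \<open>\<alpha> : N \<rightarrow> N'\<close>, with middle term
  \<open>E \<times>\<^bsub>N'\<^esub> N\<close>.\<close>

definition pullback_ext ::
  "('r, 'm) module \<Rightarrow> ('r, 'm) module \<Rightarrow> ('m \<Rightarrow> 'm) \<Rightarrow> ('r, 'm, 'e) ext
    \<Rightarrow> ('r, 'm, 'e \<times> 'm) ext" where
  "pullback_ext N L \<alpha> = (\<lambda>(E, i, p).
     let K = {(e, n). e \<in> carrier E \<and> n \<in> carrier N \<and> p e = \<alpha> n}
     in ((direct_sum E N)\<lparr>carrier := K\<rparr>, \<lambda>l\<in>carrier L. (i l, \<zero>\<^bsub>N\<^esub>), \<lambda>z\<in>K. snd z))"

text \<open>The unions run over the representatives of the class \<open>\<xi>\<close>, all of which contribute the same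
  class.\<close>

definition ext_push ::
  "('r, 'x) ring_scheme \<Rightarrow> ('r, 'm) module \<Rightarrow> ('r, 'm) module \<Rightarrow> ('r, 'm) module \<Rightarrow> ('m \<Rightarrow> 'm)
    \<Rightarrow> ('r, 'm, 'm) ext set \<Rightarrow> ('r, 'm, 'm) ext set" where
  "ext_push R N L L' \<beta> \<xi> = (\<Union>e\<in>\<xi>. ext_class R N L' (pushout_ext L L' \<beta> e))"

definition ext_pull ::
  "('r, 'x) ring_scheme \<Rightarrow> ('r, 'm) module \<Rightarrow> ('r, 'm) module \<Rightarrow> ('m \<Rightarrow> 'm)
    \<Rightarrow> ('r, 'm, 'm) ext set \<Rightarrow> ('r, 'm, 'm) ext set" where
  "ext_pull R N L \<alpha> \<xi> = (\<Union>e\<in>\<xi>. ext_class R N L (pullback_ext N L \<alpha> e))"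

text \<open>
  The category of elements of \<open>Ext\<^sup>1\<^bsub>R\<^esub>\<close> as a bimodule over \<open>CM A\<close> and \<open>CM B\<close>, where
  \<open>A\<close>-modules and \<open>B\<close>-modules become \<open>R\<close>-modules via ring homomorphisms \<open>a : R \<rightarrow> A\<close> and
  \<open>b : R \<rightarrow> B\<close>.
\<close>

definition Ext_elements ::
  "('r, 'x) ring_scheme \<Rightarrow> ('s, 'y) ring_scheme \<Rightarrow> ('t, 'z) ring_scheme
    \<Rightarrow> ('r \<Rightarrow> 's) \<Rightarrow> ('r \<Rightarrow> 't)
    \<Rightarrow> (('s, 'm) module \<times> ('t, 'm) module \<times> ('r, 'm, 'm) ext set, ('m \<Rightarrow> 'm) \<times> ('m \<Rightarrow> 'm)) cat" where
  "Ext_elements R A B a b =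
    \<lparr>Obj = {(N, L, \<xi>). N \<in> Obj (CM A) \<and> L \<in> Obj (CM B) \<and>
        \<xi> \<in> Ext1 R (restrict_scalars a N) (restrict_scalars b L)},
     Hom = (\<lambda>(N, L, \<xi>) (N', L', \<xi>'). {(\<alpha>, \<beta>).
        \<alpha> \<in> mod_hom R (restrict_scalars a N) (restrict_scalars a N') \<and>
        \<beta> \<in> mod_hom R (restrict_scalars b L) (restrict_scalars b L') \<and>
        ext_push R (restrict_scalars a N) (restrict_scalars b L) (restrict_scalars b L') \<beta> \<xi> =
        ext_pull R (restrict_scalars a N) (restrict_scalars b L') \<alpha> \<xi>'}),
     Id = (\<lambda>(N, L, \<xi>). (\<lambda>x\<in>carrier N. x, \<lambda>x\<in>carrier L. x)),
     Comp = (\<lambda>(N, L, \<xi>) _ _ (\<alpha>', \<beta>') (\<alpha>, \<beta>).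
        (compose (carrier N) \<alpha>' \<alpha>, compose (carrier L) \<beta>' \<beta>))\<rparr>"


section \<open>The ring of the singularity\<close>

text \<open>\<open>\<bbbk>[[X, Y]]\<close> is represented as \<open>\<bbbk>[[X]][[Y]]\<close>, i.e. by the type \<open>'k fps fps\<close>.\<close>

definition var_X :: "'k :: field fps fps" where "var_X = fps_const fps_X"
definition var_Y :: "'k :: field fps fps" where "var_Y = fps_X"

definition F_poly :: "'k :: field \<Rightarrow> 'k fps fps" where
  "F_poly lam = var_X * var_Y * (var_X - var_Y) * (var_X - fps_const (fps_const lam) * var_Y)"

definition R_ring :: "'k :: field \<Rightarrow> 'k fps fps set ring" where
  "R_ring lam = ring_of_type_algebra Quot (PIdl\<^bsub>ring_of_type_algebra\<^esub> (F_poly lam))"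

text \<open>The substitution \<open>X \<mapsto> a t\<close>, \<open>Y \<mapsto> b t\<close>: the monomial \<open>X\<^sup>i Y\<^sup>j\<close> goes to
  \<open>a\<^sup>i b\<^sup>j t\<^sup>i\<^sup>+\<^sup>j\<close>.\<close>

definition subst_line :: "'k :: field \<Rightarrow> 'k \<Rightarrow> 'k fps fps \<Rightarrow> 'k fps" where
  "subst_line a b f = Abs_fps (\<lambda>n. \<Sum>j\<le>n. fps_nth (fps_nth f j) (n - j) * a ^ (n - j) * b ^ j)"

text \<open>The map with \<open>X \<mapsto> (t, 0, t, \<lambda>t)\<close> and \<open>Y \<mapsto> (0, t, t, t)\<close>.\<close>

definition branches :: "'k :: field \<Rightarrow> 'k fps fps \<Rightarrow> 'k fps \<times> 'k fps \<times> 'k fps \<times> 'k fps" where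
  "branches lam f = (subst_line 1 0 f, subst_line 0 1 f, subst_line 1 1 f, subst_line lam 1 f)"

text \<open>The embedding of \<open>R\<close> into \<open>R\<^sub>1 \<times> R\<^sub>2 \<times> R\<^sub>3 \<times> R\<^sub>4\<close> induced by \<^const>\<open>branches\<close>, which is
  constant on the cosets of \<open>(F)\<close>.\<close>

definition R_embed :: "'k :: field \<Rightarrow> 'k fps fps set \<Rightarrow> 'k fps \<times> 'k fps \<times> 'k fps \<times> 'k fps" where
  "R_embed lam r = the_elem (branches lam ` r)"

definition pr12 :: "'k :: field \<Rightarrow> 'k fps fps set \<Rightarrow> 'k fps \<times> 'k fps" where
  "pr12 lam r = (case R_embed lam r of (f1, f2, f3, f4) \<Rightarrow> (f1, f2))"

definition pr34 :: "'k :: field \<Rightarrow> 'k fps fps set \<Rightarrow> 'k fps \<times> 'k fps" where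
  "pr34 lam r = (case R_embed lam r of (f1, f2, f3, f4) \<Rightarrow> (f3, f4))"

definition R12 :: "'k :: field \<Rightarrow> ('k fps \<times> 'k fps) ring" where
  "R12 lam = (RDirProd ring_of_type_algebra ring_of_type_algebra)
     \<lparr>carrier := pr12 lam ` carrier (R_ring lam)\<rparr>"

definition R34 :: "'k :: field \<Rightarrow> ('k fps \<times> 'k fps) ring" where
  "R34 lam = (RDirProd ring_of_type_algebra ring_of_type_algebra)
     \<lparr>carrier := pr34 lam ` carrier (R_ring lam)\<rparr>"

end

theory Submission
  imports Defs
begin

text \<open>
  Let \<open>f\<close> and \<open>g\<close> be elements of \<open>R\<close> that vanish on the branches of \<open>R\<^sub>1\<^sub>2\<close> and of \<open>R\<^sub>3\<^sub>4\<close> respectively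
  and are a power of \<open>t\<close> on the two other branches.  The ideal \<open>(f, g)\<close> contains all elements of high
  order, so an element of a Cohen--Macaulay module that is killed by \<open>f\<close> and \<open>g\<close> is zero.  For a
  Cohen--Macaulay \<open>R\<close>-module \<open>M\<close> the kernel \<open>L\<close> of multiplication by \<open>g\<close> is therefore a module over
  \<open>R\<^sub>3\<^sub>4\<close>, its image \<open>N = g M\<close> is a module over \<open>R\<^sub>1\<^sub>2\<close>, and \<open>M\<close> is an extension of \<open>N\<close> by \<open>L\<close>.  This
  functor is faithful because \<open>Hom(N, L') = 0\<close>.  It is full because the equation \<open>\<beta>\<xi> = \<xi>'\<alpha>\<close> says
  precisely that \<open>(\<alpha>, \<beta>)\<close> extends to a homomorphism of the middle terms.  Every \<open>\<xi>\<close> is reached from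
  its own middle term.

  Over all three rings, the maximal Cohen--Macaulay modules are the finitely generated modules
  without elements killed by the maximal ideal; the conductor into the product of the branches
  gives dimension one and the bound on the depth.
\<close>

section \<open>Equivalences of categories\<close>

text \<open>All modules live on one type \<open>'m\<close>, and this shapes two constructions. The
  quotient of a module by the kernel of \<open>g\<close> is realised as the image of
  \<open>g\<close>, which stays inside the module. The middle term of a push-out, built from cosets
  of pairs, is moved back to \<open>'m\<close>; this works for infinite \<open>'m\<close>, because a
  middle term is, as a set, the product of its two ends. Without a representative on
  \<open>'m\<close> a class would be the empty set, and an equation between push-forward and
  pull-back would say nothing.

  The constants come from the four linear forms. A product of three of them is zero on three lines
  and a scalar times t^3 on the fourth, and the scalar is nonzero because lambda is neither 0 nor 1.
  Hence the ring contains every tuple of series of order at least 3. With f and g equal to t^3 on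
  their branches, f + g is t^3 everywhere, and a ring element of order at least 6 is f + g times a
  cofactor of order at least 3, which again lies in the ring.

  Apart from this computation, the ring theory is done for subrings of finite products of power
  series rings, so that it serves all three rings at once.\<close>

theorem fully_faithful_ess_surj_equivalence:
  fixes C :: "('o, 'a) cat" and D :: "('p, 'b) cat" and F :: "('o, 'a, 'p, 'b) func"
  assumes C: "category C" and D: "category D" and F: "is_functor C D F"
    and faithful: "\<And>A B f f'. \<lbrakk>A \<in> Obj C; B \<in> Obj C; f \<in> Hom C A B; f' \<in> Hom C A B;
       hom_map F A B f = hom_map F A B f'\<rbrakk> \<Longrightarrow> f = f'"
    and full: "\<And>A B h. \<lbrakk>A \<in> Obj C; B \<in> Obj C; h \<in> Hom D (obj_map F A) (obj_map F B)\<rbrakk>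
       \<Longrightarrow> \<exists>f \<in> Hom C A B. hom_map F A B f = h"
    and surj: "\<And>V. V \<in> Obj D \<Longrightarrow> \<exists>A \<in> Obj C. \<exists>e. is_iso D (obj_map F A) V e"
  shows "equivalent_categories C D"
proof -
  interpret C: category C by (rule C)
  interpret D: category D by (rule D)
  interpret F: is_functor C D F by (rule F)
  let ?F = "obj_map F"
  define P where "P V = (SOME A. A \<in> Obj C \<and> (\<exists>e. is_iso D (?F A) V e))" for V
  have P: "P V \<in> Obj C" "\<exists>e. is_iso D (?F (P V)) V e" if "V \<in> Obj D" for V
    using someI_ex[of "\<lambda>A. A \<in> Obj C \<and> (\<exists>e. is_iso D (?F A) V e)"] surj[OF that]
    unfolding P_def by blast+
  define e where "e V = (SOME e. is_iso D (?F (P V)) V e)" for V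
  have e_iso: "is_iso D (?F (P V)) V (e V)" if "V \<in> Obj D" for V
    using someI_ex[OF P(2)[OF that]] unfolding e_def .
  define e' where "e' V = (SOME g. g \<in> Hom D V (?F (P V)) \<and>
      Comp D (?F (P V)) V (?F (P V)) g (e V) = Id D (?F (P V)) \<and>
      Comp D V (?F (P V)) V (e V) g = Id D V)" for V
  have e: "e V \<in> Hom D (?F (P V)) V" if "V \<in> Obj D" for V
    using e_iso[OF that] unfolding is_iso_def by blast
  have e': "e' V \<in> Hom D V (?F (P V))"
      "Comp D (?F (P V)) V (?F (P V)) (e' V) (e V) = Id D (?F (P V))"
      "Comp D V (?F (P V)) V (e V) (e' V) = Id D V" if "V \<in> Obj D" for V
    using someI_ex[of "\<lambda>g. g \<in> Hom D V (?F (P V)) \<and>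
      Comp D (?F (P V)) V (?F (P V)) g (e V) = Id D (?F (P V)) \<and>
      Comp D V (?F (P V)) V (e V) g = Id D V"] e_iso[OF that]
    unfolding is_iso_def e'_def by blast+
  define lift where "lift A B h = (SOME f. f \<in> Hom C A B \<and> hom_map F A B f = h)" for A B h
  have lift: "lift A B h \<in> Hom C A B" "hom_map F A B (lift A B h) = h"
    if "A \<in> Obj C" "B \<in> Obj C" "h \<in> Hom D (?F A) (?F B)" for A B h
    using someI_ex[of "\<lambda>f. f \<in> Hom C A B \<and> hom_map F A B f = h"] full[OF that]
    unfolding lift_def by blast+
  \<comment> \<open>\<open>down\<close> conjugates \<open>h\<close> with the chosen isomorphisms;
    \<open>lift\<close> then supplies an arrow of \<open>C\<close> above it.\<close>
  define down where "down V Y h = Comp D (?F (P V)) Y (?F (P Y)) (e' Y) (Comp D (?F (P V)) V Y h (e V))"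
    for V Y h
  have FP: "?F (P V) \<in> Obj D" if "V \<in> Obj D" for V
    using P(1)[OF that] F.obj_closed by blast
  have down: "down V Y h \<in> Hom D (?F (P V)) (?F (P Y))"
    if "V \<in> Obj D" "Y \<in> Obj D" "h \<in> Hom D V Y" for V Y h
    unfolding down_def using that e e'(1) FP by (meson D.Comp_closed)
  have nat_down: "Comp D (?F (P V)) (?F (P Y)) Y (e Y) (down V Y h) = Comp D (?F (P V)) V Y h (e V)"
    if "V \<in> Obj D" "Y \<in> Obj D" "h \<in> Hom D V Y" for V Y h
  proof -
    have k: "Comp D (?F (P V)) V Y h (e V) \<in> Hom D (?F (P V)) Y"
      using that e FP by (meson D.Comp_closed)
    show ?thesis
      unfolding down_def
      using D.Comp_assoc[OF FP[OF that(1)] that(2) FP[OF that(2)] that(2) k e'(1)[OF that(2)] e[OF that(2)]]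
        e'(3)[OF that(2)] D.Comp_Id_left[OF FP[OF that(1)] that(2) k] by simp
  qed
  \<comment> \<open>Since \<open>e Y\<close> is invertible, the naturality square of
    \<open>h\<close> has only one filler. That \<open>G\<close> preserves identities and composition
    follows by exhibiting a second filler.\<close>
  have down_unique: "k = down V Y h"
    if "V \<in> Obj D" "Y \<in> Obj D" "h \<in> Hom D V Y" "k \<in> Hom D (?F (P V)) (?F (P Y))"
      "Comp D (?F (P V)) (?F (P Y)) Y (e Y) k = Comp D (?F (P V)) V Y h (e V)" for V Y h k
    unfolding down_def that(5)[symmetric]
    using D.Comp_assoc[OF FP[OF that(1)] FP[OF that(2)] that(2) FP[OF that(2)] that(4) e[OF that(2)] e'(1)[OF that(2)]]
      e'(2)[OF that(2)] D.Comp_Id_left[OF FP[OF that(1)] FP[OF that(2)] that(4)] by simp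
  define G where "G = \<lparr>obj_map = P, hom_map = (\<lambda>V Y h. lift (P V) (P Y) (down V Y h))\<rparr>"
  have G: "is_functor D C G"
  proof
    show "obj_map G V \<in> Obj C" if "V \<in> Obj D" for V
      using P(1)[OF that] by (simp add: G_def)
    show "hom_map G V Y h \<in> Hom C (obj_map G V) (obj_map G Y)"
      if "V \<in> Obj D" "Y \<in> Obj D" "h \<in> Hom D V Y" for V Y h
      using lift(1) P(1) down that by (simp add: G_def)
    show "hom_map G V V (Id D V) = Id C (obj_map G V)" if V: "V \<in> Obj D" for V
    proof -
      have "Id D (?F (P V)) = down V V (Id D V)"
        by (intro down_unique)
          (use V FP e D.Id_closed D.Comp_Id_left D.Comp_Id_right in auto)
      moreover have "hom_map F (P V) (P V) (Id C (P V)) = Id D (?F (P V))"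
        using F.hom_Id P V by blast
      moreover note lift[OF P(1)[OF V] P(1)[OF V] down[OF V V D.Id_closed[OF V]]]
      ultimately show ?thesis
        using faithful[OF P(1)[OF V] P(1)[OF V] _ C.Id_closed[OF P(1)[OF V]]] by (simp add: G_def)
    qed
    show "hom_map G V Z (Comp D V Y Z k h) =
          Comp C (obj_map G V) (obj_map G Y) (obj_map G Z) (hom_map G Y Z k) (hom_map G V Y h)"
      if V: "V \<in> Obj D" and Y: "Y \<in> Obj D" and Z: "Z \<in> Obj D"
        and h: "h \<in> Hom D V Y" and k: "k \<in> Hom D Y Z" for V Y Z h k
    proof -
      let ?h = "down V Y h" and ?k = "down Y Z k"
      note dh = down[OF V Y h] and dk = down[OF Y Z k]
      note kh = D.Comp_closed[OF V Y Z h k]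
      have c: "Comp D (?F (P V)) (?F (P Y)) (?F (P Z)) ?k ?h = down V Z (Comp D V Y Z k h)"
      proof (rule down_unique[OF V Z kh])
        show "Comp D (?F (P V)) (?F (P Y)) (?F (P Z)) ?k ?h \<in> Hom D (?F (P V)) (?F (P Z))"
          using D.Comp_closed FP V Y Z dh dk by blast
        have "Comp D (?F (P V)) (?F (P Z)) Z (e Z) (Comp D (?F (P V)) (?F (P Y)) (?F (P Z)) ?k ?h)
            = Comp D (?F (P V)) (?F (P Y)) Z (Comp D (?F (P Y)) Y Z k (e Y)) ?h"
          using D.Comp_assoc[OF FP[OF V] FP[OF Y] FP[OF Z] Z dh dk e[OF Z]] nat_down[OF Y Z k] by simp
        also have "\<dots> = Comp D (?F (P V)) Y Z k (Comp D (?F (P V)) V Y h (e V))"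
          using D.Comp_assoc[OF FP[OF V] FP[OF Y] Y Z dh e[OF Y] k] nat_down[OF V Y h] by simp
        also have "\<dots> = Comp D (?F (P V)) V Z (Comp D V Y Z k h) (e V)"
          using D.Comp_assoc[OF FP[OF V] V Y Z e[OF V] h k] by simp
        finally show "Comp D (?F (P V)) (?F (P Z)) Z (e Z) (Comp D (?F (P V)) (?F (P Y)) (?F (P Z)) ?k ?h)
            = Comp D (?F (P V)) V Z (Comp D V Y Z k h) (e V)" .
      qed
      note l1 = lift[OF P(1)[OF V] P(1)[OF Y] dh] and l2 = lift[OF P(1)[OF Y] P(1)[OF Z] dk]
      note l3 = lift[OF P(1)[OF V] P(1)[OF Z] down[OF V Z kh]]
      have "lift (P V) (P Z) (down V Z (Comp D V Y Z k h)) =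
          Comp C (P V) (P Y) (P Z) (lift (P Y) (P Z) ?k) (lift (P V) (P Y) ?h)"
        using faithful[OF P(1)[OF V] P(1)[OF Z] l3(1)
            C.Comp_closed[OF P(1)[OF V] P(1)[OF Y] P(1)[OF Z] l1(1) l2(1)]]
          F.hom_Comp[OF P(1)[OF V] P(1)[OF Y] P(1)[OF Z] l1(1) l2(1)] l1(2) l2(2) l3(2) c by simp
      then show ?thesis by (simp add: G_def)
    qed
  qed
  have FG: "natural_iso D D (comp_func F G) id_func e"
    using e_iso nat_down down lift(2) P(1)
    unfolding natural_iso_def comp_func_def id_func_def G_def by auto
  have FA: "?F A \<in> Obj D" if "A \<in> Obj C" for A using F.obj_closed that by blast
  \<comment> \<open>The unit lies above the inverse isomorphism \<open>e'\<close>; faithfulness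
    carries the inverse laws and naturality from \<open>D\<close> back to \<open>C\<close>.\<close>
  define \<eta> where "\<eta> A = lift A (P (?F A)) (e' (?F A))" for A
  have eta: "\<eta> A \<in> Hom C A (P (?F A))" "hom_map F A (P (?F A)) (\<eta> A) = e' (?F A)"
    if "A \<in> Obj C" for A
    using lift that P(1) FA e'(1) by (simp_all add: \<eta>_def)
  have eta_iso: "is_iso C A (P (?F A)) (\<eta> A)" if A: "A \<in> Obj C" for A
  proof -
    let ?V = "?F A" and ?Q = "P (?F A)"
    note V = FA[OF A] note Q = P(1)[OF V]
    obtain g where g: "g \<in> Hom C ?Q A" "hom_map F ?Q A g = e ?V"
      using full[OF Q A e[OF V]] by blast
    have "Comp C A ?Q A g (\<eta> A) = Id C A"
      using F.hom_Comp[OF A Q A eta(1)[OF A] g(1)] g(2) eta(2)[OF A] e'(3)[OF V] F.hom_Id[OF A]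
      by (intro faithful[OF A A C.Comp_closed[OF A Q A eta(1)[OF A] g(1)] C.Id_closed[OF A]]) simp
    moreover have "Comp C ?Q A ?Q (\<eta> A) g = Id C ?Q"
      using F.hom_Comp[OF Q A Q g(1) eta(1)[OF A]] g(2) eta(2)[OF A] e'(2)[OF V] F.hom_Id[OF Q]
      by (intro faithful[OF Q Q C.Comp_closed[OF Q A Q g(1) eta(1)[OF A]] C.Id_closed[OF Q]]) simp
    ultimately show ?thesis
      unfolding is_iso_def using eta(1)[OF A] g(1) by blast
  qed
  have eta_nat: "Comp C A B (P (?F B)) (\<eta> B) f =
      Comp C A (P (?F A)) (P (?F B)) (hom_map G (?F A) (?F B) (hom_map F A B f)) (\<eta> A)"
    if A: "A \<in> Obj C" and B: "B \<in> Obj C" and f: "f \<in> Hom C A B" for A B f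
  proof -
    let ?V = "?F A" and ?Y = "?F B" and ?h = "hom_map F A B f"
    note V = FA[OF A] and Y = FA[OF B] note QA = P(1)[OF V] and QB = P(1)[OF Y]
    have h: "?h \<in> Hom D ?V ?Y" using F.hom_closed A B f by blast
    note d = down[OF V Y h]
    note l = lift[OF QA QB d]
    have "hom_map F A (P ?Y) (Comp C A B (P ?Y) (\<eta> B) f) = Comp D ?V ?Y (?F (P ?Y)) (e' ?Y) ?h"
      using F.hom_Comp[OF A B QB f eta(1)[OF B]] eta(2)[OF B] by simp
    also have "\<dots> = Comp D ?V (?F (P ?V)) (?F (P ?Y)) (down ?V ?Y ?h) (e' ?V)"
    proof -
      have hx: "Comp D (?F (P ?V)) ?V ?Y ?h (e ?V) \<in> Hom D (?F (P ?V)) ?Y"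
        using D.Comp_closed FP V Y e h by blast
      show ?thesis
        unfolding down_def
        using D.Comp_assoc[OF V FP[OF V] Y FP[OF Y] e'(1)[OF V] hx e'(1)[OF Y]]
          D.Comp_assoc[OF V FP[OF V] V Y e'(1)[OF V] e[OF V] h] e'(3)[OF V]
          D.Comp_Id_right[OF V Y h] by simp
    qed
    also have "\<dots> = hom_map F A (P ?Y) (Comp C A (P ?V) (P ?Y) (lift (P ?V) (P ?Y) (down ?V ?Y ?h)) (\<eta> A))"
      using F.hom_Comp[OF A QA QB eta(1)[OF A] l(1)] eta(2)[OF A] l(2) by simp
    finally show ?thesis
      using faithful[OF A QB C.Comp_closed[OF A B QB f eta(1)[OF B]] C.Comp_closed[OF A QA QB eta(1)[OF A] l(1)]]
      by (simp add: G_def)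
  qed
  have "natural_iso C C id_func (comp_func G F) \<eta>"
    using eta_iso eta_nat
    unfolding natural_iso_def comp_func_def id_func_def by (auto simp: G_def)
  with F G FG C D show ?thesis
    unfolding equivalent_categories_def by blast
qed

section \<open>Modules\<close>

lemma mod_homI:
  assumes "f \<in> carrier M \<rightarrow>\<^sub>E carrier N"
    and "\<And>x y. \<lbrakk>x \<in> carrier M; y \<in> carrier M\<rbrakk> \<Longrightarrow> f (x \<oplus>\<^bsub>M\<^esub> y) = f x \<oplus>\<^bsub>N\<^esub> f y"
    and "\<And>r x. \<lbrakk>r \<in> carrier R; x \<in> carrier M\<rbrakk> \<Longrightarrow> f (r \<odot>\<^bsub>M\<^esub> x) = r \<odot>\<^bsub>N\<^esub> f x"
  shows "f \<in> mod_hom R M N"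
  using assms unfolding mod_hom_def by blast

lemma mod_hom_restrictI:
  assumes "module R M"
    and "\<And>x. x \<in> carrier M \<Longrightarrow> f x \<in> carrier N"
    and "\<And>x y. \<lbrakk>x \<in> carrier M; y \<in> carrier M\<rbrakk> \<Longrightarrow> f (x \<oplus>\<^bsub>M\<^esub> y) = f x \<oplus>\<^bsub>N\<^esub> f y"
    and "\<And>r x. \<lbrakk>r \<in> carrier R; x \<in> carrier M\<rbrakk> \<Longrightarrow> f (r \<odot>\<^bsub>M\<^esub> x) = r \<odot>\<^bsub>N\<^esub> f x"
  shows "restrict f (carrier M) \<in> mod_hom R M N"
proof -
  interpret M: module R M by fact
  show ?thesis using assms(2-) by (intro mod_homI) auto
qed

lemma mod_homD:
  assumes "f \<in> mod_hom R M N"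
  shows mod_hom_closed: "x \<in> carrier M \<Longrightarrow> f x \<in> carrier N"
    and mod_hom_add: "\<lbrakk>x \<in> carrier M; y \<in> carrier M\<rbrakk> \<Longrightarrow> f (x \<oplus>\<^bsub>M\<^esub> y) = f x \<oplus>\<^bsub>N\<^esub> f y"
    and mod_hom_smult: "\<lbrakk>r \<in> carrier R; x \<in> carrier M\<rbrakk> \<Longrightarrow> f (r \<odot>\<^bsub>M\<^esub> x) = r \<odot>\<^bsub>N\<^esub> f x"
    and mod_hom_extensional: "f \<in> extensional (carrier M)"
proof -
  have f: "f \<in> carrier M \<rightarrow>\<^sub>E carrier N"
      "\<forall>x \<in> carrier M. \<forall>y \<in> carrier M. f (x \<oplus>\<^bsub>M\<^esub> y) = f x \<oplus>\<^bsub>N\<^esub> f y"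
      "\<forall>r \<in> carrier R. \<forall>x \<in> carrier M. f (r \<odot>\<^bsub>M\<^esub> x) = r \<odot>\<^bsub>N\<^esub> f x"
    using assms by (simp_all add: mod_hom_def)
  show "x \<in> carrier M \<Longrightarrow> f x \<in> carrier N" using f(1) by (rule PiE_mem)
  show "\<lbrakk>x \<in> carrier M; y \<in> carrier M\<rbrakk> \<Longrightarrow> f (x \<oplus>\<^bsub>M\<^esub> y) = f x \<oplus>\<^bsub>N\<^esub> f y" using f(2) by blast
  show "\<lbrakk>r \<in> carrier R; x \<in> carrier M\<rbrakk> \<Longrightarrow> f (r \<odot>\<^bsub>M\<^esub> x) = r \<odot>\<^bsub>N\<^esub> f x" using f(3) by blast
  show "f \<in> extensional (carrier M)" using f(1) by (simp add: PiE_def)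
qed

lemma mod_hom_eqI:
  assumes "f \<in> mod_hom R M N" "g \<in> mod_hom R M N'" "\<And>x. x \<in> carrier M \<Longrightarrow> f x = g x"
  shows "f = g"
  by (rule extensionalityI[OF mod_hom_extensional[OF assms(1)] mod_hom_extensional[OF assms(2)] assms(3)])

lemma mod_hom_zero:
  assumes "f \<in> mod_hom R M N" "module R M" "module R N"
  shows "f \<zero>\<^bsub>M\<^esub> = \<zero>\<^bsub>N\<^esub>"
proof -
  interpret M: module R M by fact
  interpret N: module R N by fact
  show ?thesis
    using mod_hom_smult[OF assms(1) M.R.zero_closed M.M.zero_closed] mod_hom_closed[OF assms(1)] by simp
qed

lemma mod_hom_a_inv:
  assumes "f \<in> mod_hom R M N" "module R M" "module R N" "x \<in> carrier M"
  shows "f (\<ominus>\<^bsub>M\<^esub> x) = \<ominus>\<^bsub>N\<^esub> f x"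
proof -
  interpret M: module R M by fact
  interpret N: module R N by fact
  have "f (\<ominus>\<^bsub>M\<^esub> x) \<oplus>\<^bsub>N\<^esub> f x = \<zero>\<^bsub>N\<^esub>"
    using mod_hom_add[OF assms(1), of "\<ominus>\<^bsub>M\<^esub> x" x] mod_hom_zero[OF assms(1-3)] assms(4)
    by (simp add: M.M.l_neg)
  then show ?thesis
    using mod_hom_closed[OF assms(1)] assms(4) by (simp add: N.M.minus_equality)
qed

lemma mod_hom_minus:
  assumes "f \<in> mod_hom R M N" "module R M" "module R N" "x \<in> carrier M" "y \<in> carrier M"
  shows "f (x \<ominus>\<^bsub>M\<^esub> y) = f x \<ominus>\<^bsub>N\<^esub> f y"
proof -
  interpret M: module R M by fact
  interpret N: module R N by fact
  show ?thesis
    using mod_hom_add[OF assms(1)] mod_hom_a_inv[OF assms(1-3)] assms(4,5)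
    by (simp add: M.M.minus_eq N.M.minus_eq)
qed

lemma mod_hom_id:
  assumes "module R M" shows "(\<lambda>x\<in>carrier M. x) \<in> mod_hom R M M"
  by (rule mod_hom_restrictI[OF assms]) auto

lemma mod_hom_compose:
  assumes "module R M" "f \<in> mod_hom R M N" "g \<in> mod_hom R N P"
  shows "compose (carrier M) g f \<in> mod_hom R M P"
  unfolding compose_def
  using mod_homD[OF assms(2)] mod_homD[OF assms(3)] by (intro mod_hom_restrictI[OF assms(1)]) auto

lemma mod_hom_inv_into:
  assumes "module R M" "module R N" and f: "f \<in> mod_hom R M N" and bij: "bij_betw f (carrier M) (carrier N)"
  shows "restrict (inv_into (carrier M) f) (carrier N) \<in> mod_hom R N M"
proof -
  interpret M: module R M by fact
  interpret N: module R N by fact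
  let ?g = "inv_into (carrier M) f"
  have inj: "inj_on f (carrier M)" and im: "f ` carrier M = carrier N"
    using bij by (auto simp: bij_betw_def)
  have g: "?g y \<in> carrier M" "f (?g y) = y" if "y \<in> carrier N" for y
    using that im by (auto intro: inv_into_into f_inv_into_f)
  note h = mod_homD[OF f]
  show ?thesis
  proof (rule mod_hom_restrictI[OF assms(2)])
    show "?g x \<in> carrier M" if "x \<in> carrier N" for x using g that by blast
    show "?g (x \<oplus>\<^bsub>N\<^esub> y) = ?g x \<oplus>\<^bsub>M\<^esub> ?g y" if "x \<in> carrier N" "y \<in> carrier N" for x y
      using that g h by (intro inv_into_f_eq[OF inj]) auto
    show "?g (r \<odot>\<^bsub>N\<^esub> x) = r \<odot>\<^bsub>M\<^esub> ?g x" if "r \<in> carrier R" "x \<in> carrier N" for r x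
      using that g h by (intro inv_into_f_eq[OF inj]) auto
  qed
qed

lemma restrict_scalars_simps [simp]:
  "carrier (restrict_scalars h M) = carrier M"
  "\<zero>\<^bsub>restrict_scalars h M\<^esub> = \<zero>\<^bsub>M\<^esub>"
  "x \<oplus>\<^bsub>restrict_scalars h M\<^esub> y = x \<oplus>\<^bsub>M\<^esub> y"
  "r \<odot>\<^bsub>restrict_scalars h M\<^esub> x = h r \<odot>\<^bsub>M\<^esub> x"
  by (simp_all add: restrict_scalars_def ring.defs module.defs)

lemma module_restrict_scalars:
  assumes "cring R" "h \<in> ring_hom R A" "module A M"
  shows "module R (restrict_scalars h M)"
proof -
  interpret M: module A M by fact
  interpret R: cring R by fact
  note h = ring_hom_closed[OF assms(2)] ring_hom_mult[OF assms(2)] ring_hom_add[OF assms(2)] ring_hom_one[OF assms(2)]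
  have "abelian_group (restrict_scalars h M)"
  proof (rule abelian_groupI)
    show "\<exists>y\<in>carrier (restrict_scalars h M). y \<oplus>\<^bsub>restrict_scalars h M\<^esub> x = \<zero>\<^bsub>restrict_scalars h M\<^esub>"
      if "x \<in> carrier (restrict_scalars h M)" for x
      using that by (auto intro!: bexI[of _ "\<ominus>\<^bsub>M\<^esub> x"] simp: M.M.l_neg)
  qed (auto simp: M.M.a_ac)
  then show ?thesis
    by (intro moduleI assms(1)) (auto simp: h M.smult_l_distr M.smult_r_distr M.smult_assoc1)
qed

lemma direct_sum_simps [simp]:
  "carrier (direct_sum M N) = carrier M \<times> carrier N"
  "\<zero>\<^bsub>direct_sum M N\<^esub> = (\<zero>\<^bsub>M\<^esub>, \<zero>\<^bsub>N\<^esub>)"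
  "(a, b) \<oplus>\<^bsub>direct_sum M N\<^esub> (c, d) = (a \<oplus>\<^bsub>M\<^esub> c, b \<oplus>\<^bsub>N\<^esub> d)"
  "r \<odot>\<^bsub>direct_sum M N\<^esub> (a, b) = (r \<odot>\<^bsub>M\<^esub> a, r \<odot>\<^bsub>N\<^esub> b)"
  by (auto simp: direct_sum_def RDirProd_def DirProd_def monoid.defs ring.defs module.defs)

lemma module_direct_sum:
  assumes "module R M" "module R N" shows "module R (direct_sum M N)"
proof -
  interpret M: module R M by fact
  interpret N: module R N by fact
  have "abelian_group (direct_sum M N)"
  proof (rule abelian_groupI)
    show "\<exists>y\<in>carrier (direct_sum M N). y \<oplus>\<^bsub>direct_sum M N\<^esub> x = \<zero>\<^bsub>direct_sum M N\<^esub>"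
      if "x \<in> carrier (direct_sum M N)" for x
      using that by (cases x) (auto intro!: bexI[of _ "(\<ominus>\<^bsub>M\<^esub> fst x, \<ominus>\<^bsub>N\<^esub> snd x)"] simp: M.M.l_neg N.M.l_neg)
  qed (auto simp: M.M.a_ac N.M.a_ac)
  then show ?thesis
    by (intro moduleI M.R.is_cring)
      (auto simp: M.smult_l_distr M.smult_r_distr M.smult_assoc1 N.smult_l_distr N.smult_r_distr N.smult_assoc1)
qed

lemma direct_sum_a_inv:
  assumes "module R M" "module R N" "a \<in> carrier M" "b \<in> carrier N"
  shows "\<ominus>\<^bsub>direct_sum M N\<^esub> (a, b) = (\<ominus>\<^bsub>M\<^esub> a, \<ominus>\<^bsub>N\<^esub> b)"
proof -
  interpret M: module R M by fact
  interpret N: module R N by fact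
  interpret S: module R "direct_sum M N" by (rule module_direct_sum[OF assms(1,2)])
  show ?thesis
    using assms by (intro S.M.minus_equality) (auto simp: M.M.l_neg N.M.l_neg)
qed

section \<open>Quotient modules\<close>

lemma (in module) submodule_abelian_subgroup:
  assumes "submodule H R M" shows "abelian_subgroup H M"
  using abelian_subgroupI3[OF additive_subgroupI[OF submodule.axioms(1)[OF assms]]]
    M.abelian_group_axioms by blast

lemma quotient_module_simps:
  "carrier (quotient_module M H) = a_rcosets\<^bsub>M\<^esub> H"
  "\<zero>\<^bsub>quotient_module M H\<^esub> = H"
  "C \<oplus>\<^bsub>quotient_module M H\<^esub> D = C <+>\<^bsub>M\<^esub> D"
  "r \<odot>\<^bsub>quotient_module M H\<^esub> C = (\<Union>x\<in>C. H +>\<^bsub>M\<^esub> (r \<odot>\<^bsub>M\<^esub> x))"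
  by (simp_all add: quotient_module_def FactRing_def ring.defs module.defs)

context module
begin

lemma a_rcos_eq_iff:
  assumes "submodule H R M" "x \<in> carrier M" "y \<in> carrier M"
  shows "H +>\<^bsub>M\<^esub> x = H +>\<^bsub>M\<^esub> y \<longleftrightarrow> x \<ominus>\<^bsub>M\<^esub> y \<in> H"
proof -
  interpret H: abelian_subgroup H M by (rule submodule_abelian_subgroup[OF assms(1)])
  show ?thesis
    using H.a_rcos_module[OF assms(3,2)] H.a_repr_independence'[of x y] H.a_repr_independenceD[of x y] assms(2,3)
    unfolding M.minus_eq by metis
qed

end

text \<open>The scalar action on cosets is a union over all representatives. It collapses to one
  coset because two representatives differ by an element of \<open>H\<close>, and \<open>H\<close>
  is stable under scalars.\<close>

lemma quotient_smult_rcos: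
  assumes M: "module R M" and H: "submodule H R M" and r: "r \<in> carrier R" and x: "x \<in> carrier M"
  shows "r \<odot>\<^bsub>quotient_module M H\<^esub> (H +>\<^bsub>M\<^esub> x) = H +>\<^bsub>M\<^esub> (r \<odot>\<^bsub>M\<^esub> x)"
proof -
  interpret module R M by (rule M)
  interpret H: abelian_subgroup H M by (rule submodule_abelian_subgroup[OF H])
  have "H +>\<^bsub>M\<^esub> (r \<odot>\<^bsub>M\<^esub> y) = H +>\<^bsub>M\<^esub> (r \<odot>\<^bsub>M\<^esub> x)" if y: "y \<in> H +>\<^bsub>M\<^esub> x" for y
  proof -
    have yM: "y \<in> carrier M" using H.a_elemrcos_carrier x y by blast
    have "y \<ominus>\<^bsub>M\<^esub> x \<in> H"
      using y yM x H.a_rcos_module M.minus_eq by metis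
    then have "r \<odot>\<^bsub>M\<^esub> (y \<ominus>\<^bsub>M\<^esub> x) \<in> H"
      using submoduleE(4)[OF H] r by blast
    then have "(r \<odot>\<^bsub>M\<^esub> y) \<ominus>\<^bsub>M\<^esub> (r \<odot>\<^bsub>M\<^esub> x) \<in> H"
      using r x yM by (simp add: M.minus_eq smult_r_distr smult_r_minus)
    then show ?thesis
      using a_rcos_eq_iff[OF H] r x yM by simp
  qed
  moreover have "x \<in> H +>\<^bsub>M\<^esub> x" using H.a_rcos_self x by blast
  ultimately show ?thesis unfolding quotient_module_simps by blast
qed

lemma quotient_add_rcos:
  assumes M: "module R M" and H: "submodule H R M" and "x \<in> carrier M" "y \<in> carrier M"
  shows "(H +>\<^bsub>M\<^esub> x) \<oplus>\<^bsub>quotient_module M H\<^esub> (H +>\<^bsub>M\<^esub> y) = H +>\<^bsub>M\<^esub> (x \<oplus>\<^bsub>M\<^esub> y)"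
proof -
  interpret module R M by (rule M)
  interpret H: abelian_subgroup H M by (rule submodule_abelian_subgroup[OF H])
  show ?thesis unfolding quotient_module_simps using H.a_rcos_sum assms by blast
qed

lemma quotient_carrier:
  "C \<in> carrier (quotient_module M H) \<longleftrightarrow> (\<exists>x\<in>carrier M. C = H +>\<^bsub>M\<^esub> x)"
  by (auto simp: quotient_module_simps A_RCOSETS_def' a_r_coset_def')

lemma quotient_carrierI:
  "x \<in> carrier M \<Longrightarrow> H +>\<^bsub>M\<^esub> x \<in> carrier (quotient_module M H)"
  unfolding quotient_carrier by (rule bexI, rule refl)

lemma quotient_carrierE:
  assumes "C \<in> carrier (quotient_module M H)"
  obtains x where "x \<in> carrier M" "C = H +>\<^bsub>M\<^esub> x"
  using assms unfolding quotient_carrier by (rule bexE)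

text \<open>With the zero written as a coset, the module axioms reduce to computations with
  representatives.\<close>

lemma quotient_zero:
  assumes M: "module R M" and H: "submodule H R M"
  shows "\<zero>\<^bsub>quotient_module M H\<^esub> = H +>\<^bsub>M\<^esub> \<zero>\<^bsub>M\<^esub>"
proof -
  interpret module R M by (rule M)
  interpret H: abelian_subgroup H M by (rule submodule_abelian_subgroup[OF H])
  show ?thesis unfolding quotient_module_simps using M.a_coset_add_zero H.a_subset by simp
qed

lemma module_quotient_module:
  assumes M: "module R M" and H: "submodule H R M"
  shows "module R (quotient_module M H)"
proof -
  interpret module R M by (rule M)
  interpret H: abelian_subgroup H M by (rule submodule_abelian_subgroup[OF H])
  have "abelian_group (quotient_module M H)"
  proof (rule abelian_groupI)
    let ?Q = "quotient_module M H"
    show "\<exists>D\<in>carrier ?Q. D \<oplus>\<^bsub>?Q\<^esub> C = \<zero>\<^bsub>?Q\<^esub>" if C: "C \<in> carrier ?Q" for C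
    proof -
      obtain x where x: "x \<in> carrier M" "C = H +>\<^bsub>M\<^esub> x" by (rule quotient_carrierE[OF C])
      have "(H +>\<^bsub>M\<^esub> (\<ominus>\<^bsub>M\<^esub> x)) \<oplus>\<^bsub>?Q\<^esub> C = \<zero>\<^bsub>?Q\<^esub>"
        using x by (simp add: quotient_add_rcos[OF M H] quotient_zero[OF M H] M.l_neg)
      then show ?thesis
        by (rule bexI[OF _ quotient_carrierI]) (use x in simp)
    qed
    show "\<zero>\<^bsub>?Q\<^esub> \<in> carrier ?Q"
      unfolding quotient_zero[OF M H] by (rule quotient_carrierI) simp
    fix C D
    assume C: "C \<in> carrier ?Q" and D: "D \<in> carrier ?Q"
    obtain x where x: "x \<in> carrier M" "C = H +>\<^bsub>M\<^esub> x" by (rule quotient_carrierE[OF C])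
    obtain y where y: "y \<in> carrier M" "D = H +>\<^bsub>M\<^esub> y" by (rule quotient_carrierE[OF D])
    show "C \<oplus>\<^bsub>?Q\<^esub> D \<in> carrier ?Q"
      using x y by (simp add: quotient_add_rcos[OF M H] quotient_carrierI)
    show "C \<oplus>\<^bsub>?Q\<^esub> D = D \<oplus>\<^bsub>?Q\<^esub> C"
      using x y by (simp add: quotient_add_rcos[OF M H] M.a_comm)
    show "\<zero>\<^bsub>?Q\<^esub> \<oplus>\<^bsub>?Q\<^esub> C = C"
      using x by (simp add: quotient_add_rcos[OF M H] quotient_zero[OF M H])
    show "C \<oplus>\<^bsub>?Q\<^esub> D \<oplus>\<^bsub>?Q\<^esub> E = C \<oplus>\<^bsub>?Q\<^esub> (D \<oplus>\<^bsub>?Q\<^esub> E)" if E: "E \<in> carrier ?Q" for E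
    proof -
      obtain z where z: "z \<in> carrier M" "E = H +>\<^bsub>M\<^esub> z" by (rule quotient_carrierE[OF E])
      show ?thesis using x y z by (simp add: quotient_add_rcos[OF M H] M.a_assoc)
    qed
  qed
  note [simp] = quotient_add_rcos[OF M H] quotient_smult_rcos[OF M H]
  show ?thesis
  proof (rule moduleI)
    let ?Q = "quotient_module M H"
    show "\<one>\<^bsub>R\<^esub> \<odot>\<^bsub>?Q\<^esub> C = C" if C: "C \<in> carrier ?Q" for C
    proof -
      obtain x where "x \<in> carrier M" "C = H +>\<^bsub>M\<^esub> x" by (rule quotient_carrierE[OF C])
      then show ?thesis by simp
    qed
    fix a b C D
    assume a: "a \<in> carrier R" and C: "C \<in> carrier ?Q"
    obtain x where x [simp]: "x \<in> carrier M" and Cx: "C = H +>\<^bsub>M\<^esub> x"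
      by (rule quotient_carrierE[OF C])
    show "a \<odot>\<^bsub>?Q\<^esub> C \<in> carrier ?Q"
      using a by (simp add: Cx quotient_carrierI)
    show "(a \<oplus>\<^bsub>R\<^esub> b) \<odot>\<^bsub>?Q\<^esub> C = a \<odot>\<^bsub>?Q\<^esub> C \<oplus>\<^bsub>?Q\<^esub> b \<odot>\<^bsub>?Q\<^esub> C"
      "a \<otimes>\<^bsub>R\<^esub> b \<odot>\<^bsub>?Q\<^esub> C = a \<odot>\<^bsub>?Q\<^esub> (b \<odot>\<^bsub>?Q\<^esub> C)" if b: "b \<in> carrier R"
      using a b by (simp_all add: Cx smult_l_distr smult_assoc1)
    show "a \<odot>\<^bsub>?Q\<^esub> (C \<oplus>\<^bsub>?Q\<^esub> D) = a \<odot>\<^bsub>?Q\<^esub> C \<oplus>\<^bsub>?Q\<^esub> a \<odot>\<^bsub>?Q\<^esub> D" if D: "D \<in> carrier ?Q"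
    proof -
      obtain y where y [simp]: "y \<in> carrier M" and Dy: "D = H +>\<^bsub>M\<^esub> y"
        by (rule quotient_carrierE[OF D])
      show ?thesis using a by (simp add: Cx Dy smult_r_distr)
    qed
  qed (rule is_cring, fact)
qed

section \<open>Extensions\<close>

lemma (in abelian_group) minus_zero_iff:
  assumes "x \<in> carrier G" "y \<in> carrier G"
  shows "x \<ominus> y = \<zero> \<longleftrightarrow> x = y"
  using assms by (metis add.inv_closed add.inv_equality add.inv_inv minus_eq r_neg)

lemma (in abelian_group) add_minus_cancel:
  assumes "x \<in> carrier G" "y \<in> carrier G"
  shows "y \<oplus> (x \<ominus> y) = x"
  using assms by (simp add: minus_eq a_lcomm r_neg)

lemma (in abelian_group) eq_add_minusD:
  assumes "x \<ominus> y = z" "x \<in> carrier G" "y \<in> carrier G"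
  shows "x = y \<oplus> z"
  unfolding assms(1)[symmetric] by (rule add_minus_cancel[OF assms(2,3), symmetric])

lemma (in abelian_group) add_eq_selfD:
  assumes "x = x \<oplus> y" "x \<in> carrier G" "y \<in> carrier G"
  shows "y = \<zero>"
proof -
  have "x \<oplus> y = x \<oplus> \<zero>"
    unfolding assms(1)[symmetric] using assms(2) by simp
  then show ?thesis using assms(2,3) add.l_cancel zero_closed by metis
qed

lemma direct_sum_minus:
  assumes "module R M" "module R N" "a \<in> carrier M" "b \<in> carrier N" "c \<in> carrier M" "d \<in> carrier N"
  shows "(a, b) \<ominus>\<^bsub>direct_sum M N\<^esub> (c, d) = (a \<ominus>\<^bsub>M\<^esub> c, b \<ominus>\<^bsub>N\<^esub> d)"
  using assms by (simp add: a_minus_def direct_sum_a_inv)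

text \<open>The middle term has a type of its own, since push-outs and pull-backs live on sets of
  pairs and on pairs. Only the two ends share the type \<open>'m\<close>.\<close>

locale extension =
  fixes R :: "('r, 'x) ring_scheme" and N L :: "('r, 'm) module"
    and E :: "('r, 'e) module" and i :: "'m \<Rightarrow> 'e" and p :: "'e \<Rightarrow> 'm"
  assumes N: "module R N" and L: "module R L" and mem: "(E, i, p) \<in> extensions R N L"
begin

lemma E: "module R E" and i_hom: "i \<in> mod_hom R L E" and p_hom: "p \<in> mod_hom R E N"
  and i_inj: "inj_on i (carrier L)" and i_image: "i ` carrier L = {e \<in> carrier E. p e = \<zero>\<^bsub>N\<^esub>}"
  and p_image: "p ` carrier E = carrier N"
  using mem unfolding extensions_def by auto

sublocale N: module R N by (rule N)
sublocale L: module R L by (rule L)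
sublocale E: module R E by (rule E)

lemmas i_closed [simp] = mod_hom_closed[OF i_hom]
lemmas p_closed [simp] = mod_hom_closed[OF p_hom]
lemmas i_add = mod_hom_add[OF i_hom] and p_add = mod_hom_add[OF p_hom]
lemmas p_minus = mod_hom_minus[OF p_hom E N]
lemmas i_a_inv = mod_hom_a_inv[OF i_hom L E] and p_a_inv = mod_hom_a_inv[OF p_hom E N]
lemmas i_smult = mod_hom_smult[OF i_hom] and p_smult = mod_hom_smult[OF p_hom]
lemmas i_zero [simp] = mod_hom_zero[OF i_hom L E]
lemmas p_zero [simp] = mod_hom_zero[OF p_hom E N]

lemma p_i [simp]: "l \<in> carrier L \<Longrightarrow> p (i l) = \<zero>\<^bsub>N\<^esub>"
  using i_image by auto

lemma i_eq_iff: "\<lbrakk>l \<in> carrier L; l' \<in> carrier L\<rbrakk> \<Longrightarrow> i l = i l' \<longleftrightarrow> l = l'"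
  using i_inj by (rule inj_on_eq_iff)

lemma i_eq_zero: "l \<in> carrier L \<Longrightarrow> i l = \<zero>\<^bsub>E\<^esub> \<Longrightarrow> l = \<zero>\<^bsub>L\<^esub>"
  using i_eq_iff[of l "\<zero>\<^bsub>L\<^esub>"] by simp

lemma kerE:
  assumes "x \<in> carrier E" "p x = \<zero>\<^bsub>N\<^esub>"
  obtains l where "l \<in> carrier L" "x = i l"
  using assms i_image by (metis (mono_tags, lifting) imageE mem_Collect_eq)

lemma surjE:
  assumes "n \<in> carrier N"
  obtains x where "x \<in> carrier E" "p x = n"
  using assms p_image by (metis imageE)

text \<open>The fibres of \<open>p\<close> are the translates of the image of \<open>i\<close>. The
  diagram chases below use exactness in this form.\<close>

lemma same_fibreE:
  assumes "x \<in> carrier E" "y \<in> carrier E" "p x = p y"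
  obtains l where "l \<in> carrier L" "x = y \<oplus>\<^bsub>E\<^esub> i l"
proof -
  have "p (x \<ominus>\<^bsub>E\<^esub> y) = \<zero>\<^bsub>N\<^esub>"
    using assms by (simp add: p_minus N.M.minus_zero_iff)
  then obtain l where "l \<in> carrier L" "x \<ominus>\<^bsub>E\<^esub> y = i l"
    using kerE[of "x \<ominus>\<^bsub>E\<^esub> y"] assms by auto
  then show ?thesis using that E.M.eq_add_minusD assms by blast
qed

end

text \<open>A morphism of short exact sequences with prescribed maps on the ends. These two maps are
  evaluated on carriers only and need not be extensional, so identities and composites can be
  written as plain functions.\<close>

definition ext_mor ::
  "('r, 'x) ring_scheme \<Rightarrow> ('r, 'm) module \<Rightarrow> ('m \<Rightarrow> 'm) \<Rightarrow> ('m \<Rightarrow> 'm)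
    \<Rightarrow> ('r, 'm, 'e) ext \<Rightarrow> ('r, 'm, 'd) ext \<Rightarrow> ('e \<Rightarrow> 'd) \<Rightarrow> bool" where
  "ext_mor R L \<alpha> \<beta> = (\<lambda>(E, i, p) (E', i', p') f. f \<in> mod_hom R E E' \<and>
     (\<forall>l\<in>carrier L. f (i l) = i' (\<beta> l)) \<and> (\<forall>x\<in>carrier E. p' (f x) = \<alpha> (p x)))"

lemma ext_mor_iff:
  "ext_mor R L \<alpha> \<beta> (E, i, p) (E', i', p') f \<longleftrightarrow> f \<in> mod_hom R E E' \<and>
     (\<forall>l\<in>carrier L. f (i l) = i' (\<beta> l)) \<and> (\<forall>x\<in>carrier E. p' (f x) = \<alpha> (p x))"
  by (simp add: ext_mor_def)

lemma ext_mor_compose: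
  assumes e: "extension R N L E i p"
    and f: "ext_mor R L \<alpha> \<beta> (E, i, p) (E', i', p') f"
    and g: "ext_mor R L' \<alpha>' \<beta>' (E', i', p') (E'', i'', p'') g"
    and b: "\<And>l. l \<in> carrier L \<Longrightarrow> \<beta> l \<in> carrier L'"
  shows "ext_mor R L (\<lambda>x. \<alpha>' (\<alpha> x)) (\<lambda>x. \<beta>' (\<beta> x)) (E, i, p) (E'', i'', p'') (compose (carrier E) g f)"
proof -
  interpret extension R N L E i p by (rule e)
  show ?thesis
    using f g b mod_hom_compose[OF E] mod_hom_closed[of f R E E']
    unfolding ext_mor_iff by (auto simp: compose_def)
qed

lemma ext_mor_id:
  assumes "extension R N L E i p"
  shows "ext_mor R L (\<lambda>x. x) (\<lambda>x. x) (E, i, p) (E, i, p) (\<lambda>x\<in>carrier E. x)"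
proof -
  interpret extension R N L E i p by fact
  show ?thesis unfolding ext_mor_iff using mod_hom_id[OF E] by auto
qed

text \<open>Mediates between plain end maps such as \<open>\<lambda>x. x\<close> and the extensional
  ones that occur as arrows of the categories.\<close>

lemma ext_mor_cong:
  assumes "extension R N L E i p" "ext_mor R L \<alpha> \<beta> (E, i, p) (E', i', p') f"
    and "\<And>x. x \<in> carrier N \<Longrightarrow> \<alpha> x = \<alpha>' x" "\<And>x. x \<in> carrier L \<Longrightarrow> \<beta> x = \<beta>' x"
  shows "ext_mor R L \<alpha>' \<beta>' (E, i, p) (E', i', p') f"
proof -
  interpret extension R N L E i p by fact
  show ?thesis using assms(2-) unfolding ext_mor_iff by auto
qed

text \<open>Five lemma. Elements with equal image lie in one fibre of \<open>p\<close> and differ by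
  some \<open>i l\<close> with \<open>i' l = 0\<close>; a preimage is found by lifting along
  \<open>p\<close> and correcting by an element of \<open>L\<close>.\<close>

lemma short_five:
  assumes "extension R N L E i p" "extension R N L E' i' p'"
    and f: "ext_mor R L (\<lambda>x. x) (\<lambda>x. x) (E, i, p) (E', i', p') f"
  shows "bij_betw f (carrier E) (carrier E')"
proof -
  interpret e: extension R N L E i p by fact
  interpret e': extension R N L E' i' p' by fact
  have fh: "f \<in> mod_hom R E E'" and fi: "\<And>l. l \<in> carrier L \<Longrightarrow> f (i l) = i' l"
    and pf: "\<And>x. x \<in> carrier E \<Longrightarrow> p' (f x) = p x"
    using f by (auto simp: ext_mor_iff)
  have "x = y" if x: "x \<in> carrier E" and y: "y \<in> carrier E" and eq: "f x = f y" for x y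
  proof -
    have "p x = p y" using pf x y eq by metis
    then obtain l where l: "l \<in> carrier L" "x = y \<oplus>\<^bsub>E\<^esub> i l" using e.same_fibreE x y by blast
    have "f y = f y \<oplus>\<^bsub>E'\<^esub> i' l"
      using l y eq fi mod_hom_add[OF fh] by simp
    then have "i' l = \<zero>\<^bsub>E'\<^esub>"
      by (rule e'.E.M.add_eq_selfD) (use l y mod_hom_closed[OF fh] in auto)
    then have "l = \<zero>\<^bsub>L\<^esub>" by (rule e'.i_eq_zero[OF l(1)])
    then show "x = y" using l(2) y by simp
  qed
  moreover have "\<exists>x\<in>carrier E. f x = y" if y: "y \<in> carrier E'" for y
  proof -
    obtain x where x: "x \<in> carrier E" "p x = p' y" using e.surjE e'.p_closed y by metis
    then have "p' y = p' (f x)" using pf by simp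
    then obtain l where "l \<in> carrier L" "y = f x \<oplus>\<^bsub>E'\<^esub> i' l"
      using e'.same_fibreE y x mod_hom_closed[OF fh] by metis
    then have "f (x \<oplus>\<^bsub>E\<^esub> i l) = y"
      using x fi mod_hom_add[OF fh] by simp
    then show ?thesis using x \<open>l \<in> carrier L\<close> by (intro bexI[of _ "x \<oplus>\<^bsub>E\<^esub> i l"]) auto
  qed
  ultimately show ?thesis
    unfolding bij_betw_def inj_on_def using mod_hom_closed[OF fh] by blast
qed

lemma ext_equiv_iff:
  assumes "extension R N L E i p" "extension R N L E' i' p'"
  shows "ext_equiv R L (E, i, p) (E', i', p') \<longleftrightarrow>
    (\<exists>f. ext_mor R L (\<lambda>x. x) (\<lambda>x. x) (E, i, p) (E', i', p') f)"
  using short_five[OF assms] unfolding ext_equiv_def ext_mor_iff by blast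

text \<open>Together with \<open>ext_mor_compose\<close> this makes equivalence of extensions usable
  in both directions, even between middle terms of different types.\<close>

lemma ext_mor_inverse:
  assumes "extension R N L E i p" "extension R N L E' i' p'"
    and f: "ext_mor R L (\<lambda>x. x) (\<lambda>x. x) (E, i, p) (E', i', p') f"
  shows "\<exists>g. ext_mor R L (\<lambda>x. x) (\<lambda>x. x) (E', i', p') (E, i, p) g"
proof -
  interpret e: extension R N L E i p by fact
  interpret e': extension R N L E' i' p' by fact
  have fh: "f \<in> mod_hom R E E'" and fi: "\<And>l. l \<in> carrier L \<Longrightarrow> f (i l) = i' l"
    and pf: "\<And>x. x \<in> carrier E \<Longrightarrow> p' (f x) = p x"
    using f by (auto simp: ext_mor_iff)
  note bij = short_five[OF assms]
  let ?g = "restrict (inv_into (carrier E) f) (carrier E')"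
  have "?g (i' l) = i l" if "l \<in> carrier L" for l
    using that fi bij by (auto simp: bij_betw_def intro: inv_into_f_eq)
  moreover have "p (?g y) = p' y" if y: "y \<in> carrier E'" for y
  proof -
    have "?g y \<in> carrier E" "f (?g y) = y"
      using y bij by (auto simp: bij_betw_def intro: inv_into_into f_inv_into_f)
    then show ?thesis using pf by metis
  qed
  ultimately show ?thesis
    using mod_hom_inv_into[OF e.E e'.E fh bij] unfolding ext_mor_iff by blast
qed

text \<open>A morphism \<open>h\<close> that is the identity on \<open>N\<close> exhibits its target as the push-out of its source,
  and one that is the identity on \<open>L\<close> exhibits its source as the pull-back of its target.\<close>

lemma ext_mor_factor_pushout:
  assumes "extension R N L E i p" "extension R N L' E1 i1 p1" "extension R N' L' E' i' p'"
    and b: "\<beta> \<in> mod_hom R L L'" and a: "\<alpha> \<in> mod_hom R N N'"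
    and h: "ext_mor R L (\<lambda>x. x) \<beta> (E, i, p) (E1, i1, p1) h"
    and f: "ext_mor R L \<alpha> \<beta> (E, i, p) (E', i', p') f"
  shows "\<exists>k. ext_mor R L' \<alpha> (\<lambda>x. x) (E1, i1, p1) (E', i', p') k"
proof -
  interpret e: extension R N L E i p by fact
  interpret e1: extension R N L' E1 i1 p1 by fact
  interpret e': extension R N' L' E' i' p' by fact
  have hh: "h \<in> mod_hom R E E1" and hi: "\<And>l. l \<in> carrier L \<Longrightarrow> h (i l) = i1 (\<beta> l)"
    and ph: "\<And>x. x \<in> carrier E \<Longrightarrow> p1 (h x) = p x"
    using h by (auto simp: ext_mor_iff)
  have fh: "f \<in> mod_hom R E E'" and fi: "\<And>l. l \<in> carrier L \<Longrightarrow> f (i l) = i' (\<beta> l)"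
    and pf: "\<And>x. x \<in> carrier E \<Longrightarrow> p' (f x) = \<alpha> (p x)"
    using f by (auto simp: ext_mor_iff)
  note [simp] = mod_hom_closed[OF b] mod_hom_closed[OF a] mod_hom_closed[OF hh] mod_hom_closed[OF fh]
  \<comment> \<open>A lift of \<open>p1 y\<close> along \<open>p\<close> gives some
    \<open>h x\<close> in the fibre of \<open>y\<close>, so the images of \<open>h\<close> and
    \<open>i1\<close> together span \<open>E1\<close>.\<close>
  have dec: "\<exists>x\<in>carrier E. \<exists>l\<in>carrier L'. y = h x \<oplus>\<^bsub>E1\<^esub> i1 l" if y: "y \<in> carrier E1" for y
  proof -
    obtain x where x: "x \<in> carrier E" "p x = p1 y" using e.surjE e1.p_closed y by metis
    then have "p1 y = p1 (h x)" using ph by simp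
    then show ?thesis using e1.same_fibreE[OF y] x by (metis mod_hom_closed[OF hh])
  qed
  \<comment> \<open>Such a decomposition is unique up to moving an element \<open>m\<close> of
    \<open>L\<close> from one summand to the other, and \<open>f (i m) = i' (\<beta> m)\<close> says
    that the move leaves the value unchanged.\<close>
  have wd: "f x \<oplus>\<^bsub>E'\<^esub> i' l = f x' \<oplus>\<^bsub>E'\<^esub> i' l'"
    if x: "x \<in> carrier E" "l \<in> carrier L'" "x' \<in> carrier E" "l' \<in> carrier L'"
      and eq: "h x \<oplus>\<^bsub>E1\<^esub> i1 l = h x' \<oplus>\<^bsub>E1\<^esub> i1 l'" for x l x' l'
  proof -
    have "p1 (h x \<oplus>\<^bsub>E1\<^esub> i1 l) = p1 (h x' \<oplus>\<^bsub>E1\<^esub> i1 l')" by (simp add: eq)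
    then have "p x = p x'" using x ph by (simp add: e1.p_add)
    then obtain m where m: "m \<in> carrier L" "x = x' \<oplus>\<^bsub>E\<^esub> i m" using e.same_fibreE x by blast
    have "h x' \<oplus>\<^bsub>E1\<^esub> i1 (\<beta> m \<oplus>\<^bsub>L'\<^esub> l) = h x' \<oplus>\<^bsub>E1\<^esub> i1 l'"
      using eq m x hi by (simp add: mod_hom_add[OF hh] e1.i_add e1.E.M.a_assoc)
    then have "i1 (\<beta> m \<oplus>\<^bsub>L'\<^esub> l) = i1 l'"
      using m x by simp
    then have "\<beta> m \<oplus>\<^bsub>L'\<^esub> l = l'" using e1.i_eq_iff m x by simp
    then show ?thesis
      using m x fi by (auto simp: mod_hom_add[OF fh] e'.i_add e'.E.M.a_assoc)
  qed
  define k where "k = (\<lambda>y\<in>carrier E1. SOME z. \<exists>x\<in>carrier E. \<exists>l\<in>carrier L'.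
      y = h x \<oplus>\<^bsub>E1\<^esub> i1 l \<and> z = f x \<oplus>\<^bsub>E'\<^esub> i' l)"
  have k: "k (h x \<oplus>\<^bsub>E1\<^esub> i1 l) = f x \<oplus>\<^bsub>E'\<^esub> i' l" if "x \<in> carrier E" "l \<in> carrier L'" for x l
  proof -
    have "(SOME z. \<exists>x'\<in>carrier E. \<exists>l'\<in>carrier L'.
      h x \<oplus>\<^bsub>E1\<^esub> i1 l = h x' \<oplus>\<^bsub>E1\<^esub> i1 l' \<and> z = f x' \<oplus>\<^bsub>E'\<^esub> i' l') = f x \<oplus>\<^bsub>E'\<^esub> i' l"
    proof (rule some_equality)
      show "\<exists>x'\<in>carrier E. \<exists>l'\<in>carrier L'.
        h x \<oplus>\<^bsub>E1\<^esub> i1 l = h x' \<oplus>\<^bsub>E1\<^esub> i1 l' \<and> f x \<oplus>\<^bsub>E'\<^esub> i' l = f x' \<oplus>\<^bsub>E'\<^esub> i' l'"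
        using that by (intro bexI[of _ x] bexI[of _ l] conjI refl)
    next
      fix z
      assume "\<exists>x'\<in>carrier E. \<exists>l'\<in>carrier L'.
        h x \<oplus>\<^bsub>E1\<^esub> i1 l = h x' \<oplus>\<^bsub>E1\<^esub> i1 l' \<and> z = f x' \<oplus>\<^bsub>E'\<^esub> i' l'"
      then obtain x' l' where "x' \<in> carrier E" "l' \<in> carrier L'"
        "h x \<oplus>\<^bsub>E1\<^esub> i1 l = h x' \<oplus>\<^bsub>E1\<^esub> i1 l'" "z = f x' \<oplus>\<^bsub>E'\<^esub> i' l'" by (elim bexE conjE)
      then show "z = f x \<oplus>\<^bsub>E'\<^esub> i' l" using wd[of x' l' x l] that by simp
    qed
    then show ?thesis using that by (simp add: k_def)
  qed
  have ki: "k (i1 l) = i' l" if "l \<in> carrier L'" for l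
    using k[of "\<zero>\<^bsub>E\<^esub>" l] that by (simp add: mod_hom_zero[OF hh e.E e1.E] mod_hom_zero[OF fh e.E e'.E])
  have pk: "p' (k y) = \<alpha> (p1 y)" "k y \<in> carrier E'" if "y \<in> carrier E1" for y
    using dec[OF that] by (auto simp: k e'.p_add e1.p_add ph pf)
  have "k \<in> mod_hom R E1 E'"
  proof (rule mod_homI)
    show "k \<in> carrier E1 \<rightarrow>\<^sub>E carrier E'" using pk(2) by (auto simp: k_def)
    show "k (y \<oplus>\<^bsub>E1\<^esub> y') = k y \<oplus>\<^bsub>E'\<^esub> k y'" if y: "y \<in> carrier E1" and y': "y' \<in> carrier E1" for y y'
    proof -
      obtain x l where x: "x \<in> carrier E" "l \<in> carrier L'" "y = h x \<oplus>\<^bsub>E1\<^esub> i1 l" using dec[OF y] by blast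
      obtain x' l' where x': "x' \<in> carrier E" "l' \<in> carrier L'" "y' = h x' \<oplus>\<^bsub>E1\<^esub> i1 l'"
        using dec[OF y'] by blast
      have "y \<oplus>\<^bsub>E1\<^esub> y' = h (x \<oplus>\<^bsub>E\<^esub> x') \<oplus>\<^bsub>E1\<^esub> i1 (l \<oplus>\<^bsub>L'\<^esub> l')"
        using x x' by (simp add: mod_hom_add[OF hh] e1.i_add e1.E.M.a_ac)
      then show ?thesis
        using x x' k[of "x \<oplus>\<^bsub>E\<^esub> x'" "l \<oplus>\<^bsub>L'\<^esub> l'"]
        by (simp add: k mod_hom_add[OF fh] e'.i_add e'.E.M.a_ac)
    qed
    show "k (r \<odot>\<^bsub>E1\<^esub> y) = r \<odot>\<^bsub>E'\<^esub> k y" if r: "r \<in> carrier R" and y: "y \<in> carrier E1" for r y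
    proof -
      obtain x l where x: "x \<in> carrier E" "l \<in> carrier L'" "y = h x \<oplus>\<^bsub>E1\<^esub> i1 l" using dec[OF y] by blast
      have "r \<odot>\<^bsub>E1\<^esub> y = h (r \<odot>\<^bsub>E\<^esub> x) \<oplus>\<^bsub>E1\<^esub> i1 (r \<odot>\<^bsub>L'\<^esub> l)"
        using x r by (simp add: mod_hom_smult[OF hh] e1.i_smult e1.E.smult_r_distr)
      then show ?thesis
        using x r k[of "r \<odot>\<^bsub>E\<^esub> x" "r \<odot>\<^bsub>L'\<^esub> l"]
        by (simp add: k mod_hom_smult[OF fh] e'.i_smult e'.E.smult_r_distr)
    qed
  qed
  then show ?thesis using ki pk unfolding ext_mor_iff by blast
qed

lemma ext_mor_factor_pullback:
  assumes "extension R N L E i p" "extension R N L' E1 i1 p1" "extension R N' L' E' i' p'"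
    and b: "\<beta> \<in> mod_hom R L L'" and a: "\<alpha> \<in> mod_hom R N N'"
    and k: "ext_mor R L' \<alpha> (\<lambda>x. x) (E1, i1, p1) (E', i', p') k"
    and f: "ext_mor R L \<alpha> \<beta> (E, i, p) (E', i', p') f"
  shows "\<exists>h. ext_mor R L (\<lambda>x. x) \<beta> (E, i, p) (E1, i1, p1) h"
proof -
  interpret e: extension R N L E i p by fact
  interpret e1: extension R N L' E1 i1 p1 by fact
  interpret e': extension R N' L' E' i' p' by fact
  have kh: "k \<in> mod_hom R E1 E'" and ki: "\<And>l. l \<in> carrier L' \<Longrightarrow> k (i1 l) = i' l"
    and pk: "\<And>x. x \<in> carrier E1 \<Longrightarrow> p' (k x) = \<alpha> (p1 x)"
    using k by (auto simp: ext_mor_iff)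
  have fh: "f \<in> mod_hom R E E'" and fi: "\<And>l. l \<in> carrier L \<Longrightarrow> f (i l) = i' (\<beta> l)"
    and pf: "\<And>x. x \<in> carrier E \<Longrightarrow> p' (f x) = \<alpha> (p x)"
    using f by (auto simp: ext_mor_iff)
  note [simp] = mod_hom_closed[OF b] mod_hom_closed[OF a] mod_hom_closed[OF kh] mod_hom_closed[OF fh]
  \<comment> \<open>\<open>k\<close> and \<open>p1\<close> together identify \<open>E1\<close> with
    the fibre product of \<open>E'\<close> and \<open>N\<close> over \<open>N'\<close>: the
    compatible pair (f x, p x) has a preimage in \<open>E1\<close>, and by \<open>uniq\<close> only
    one. Linearity of \<open>h\<close> follows from that uniqueness.\<close>
  have ex: "\<exists>y\<in>carrier E1. k y = f x \<and> p1 y = p x" if x: "x \<in> carrier E" for x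
  proof -
    obtain y where y: "y \<in> carrier E1" "p1 y = p x" using e1.surjE e.p_closed x by metis
    then have "p' (f x) = p' (k y)" using pf pk x by simp
    then obtain l where l: "l \<in> carrier L'" "f x = k y \<oplus>\<^bsub>E'\<^esub> i' l"
      using e'.same_fibreE[of "f x" "k y"] x y by auto
    then have "k (y \<oplus>\<^bsub>E1\<^esub> i1 l) = f x" "p1 (y \<oplus>\<^bsub>E1\<^esub> i1 l) = p x"
      using y x ki by (simp_all add: mod_hom_add[OF kh] e1.p_add)
    then show ?thesis using y l by (intro bexI[of _ "y \<oplus>\<^bsub>E1\<^esub> i1 l"]) auto
  qed
  have uniq: "y = y'" if y: "y \<in> carrier E1" "y' \<in> carrier E1" "k y = k y'" "p1 y = p1 y'" for y y'
  proof -
    obtain l where l: "l \<in> carrier L'" "y = y' \<oplus>\<^bsub>E1\<^esub> i1 l" using e1.same_fibreE y by blast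
    have "k y' = k y' \<oplus>\<^bsub>E'\<^esub> i' l" using l y ki by (simp add: mod_hom_add[OF kh])
    then have "i' l = \<zero>\<^bsub>E'\<^esub>"
      by (rule e'.E.M.add_eq_selfD) (use l y in auto)
    then have "l = \<zero>\<^bsub>L'\<^esub>" by (rule e'.i_eq_zero[OF l(1)])
    then show ?thesis using l(2) y(2) by simp
  qed
  define h where "h = (\<lambda>x\<in>carrier E. SOME y. y \<in> carrier E1 \<and> k y = f x \<and> p1 y = p x)"
  have h: "h x \<in> carrier E1" "k (h x) = f x" "p1 (h x) = p x" if "x \<in> carrier E" for x
    using someI_ex[of "\<lambda>y. y \<in> carrier E1 \<and> k y = f x \<and> p1 y = p x"] ex[OF that] that
    unfolding h_def by auto
  have "h (i l) = i1 (\<beta> l)" if "l \<in> carrier L" for l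
    using that h fi ki by (intro uniq) auto
  moreover have "h \<in> mod_hom R E E1"
  proof (rule mod_homI)
    show "h \<in> carrier E \<rightarrow>\<^sub>E carrier E1" using h(1) by (auto simp: h_def)
    show "h (x \<oplus>\<^bsub>E\<^esub> y) = h x \<oplus>\<^bsub>E1\<^esub> h y" if "x \<in> carrier E" "y \<in> carrier E" for x y
      using that h by (intro uniq) (auto simp: mod_hom_add[OF kh] mod_hom_add[OF fh] e1.p_add e.p_add)
    show "h (r \<odot>\<^bsub>E\<^esub> x) = r \<odot>\<^bsub>E1\<^esub> h x" if "r \<in> carrier R" "x \<in> carrier E" for r x
      using that h by (intro uniq) (auto simp: mod_hom_smult[OF kh] mod_hom_smult[OF fh] e1.p_smult e.p_smult)
  qed
  ultimately show ?thesis using h unfolding ext_mor_iff by blast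
qed

text \<open>The coset description of the push-out is opened here only. Later arguments use the
  canonical morphism \<open>c\<close> and the factorisation through it.\<close>

lemma pushout_extension:
  assumes e: "extension R N L E i p" and L': "module R L'" and b: "\<beta> \<in> mod_hom R L L'"
  obtains Q j q c where "pushout_ext L L' \<beta> (E, i, p) = (Q, j, q)" "extension R N L' Q j q"
    "ext_mor R L (\<lambda>x. x) \<beta> (E, i, p) (Q, j, q) c"
proof -
  interpret e: extension R N L E i p by fact
  interpret L': module R L' by fact
  note [simp] = mod_hom_closed[OF b]
  define S where "S = direct_sum E L'"
  define H where "H = {(i l, \<ominus>\<^bsub>L'\<^esub> \<beta> l) | l. l \<in> carrier L}"
  define Q where "Q = quotient_module S H"
  define cls where "cls x l = H +>\<^bsub>S\<^esub> (x, l)" for x l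
  define j where "j = (\<lambda>l\<in>carrier L'. cls \<zero>\<^bsub>E\<^esub> l)"
  define q where "q = (\<lambda>C\<in>carrier Q. the_elem ((\<lambda>(e, l'). p e) ` C))"
  define c where "c = (\<lambda>x\<in>carrier E. cls x \<zero>\<^bsub>L'\<^esub>)"
  have po: "pushout_ext L L' \<beta> (E, i, p) = (Q, j, q)"
    by (simp add: pushout_ext_def Let_def S_def H_def Q_def j_def q_def cls_def)
  have S: "module R S" unfolding S_def by (rule module_direct_sum[OF e.E L'])
  interpret S: module R S by (rule S)
  have H_memI: "(i l, \<ominus>\<^bsub>L'\<^esub> \<beta> l) \<in> H" if "l \<in> carrier L" for l
    using that unfolding H_def by (intro CollectI exI[of _ l] conjI refl)
  have H_memE: thesis if "z \<in> H" "\<And>l. \<lbrakk>l \<in> carrier L; z = (i l, \<ominus>\<^bsub>L'\<^esub> \<beta> l)\<rbrakk> \<Longrightarrow> thesis" for z thesis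
    using that(1) unfolding H_def by (elim CollectE exE conjE) (rule that(2))
  have H: "submodule H R S"
  proof (rule S.submoduleI)
    show "H \<subseteq> carrier S" by (auto elim!: H_memE simp: S_def)
    show "\<zero>\<^bsub>S\<^esub> \<in> H"
      using H_memI[of "\<zero>\<^bsub>L\<^esub>"] mod_hom_zero[OF b e.L L'] L'.M.add.inv_one by (simp add: S_def a_inv_def)
    show "\<ominus>\<^bsub>S\<^esub> z \<in> H" if z: "z \<in> H" for z
    proof (rule H_memE[OF z])
      fix l assume l: "l \<in> carrier L" "z = (i l, \<ominus>\<^bsub>L'\<^esub> \<beta> l)"
      then show ?thesis
        using H_memI[of "\<ominus>\<^bsub>L\<^esub> l"]
        by (simp add: S_def direct_sum_a_inv[OF e.E L'] e.i_a_inv mod_hom_a_inv[OF b e.L L'])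
    qed
    show "z \<oplus>\<^bsub>S\<^esub> w \<in> H" if z: "z \<in> H" and w: "w \<in> H" for z w
    proof (rule H_memE[OF z], rule H_memE[OF w])
      fix l m assume "l \<in> carrier L" "z = (i l, \<ominus>\<^bsub>L'\<^esub> \<beta> l)" "m \<in> carrier L" "w = (i m, \<ominus>\<^bsub>L'\<^esub> \<beta> m)"
      then show ?thesis
        using H_memI[of "l \<oplus>\<^bsub>L\<^esub> m"] by (simp add: S_def e.i_add mod_hom_add[OF b] L'.M.minus_add)
    qed
    show "r \<odot>\<^bsub>S\<^esub> z \<in> H" if r: "r \<in> carrier R" and z: "z \<in> H" for r z
    proof (rule H_memE[OF z])
      fix l assume l: "l \<in> carrier L" "z = (i l, \<ominus>\<^bsub>L'\<^esub> \<beta> l)"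
      then show ?thesis
        using H_memI[of "r \<odot>\<^bsub>L\<^esub> l"] r by (simp add: S_def e.i_smult mod_hom_smult[OF b] L'.smult_r_minus)
    qed
  qed
  have Q: "module R Q" unfolding Q_def by (rule module_quotient_module[OF S H])
  interpret Q: module R Q by (rule Q)
  have cls_closed [simp]: "cls x l \<in> carrier Q" if "x \<in> carrier E" "l \<in> carrier L'" for x l
    unfolding cls_def Q_def by (rule quotient_carrierI) (use that in \<open>simp add: S_def\<close>)
  have clsE: thesis if C: "C \<in> carrier Q"
    and *: "\<And>x l. \<lbrakk>x \<in> carrier E; l \<in> carrier L'; C = cls x l\<rbrakk> \<Longrightarrow> thesis" for C thesis
  proof (rule quotient_carrierE[OF C[unfolded Q_def]])
    fix z assume z: "z \<in> carrier S" "C = H +>\<^bsub>S\<^esub> z"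
    show thesis
      by (rule *[of "fst z" "snd z"]) (use z in \<open>auto simp: S_def cls_def\<close>)
  qed
  have cls_add: "cls x l \<oplus>\<^bsub>Q\<^esub> cls y m = cls (x \<oplus>\<^bsub>E\<^esub> y) (l \<oplus>\<^bsub>L'\<^esub> m)"
    if "x \<in> carrier E" "l \<in> carrier L'" "y \<in> carrier E" "m \<in> carrier L'" for x l y m
    using quotient_add_rcos[OF S H, of "(x, l)" "(y, m)"] that unfolding cls_def Q_def by (simp add: S_def)
  have cls_smult: "r \<odot>\<^bsub>Q\<^esub> cls x l = cls (r \<odot>\<^bsub>E\<^esub> x) (r \<odot>\<^bsub>L'\<^esub> l)"
    if "r \<in> carrier R" "x \<in> carrier E" "l \<in> carrier L'" for r x l
    using quotient_smult_rcos[OF S H, of r "(x, l)"] that unfolding cls_def Q_def by (simp add: S_def)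
  have Q_zero: "\<zero>\<^bsub>Q\<^esub> = cls \<zero>\<^bsub>E\<^esub> \<zero>\<^bsub>L'\<^esub>"
    using quotient_zero[OF S H] unfolding cls_def Q_def by (simp add: S_def)
  have cls_eq: "cls x l = cls y m \<longleftrightarrow> (x \<ominus>\<^bsub>E\<^esub> y, l \<ominus>\<^bsub>L'\<^esub> m) \<in> H"
    if "x \<in> carrier E" "l \<in> carrier L'" "y \<in> carrier E" "m \<in> carrier L'" for x l y m
    using S.a_rcos_eq_iff[OF H, of "(x, l)" "(y, m)"] that
    unfolding cls_def by (simp add: S_def direct_sum_minus[OF e.E L'])
  \<comment> \<open>The first components of the members of a coset differ by elements of the image
    of \<open>i\<close>, where \<open>p\<close> vanishes, so \<open>the_elem\<close> is applied to a
    singleton.\<close>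
  have q_cls: "q (cls x l) = p x" if x: "x \<in> carrier E" "l \<in> carrier L'" for x l
  proof -
    have "(\<lambda>(e, l'). p e) z = p x" if z: "z \<in> cls x l" for z
    proof -
      obtain h where h: "h \<in> H" "z = h \<oplus>\<^bsub>S\<^esub> (x, l)"
        using z unfolding cls_def a_r_coset_def' by (elim UN_E singletonE)
      show ?thesis
      proof (rule H_memE[OF h(1)])
        fix m assume "m \<in> carrier L" "h = (i m, \<ominus>\<^bsub>L'\<^esub> \<beta> m)"
        then show ?thesis using h(2) x by (simp add: S_def e.p_add)
      qed
    qed
    moreover have "(x, l) \<in> cls x l"
    proof -
      have "(x, l) = \<zero>\<^bsub>S\<^esub> \<oplus>\<^bsub>S\<^esub> (x, l)" using x by (simp add: S_def)
      moreover have "\<zero>\<^bsub>S\<^esub> \<in> H"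
        using H_memI[of "\<zero>\<^bsub>L\<^esub>"] mod_hom_zero[OF b e.L L'] L'.M.add.inv_one by (simp add: S_def a_inv_def)
      ultimately show ?thesis
        unfolding cls_def a_r_coset_def' by (intro UN_I[of "\<zero>\<^bsub>S\<^esub>"]) (simp_all only: singleton_iff)
    qed
    ultimately have "(\<lambda>(e, l'). p e) ` cls x l = {p x}"
      using image_cong[OF refl, of "cls x l" "\<lambda>(e, l'). p e" "\<lambda>_. p x"]
        image_constant[of "(x, l)" "cls x l" "p x"] by metis
    then show ?thesis using x by (simp add: q_def)
  qed
  have j: "j \<in> mod_hom R L' Q"
    unfolding j_def by (rule mod_hom_restrictI[OF L']) (simp_all add: cls_add cls_smult)
  have c: "c \<in> mod_hom R E Q"
    unfolding c_def by (rule mod_hom_restrictI[OF e.E]) (simp_all add: cls_add cls_smult)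
  have q: "q \<in> mod_hom R Q N"
  proof (rule mod_homI)
    show "q \<in> carrier Q \<rightarrow>\<^sub>E carrier N"
    proof
      fix C assume "C \<in> carrier Q"
      then show "q C \<in> carrier N" by (rule clsE) (simp add: q_cls)
    qed (simp add: q_def)
    show "q (C \<oplus>\<^bsub>Q\<^esub> D) = q C \<oplus>\<^bsub>N\<^esub> q D" if C: "C \<in> carrier Q" and D: "D \<in> carrier Q" for C D
      by (rule clsE[OF C], rule clsE[OF D]) (simp add: cls_add q_cls e.p_add)
    show "q (r \<odot>\<^bsub>Q\<^esub> C) = r \<odot>\<^bsub>N\<^esub> q C" if r: "r \<in> carrier R" and C: "C \<in> carrier Q" for r C
      by (rule clsE[OF C]) (simp add: r cls_smult q_cls e.p_smult)
  qed
  \<comment> \<open>The defining relation of the push-out: an element of \<open>L\<close> passes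
    from the first component to the second through \<open>\<beta>\<close>.\<close>
  have cls_i: "cls (i l) m = cls \<zero>\<^bsub>E\<^esub> (\<beta> l \<oplus>\<^bsub>L'\<^esub> m)" if l: "l \<in> carrier L" "m \<in> carrier L'" for l m
  proof -
    have "m \<ominus>\<^bsub>L'\<^esub> (\<beta> l \<oplus>\<^bsub>L'\<^esub> m) = \<ominus>\<^bsub>L'\<^esub> \<beta> l"
      using l L'.M.a_lcomm[of m "\<ominus>\<^bsub>L'\<^esub> \<beta> l" "\<ominus>\<^bsub>L'\<^esub> m"]
      by (simp add: L'.M.minus_eq L'.M.minus_add L'.M.r_neg)
    moreover have "i l \<ominus>\<^bsub>E\<^esub> \<zero>\<^bsub>E\<^esub> = i l"
      using l by (simp add: e.E.M.minus_eq)
    ultimately show ?thesis using l H_memI[OF l(1)] by (simp add: cls_eq)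
  qed
  \<comment> \<open>A relation with first component zero comes from some \<open>k\<close> with
    \<open>i k = 0\<close>; then \<open>k = 0\<close>, and the second component is zero as
    well.\<close>
  have "inj_on j (carrier L')"
  proof (rule inj_onI)
    fix l m assume l: "l \<in> carrier L'" "m \<in> carrier L'" "j l = j m"
    then have "(\<zero>\<^bsub>E\<^esub> \<ominus>\<^bsub>E\<^esub> \<zero>\<^bsub>E\<^esub>, l \<ominus>\<^bsub>L'\<^esub> m) \<in> H" by (simp add: j_def cls_eq)
    then show "l = m"
    proof (rule H_memE)
      fix k assume k: "k \<in> carrier L" "(\<zero>\<^bsub>E\<^esub> \<ominus>\<^bsub>E\<^esub> \<zero>\<^bsub>E\<^esub>, l \<ominus>\<^bsub>L'\<^esub> m) = (i k, \<ominus>\<^bsub>L'\<^esub> \<beta> k)"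
      then have "i k = \<zero>\<^bsub>E\<^esub>" by (metis Pair_inject e.E.M.minus_zero_iff e.E.M.zero_closed)
      then have "k = \<zero>\<^bsub>L\<^esub>" by (rule e.i_eq_zero[OF k(1)])
      then have "l \<ominus>\<^bsub>L'\<^esub> m = \<zero>\<^bsub>L'\<^esub>"
        using k mod_hom_zero[OF b e.L L'] L'.M.add.inv_one by (simp add: a_inv_def)
      then show "l = m" using l L'.M.minus_zero_iff by blast
    qed
  qed
  moreover have "j ` carrier L' = {C \<in> carrier Q. q C = \<zero>\<^bsub>N\<^esub>}"
  proof (rule subset_antisym)
    show "j ` carrier L' \<subseteq> {C \<in> carrier Q. q C = \<zero>\<^bsub>N\<^esub>}"
      by (rule image_subsetI) (simp add: j_def q_cls)
    show "{C \<in> carrier Q. q C = \<zero>\<^bsub>N\<^esub>} \<subseteq> j ` carrier L'"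
    proof (rule subsetI, elim CollectE conjE)
      fix C assume C: "C \<in> carrier Q" "q C = \<zero>\<^bsub>N\<^esub>"
      show "C \<in> j ` carrier L'"
      proof (rule clsE[OF C(1)])
        fix x l assume x: "x \<in> carrier E" "l \<in> carrier L'" "C = cls x l"
        then have "p x = \<zero>\<^bsub>N\<^esub>" using C q_cls by simp
        then obtain m where "m \<in> carrier L" "x = i m" using e.kerE[OF x(1)] by metis
        then have "C = j (\<beta> m \<oplus>\<^bsub>L'\<^esub> l)" using x cls_i by (simp add: j_def)
        then show ?thesis using x \<open>m \<in> carrier L\<close> by (intro image_eqI[of _ _ "\<beta> m \<oplus>\<^bsub>L'\<^esub> l"]) simp_all
      qed
    qed
  qed
  moreover have "q ` carrier Q = carrier N"
  proof (rule subset_antisym)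
    show "q ` carrier Q \<subseteq> carrier N" using mod_hom_closed[OF q] by (rule image_subsetI)
    show "carrier N \<subseteq> q ` carrier Q"
    proof
      fix n assume "n \<in> carrier N"
      then obtain x where "x \<in> carrier E" "p x = n" by (rule e.surjE)
      then show "n \<in> q ` carrier Q" by (intro image_eqI[of _ _ "cls x \<zero>\<^bsub>L'\<^esub>"]) (simp_all add: q_cls)
    qed
  qed
  ultimately have "extension R N L' Q j q"
    using e.N L' Q j q by (simp add: extension_def extensions_def)
  moreover have "ext_mor R L (\<lambda>x. x) \<beta> (E, i, p) (Q, j, q) c"
    unfolding ext_mor_iff using c cls_i by (simp add: c_def j_def q_cls)
  ultimately show ?thesis using po that by blast
qed

text \<open>The fibre product is a submodule of the direct sum, from which it inherits the module
  axioms; what remains is exactness.\<close>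

lemma pullback_extension:
  assumes e: "extension R N' L E i p" and N: "module R N" and a: "\<alpha> \<in> mod_hom R N N'"
  obtains Q j q c where "pullback_ext N L \<alpha> (E, i, p) = (Q, j, q)" "extension R N L Q j q"
    "ext_mor R L \<alpha> (\<lambda>x. x) (Q, j, q) (E, i, p) c"
proof -
  interpret e: extension R N' L E i p by fact
  interpret N: module R N by fact
  note [simp] = mod_hom_closed[OF a]
  define S where "S = direct_sum E N"
  define K where "K = {(e, n). e \<in> carrier E \<and> n \<in> carrier N \<and> p e = \<alpha> n}"
  define Q where "Q = S\<lparr>carrier := K\<rparr>"
  define j where "j = (\<lambda>l\<in>carrier L. (i l, \<zero>\<^bsub>N\<^esub>))"
  define q where "q = (\<lambda>z\<in>K. snd z)"
  define c where "c = (\<lambda>z\<in>K. fst z)"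
  have pb: "pullback_ext N L \<alpha> (E, i, p) = (Q, j, q)"
    by (simp add: pullback_ext_def Let_def S_def K_def Q_def j_def q_def)
  have S: "module R S" unfolding S_def by (rule module_direct_sum[OF e.E N])
  interpret S: module R S by (rule S)
  have K: "(x, n) \<in> K \<longleftrightarrow> x \<in> carrier E \<and> n \<in> carrier N \<and> p x = \<alpha> n" for x n
    by (simp add: K_def)
  have sub: "submodule K R S"
  proof (rule S.submoduleI)
    show "K \<subseteq> carrier S" by (auto simp: K_def S_def)
    show "\<zero>\<^bsub>S\<^esub> \<in> K" by (simp add: S_def K mod_hom_zero[OF a N e.N])
    show "\<ominus>\<^bsub>S\<^esub> z \<in> K" if "z \<in> K" for z
      using that by (cases z) (simp add: S_def K direct_sum_a_inv[OF e.E N] e.p_a_inv mod_hom_a_inv[OF a N e.N])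
    show "z \<oplus>\<^bsub>S\<^esub> w \<in> K" if "z \<in> K" "w \<in> K" for z w
      using that by (cases z; cases w) (simp add: S_def K e.p_add mod_hom_add[OF a])
    show "r \<odot>\<^bsub>S\<^esub> z \<in> K" if "r \<in> carrier R" "z \<in> K" for r z
      using that by (cases z) (simp add: S_def K e.p_smult mod_hom_smult[OF a])
  qed
  have Q: "module R Q" unfolding Q_def by (rule submodule.submodule_is_module[OF sub S])
  have Q_simps [simp]: "carrier Q = K" "\<zero>\<^bsub>Q\<^esub> = (\<zero>\<^bsub>E\<^esub>, \<zero>\<^bsub>N\<^esub>)"
    "z \<oplus>\<^bsub>Q\<^esub> w = (fst z \<oplus>\<^bsub>E\<^esub> fst w, snd z \<oplus>\<^bsub>N\<^esub> snd w)"
    "r \<odot>\<^bsub>Q\<^esub> z = (r \<odot>\<^bsub>E\<^esub> fst z, r \<odot>\<^bsub>N\<^esub> snd z)" for z w r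
    by (simp_all add: Q_def S_def) (cases z; cases w; simp)+
  have K': "z \<in> K \<Longrightarrow> fst z \<in> carrier E \<and> snd z \<in> carrier N \<and> p (fst z) = \<alpha> (snd z)" for z
    by (cases z) (simp add: K)
  have j: "j \<in> mod_hom R L Q"
    unfolding j_def
    by (rule mod_hom_restrictI[OF e.L]) (simp_all add: K mod_hom_zero[OF a N e.N] e.i_add e.i_smult)
  have q: "q \<in> mod_hom R Q N"
    unfolding q_def Q_simps(1)[symmetric]
    by (rule mod_hom_restrictI[OF Q]) (use K' in simp_all)
  have c: "c \<in> mod_hom R Q E"
    unfolding c_def Q_simps(1)[symmetric]
    by (rule mod_hom_restrictI[OF Q]) (use K' in simp_all)
  have jK: "(i l, \<zero>\<^bsub>N\<^esub>) \<in> K" if "l \<in> carrier L" for l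
    using that by (simp add: K mod_hom_zero[OF a N e.N])
  have "inj_on j (carrier L)"
    by (rule inj_onI) (simp add: j_def e.i_eq_iff)
  moreover have "j ` carrier L = {z \<in> carrier Q. q z = \<zero>\<^bsub>N\<^esub>}"
  proof (rule subset_antisym)
    show "j ` carrier L \<subseteq> {z \<in> carrier Q. q z = \<zero>\<^bsub>N\<^esub>}"
      by (rule image_subsetI) (simp add: j_def q_def jK)
    show "{z \<in> carrier Q. q z = \<zero>\<^bsub>N\<^esub>} \<subseteq> j ` carrier L"
    proof (rule subsetI, elim CollectE conjE)
      fix z assume z: "z \<in> carrier Q" "q z = \<zero>\<^bsub>N\<^esub>"
      then have "p (fst z) = \<zero>\<^bsub>N'\<^esub>" "snd z = \<zero>\<^bsub>N\<^esub>" "fst z \<in> carrier E"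
        using K' mod_hom_zero[OF a N e.N] by (simp_all add: q_def)
      then obtain l where "l \<in> carrier L" "fst z = i l" using e.kerE by metis
      then show "z \<in> j ` carrier L"
        using \<open>snd z = \<zero>\<^bsub>N\<^esub>\<close> by (intro image_eqI[of _ _ l]) (simp_all add: j_def prod_eq_iff)
    qed
  qed
  moreover have "q ` carrier Q = carrier N"
  proof (rule subset_antisym)
    show "q ` carrier Q \<subseteq> carrier N" using mod_hom_closed[OF q] by (rule image_subsetI)
    show "carrier N \<subseteq> q ` carrier Q"
    proof
      fix n assume n: "n \<in> carrier N"
      then obtain x where "x \<in> carrier E" "p x = \<alpha> n" using e.surjE[of "\<alpha> n"] by auto
      then show "n \<in> q ` carrier Q" using n by (intro image_eqI[of _ _ "(x, n)"]) (simp_all add: q_def K)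
    qed
  qed
  ultimately have "extension R N L Q j q"
    using N e.L Q j q by (simp add: extension_def extensions_def)
  moreover have "ext_mor R L \<alpha> (\<lambda>x. x) (Q, j, q) (E, i, p) c"
    unfolding ext_mor_iff using c K' by (simp add: c_def j_def q_def jK)
  ultimately show ?thesis using pb that by blast
qed

section \<open>Moving an extension into the universe\<close>

lemma inj_Times_same_infinite:
  assumes "infinite (UNIV :: 'm set)"
  shows "\<exists>u :: 'm \<times> 'm \<Rightarrow> 'm. inj u"
  using card_of_Times_same_infinite[OF assms] unfolding UNIV_Times_UNIV card_of_ordIso[symmetric]
  by (auto simp: bij_betw_def)

text \<open>A set-theoretic section \<open>s\<close> of \<open>p\<close> writes every element of
  \<open>E\<close> as \<open>s n\<close> plus some \<open>i l\<close>, so the pair (n, l) determines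
  it. Thus \<open>E\<close> injects into \<open>'m \<times> 'm\<close>, hence into
  \<open>'m\<close>, and its structure is carried along this injection.\<close>

lemma extension_transport:
  fixes E :: "('r, 'e) module" and N L :: "('r, 'm) module"
  assumes e: "extension R N L E i p" and inf: "infinite (UNIV :: 'm set)"
  obtains E' :: "('r, 'm) module" and i' p' t where "extension R N L E' i' p'"
    "ext_mor R L (\<lambda>x. x) (\<lambda>x. x) (E, i, p) (E', i', p') t"
proof -
  interpret e: extension R N L E i p by fact
  obtain w :: "'m \<times> 'm \<Rightarrow> 'm" where w: "inj w" using inj_Times_same_infinite[OF inf] by blast
  define s where "s n = (SOME x. x \<in> carrier E \<and> p x = n)" for n
  have s: "s n \<in> carrier E" "p (s n) = n" if "n \<in> carrier N" for n
  proof -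
    have "\<exists>x. x \<in> carrier E \<and> p x = n" by (rule e.surjE[OF that]) (intro exI conjI)
    from someI_ex[OF this] show "s n \<in> carrier E" "p (s n) = n" unfolding s_def by simp_all
  qed
  define d where "d x = (SOME l. l \<in> carrier L \<and> x = s (p x) \<oplus>\<^bsub>E\<^esub> i l)" for x
  have d: "x = s (p x) \<oplus>\<^bsub>E\<^esub> i (d x)" if x: "x \<in> carrier E" for x
  proof -
    have "\<exists>l. l \<in> carrier L \<and> x = s (p x) \<oplus>\<^bsub>E\<^esub> i l"
      by (rule e.same_fibreE[of x "s (p x)"]) (use x s in \<open>auto intro!: exI conjI\<close>)
    from someI_ex[OF this] show ?thesis unfolding d_def by (rule conjunct2)
  qed
  define u where "u x = w (p x, d x)" for x
  have u: "inj_on u (carrier E)"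
  proof (rule inj_onI)
    fix x y assume x: "x \<in> carrier E" "y \<in> carrier E" "u x = u y"
    then have "p x = p y" "d x = d y" using w by (simp_all add: u_def inj_eq)
    then show "x = y" using d[OF x(1)] d[OF x(2)] by simp
  qed
  define v where "v = inv_into (carrier E) u"
  have vu [simp]: "v (u x) = x" if "x \<in> carrier E" for x
    using that u by (simp add: v_def)
  \<comment> \<open>The two ring fields of a module record have no meaning for a module and stay
    unspecified.\<close>
  define E' :: "('r, 'm) module" where "E' = \<lparr>carrier = u ` carrier E, monoid.mult = undefined, monoid.one = undefined,
     ring.zero = u \<zero>\<^bsub>E\<^esub>, ring.add = (\<lambda>x y. u (v x \<oplus>\<^bsub>E\<^esub> v y)), module.smult = (\<lambda>r x. u (r \<odot>\<^bsub>E\<^esub> v x))\<rparr>"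
  have E'_simps [simp]: "carrier E' = u ` carrier E" "\<zero>\<^bsub>E'\<^esub> = u \<zero>\<^bsub>E\<^esub>"
     "x \<oplus>\<^bsub>E'\<^esub> y = u (v x \<oplus>\<^bsub>E\<^esub> v y)" "r \<odot>\<^bsub>E'\<^esub> x = u (r \<odot>\<^bsub>E\<^esub> v x)" for x y r
    by (simp_all add: E'_def)
  have "abelian_group E'"
  proof (rule abelian_groupI)
    show "\<exists>y\<in>carrier E'. y \<oplus>\<^bsub>E'\<^esub> x = \<zero>\<^bsub>E'\<^esub>" if x: "x \<in> carrier E'" for x
    proof -
      obtain z where z: "z \<in> carrier E" "x = u z" using x by auto
      then show ?thesis by (intro bexI[of _ "u (\<ominus>\<^bsub>E\<^esub> z)"]) (simp_all add: e.E.M.l_neg)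
    qed
  qed (auto simp: e.E.M.a_ac)
  then have E': "module R E'"
    by (intro moduleI module.axioms(1)[OF e.E]) (auto simp: e.E.smult_l_distr e.E.smult_r_distr e.E.smult_assoc1)
  define i' where "i' = (\<lambda>l\<in>carrier L. u (i l))"
  define p' where "p' = (\<lambda>x\<in>carrier E'. p (v x))"
  define t where "t = (\<lambda>x\<in>carrier E. u x)"
  have t: "t \<in> mod_hom R E E'"
    unfolding t_def by (rule mod_hom_restrictI[OF e.E]) simp_all
  have i': "i' \<in> mod_hom R L E'"
    unfolding i'_def by (rule mod_hom_restrictI[OF e.L]) (simp_all add: e.i_add e.i_smult)
  have p': "p' \<in> mod_hom R E' N"
    unfolding p'_def by (rule mod_hom_restrictI[OF E']) (auto simp: e.p_add e.p_smult)
  have "inj_on i' (carrier L)"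
    by (rule inj_onI) (use u e.i_eq_iff in \<open>simp add: i'_def inj_on_eq_iff\<close>)
  moreover have "i' ` carrier L = {x \<in> carrier E'. p' x = \<zero>\<^bsub>N\<^esub>}"
  proof -
    have "i' ` carrier L = u ` (i ` carrier L)" by (force simp: i'_def)
    also have "\<dots> = {x \<in> carrier E'. p' x = \<zero>\<^bsub>N\<^esub>}" unfolding e.i_image by (auto simp: p'_def dest: inj_onD[OF u])
    finally show ?thesis .
  qed
  moreover have "p' ` carrier E' = carrier N"
    unfolding e.p_image[symmetric] by (force simp: p'_def)
  ultimately have "extension R N L E' i' p'"
    using e.N e.L E' i' p' by (simp add: extension_def extensions_def)
  moreover have "ext_mor R L (\<lambda>x. x) (\<lambda>x. x) (E, i, p) (E', i', p') t"
    unfolding ext_mor_iff using t by (simp add: t_def i'_def p'_def)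
  ultimately show ?thesis by (rule that)
qed

section \<open>Classes of extensions, push-forward and pull-back\<close>

lemma ext_class_iff:
  assumes "extension R N L E i p"
  shows "(E', i', p') \<in> ext_class R N L (E, i, p) \<longleftrightarrow> extension R N L E' i' p' \<and>
    (\<exists>f. ext_mor R L (\<lambda>x. x) (\<lambda>x. x) (E, i, p) (E', i', p') f)"
proof -
  have "(E', i', p') \<in> extensions R N L \<longleftrightarrow> extension R N L E' i' p'"
    using assms by (simp add: extension_def)
  then show ?thesis using ext_equiv_iff[OF assms] unfolding ext_class_def by auto
qed

lemma ext_class_self:
  fixes N L E :: "('r, 'm) module"
  assumes "extension R N L E i p"
  shows "(E, i, p) \<in> ext_class R N L (E, i, p)"
  using ext_class_iff[OF assms] ext_mor_id[OF assms] assms by blast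

lemma Ext1E:
  fixes N L :: "('r, 'm) module"
  assumes "\<xi> \<in> Ext1 R N L" "module R N" "module R L"
  obtains E :: "('r, 'm) module" and i p where "extension R N L E i p" "\<xi> = ext_class R N L (E, i, p)"
proof -
  obtain e :: "('r, 'm, 'm) ext" where e: "e \<in> extensions R N L" "\<xi> = ext_class R N L e"
    using assms(1) unfolding Ext1_def by (elim imageE)
  obtain E i p where "e = (E, i, p)" by (rule prod_cases3)
  then show ?thesis using that[of E i p] e assms(2,3) by (simp add: extension_def)
qed

lemma ext_class_in_Ext1:
  fixes N L E :: "('r, 'm) module"
  assumes "extension R N L E i p"
  shows "ext_class R N L (E, i, p) \<in> Ext1 R N L"
  using extension.mem[OF assms] unfolding Ext1_def by (rule imageI)

text \<open>Removes both the union over representatives and the push-out: by the factorisation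
  through the push-out, membership is the existence of a morphism out of one fixed
  representative.\<close>

lemma ext_push_iff:
  fixes N L E :: "('r, 'm) module"
  assumes e: "extension R N L E i p" and L': "module R L'" and b: "\<beta> \<in> mod_hom R L L'"
  shows "(E1, i1, p1) \<in> ext_push R N L L' \<beta> (ext_class R N L (E, i, p)) \<longleftrightarrow>
    extension R N L' E1 i1 p1 \<and> (\<exists>h. ext_mor R L (\<lambda>x. x) \<beta> (E, i, p) (E1, i1, p1) h)"
    (is "?lhs \<longleftrightarrow> ?rhs")
proof
  assume ?lhs
  then obtain z where z: "z \<in> ext_class R N L (E, i, p)" "(E1, i1, p1) \<in> ext_class R N L' (pushout_ext L L' \<beta> z)"
    unfolding ext_push_def by (elim UN_E)
  obtain E0 i0 p0 where z0: "z = (E0, i0, p0)" by (cases z)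
  have e0: "extension R N L E0 i0 p0"
    using z(1) ext_class_iff[OF e] z0 by blast
  obtain f where f: "ext_mor R L (\<lambda>x. x) (\<lambda>x. x) (E, i, p) (E0, i0, p0) f"
    using z(1) ext_class_iff[OF e] z0 by blast
  obtain Q j q c where Q: "pushout_ext L L' \<beta> (E0, i0, p0) = (Q, j, q)" "extension R N L' Q j q"
    "ext_mor R L (\<lambda>x. x) \<beta> (E0, i0, p0) (Q, j, q) c"
    by (rule pushout_extension[OF e0 L' b])
  obtain g where g: "ext_mor R L' (\<lambda>x. x) (\<lambda>x. x) (Q, j, q) (E1, i1, p1) g"
    and e1: "extension R N L' E1 i1 p1"
    using z(2) ext_class_iff[OF Q(2)] unfolding z0 Q(1) by blast
  show ?rhs
    using ext_mor_compose[OF e f ext_mor_compose[OF e0 Q(3) g mod_hom_closed[OF b]]] e1 by blast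
next
  assume ?rhs
  then obtain h where h: "ext_mor R L (\<lambda>x. x) \<beta> (E, i, p) (E1, i1, p1) h"
    and e1: "extension R N L' E1 i1 p1" by blast
  obtain Q j q c where Q: "pushout_ext L L' \<beta> (E, i, p) = (Q, j, q)" "extension R N L' Q j q"
    "ext_mor R L (\<lambda>x. x) \<beta> (E, i, p) (Q, j, q) c"
    by (rule pushout_extension[OF e L' b])
  note id = ext_mor_factor_pushout[OF e Q(2) e1 b mod_hom_id[OF extension.N[OF e]] Q(3)
      ext_mor_cong[OF e h]]
  obtain k where k: "ext_mor R L' (\<lambda>x\<in>carrier N. x) (\<lambda>x. x) (Q, j, q) (E1, i1, p1) k"
    using id by auto
  have "ext_mor R L' (\<lambda>x. x) (\<lambda>x. x) (Q, j, q) (E1, i1, p1) k"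
    by (rule ext_mor_cong[OF Q(2) k]) simp_all
  then have "(E1, i1, p1) \<in> ext_class R N L' (pushout_ext L L' \<beta> (E, i, p))"
    unfolding Q(1) using ext_class_iff[OF Q(2)] e1 by blast
  then show ?lhs
    unfolding ext_push_def using ext_class_self[OF e] by (intro UN_I)
qed

text \<open>Dual to the push-forward. The morphisms now end in the fixed representative, so the
  equivalences furnished by class membership have to be inverted.\<close>

lemma ext_pull_iff:
  fixes N L E :: "('r, 'm) module"
  assumes e: "extension R N' L E i p" and N: "module R N" and a: "\<alpha> \<in> mod_hom R N N'"
  shows "(E1, i1, p1) \<in> ext_pull R N L \<alpha> (ext_class R N' L (E, i, p)) \<longleftrightarrow>
    extension R N L E1 i1 p1 \<and> (\<exists>h. ext_mor R L \<alpha> (\<lambda>x. x) (E1, i1, p1) (E, i, p) h)"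
    (is "?lhs \<longleftrightarrow> ?rhs")
proof
  assume ?lhs
  then obtain z where z: "z \<in> ext_class R N' L (E, i, p)" "(E1, i1, p1) \<in> ext_class R N L (pullback_ext N L \<alpha> z)"
    unfolding ext_pull_def by (elim UN_E)
  obtain E0 i0 p0 where z0: "z = (E0, i0, p0)" by (cases z)
  have e0: "extension R N' L E0 i0 p0"
    using z(1) ext_class_iff[OF e] z0 by blast
  obtain f where f: "ext_mor R L (\<lambda>x. x) (\<lambda>x. x) (E0, i0, p0) (E, i, p) f"
    using z(1) ext_class_iff[OF e] z0 ext_mor_inverse[OF e e0] by blast
  obtain Q j q c where Q: "pullback_ext N L \<alpha> (E0, i0, p0) = (Q, j, q)" "extension R N L Q j q"
    "ext_mor R L \<alpha> (\<lambda>x. x) (Q, j, q) (E0, i0, p0) c"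
    by (rule pullback_extension[OF e0 N a])
  have e1: "extension R N L E1 i1 p1"
    using z(2) ext_class_iff[OF Q(2)] unfolding z0 Q(1) by blast
  obtain g where g: "ext_mor R L (\<lambda>x. x) (\<lambda>x. x) (E1, i1, p1) (Q, j, q) g"
    using z(2) ext_class_iff[OF Q(2)] ext_mor_inverse[OF Q(2) e1] unfolding z0 Q(1) by blast
  show ?rhs
    using ext_mor_compose[OF e1 g ext_mor_compose[OF Q(2) Q(3) f]] e1 by blast
next
  assume ?rhs
  then obtain h where h: "ext_mor R L \<alpha> (\<lambda>x. x) (E1, i1, p1) (E, i, p) h"
    and e1: "extension R N L E1 i1 p1" by blast
  obtain Q j q c where Q: "pullback_ext N L \<alpha> (E, i, p) = (Q, j, q)" "extension R N L Q j q"
    "ext_mor R L \<alpha> (\<lambda>x. x) (Q, j, q) (E, i, p) c"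
    by (rule pullback_extension[OF e N a])
  have "\<exists>k. ext_mor R L (\<lambda>x. x) (\<lambda>x\<in>carrier L. x) (E1, i1, p1) (Q, j, q) k"
    by (rule ext_mor_factor_pullback[OF e1 Q(2) e mod_hom_id[OF extension.L[OF e]] a Q(3)],
        rule ext_mor_cong[OF e1 h]) simp_all
  then obtain k where k: "ext_mor R L (\<lambda>x. x) (\<lambda>x\<in>carrier L. x) (E1, i1, p1) (Q, j, q) k" by blast
  have "ext_mor R L (\<lambda>x. x) (\<lambda>x. x) (E1, i1, p1) (Q, j, q) k"
    by (rule ext_mor_cong[OF e1 k]) simp_all
  then have "(E1, i1, p1) \<in> ext_class R N L (pullback_ext N L \<alpha> (E, i, p))"
    unfolding Q(1) using ext_class_iff[OF Q(2)] ext_mor_inverse[OF e1 Q(2)] e1 by blast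
  then show ?lhs
    unfolding ext_pull_def using ext_class_self[OF e] by (intro UN_I)
qed

text \<open>A morphism over (\<alpha>, \<beta>) is the same as one from the push-out of the source
  to the target, and as one from the source to the pull-back of the target. The infinite universe
  guarantees that the push-out class has a member at which the two sides can be compared.\<close>

theorem ext_push_eq_ext_pull_iff:
  fixes N L E E' :: "('r, 'm) module"
  assumes e: "extension R N L E i p" and e': "extension R N' L' E' i' p'"
    and a: "\<alpha> \<in> mod_hom R N N'" and b: "\<beta> \<in> mod_hom R L L'" and inf: "infinite (UNIV :: 'm set)"
  shows "ext_push R N L L' \<beta> (ext_class R N L (E, i, p)) = ext_pull R N L' \<alpha> (ext_class R N' L' (E', i', p'))
    \<longleftrightarrow> (\<exists>f. ext_mor R L \<alpha> \<beta> (E, i, p) (E', i', p') f)" (is "?lhs \<longleftrightarrow> ?rhs")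
proof
  interpret e: extension R N L E i p by fact
  interpret e': extension R N' L' E' i' p' by fact
  note push = ext_push_iff[OF e e'.L b] and pull = ext_pull_iff[OF e' e.N a]
  {
    assume ?lhs
    obtain Q j q c where Q: "pushout_ext L L' \<beta> (E, i, p) = (Q, j, q)" "extension R N L' Q j q"
      "ext_mor R L (\<lambda>x. x) \<beta> (E, i, p) (Q, j, q) c"
      by (rule pushout_extension[OF e e'.L b])
    \<comment> \<open>A copy of the push-out on \<open>'m\<close> belongs to the left class, hence
      to the right one. The two memberships give morphisms into it and out of it, whose composite is
      the wanted map.\<close>
    obtain E1 :: "('r, 'm) module" and i1 p1 t where e1: "extension R N L' E1 i1 p1"
      and t: "ext_mor R L' (\<lambda>x. x) (\<lambda>x. x) (Q, j, q) (E1, i1, p1) t"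
      by (rule extension_transport[OF Q(2) inf])
    note h = ext_mor_compose[OF e Q(3) t mod_hom_closed[OF b]]
    have "(E1, i1, p1) \<in> ext_push R N L L' \<beta> (ext_class R N L (E, i, p))"
      using push e1 h by blast
    then have "(E1, i1, p1) \<in> ext_pull R N L' \<alpha> (ext_class R N' L' (E', i', p'))"
      unfolding \<open>?lhs\<close> .
    then obtain k where k: "ext_mor R L' \<alpha> (\<lambda>x. x) (E1, i1, p1) (E', i', p') k"
      using pull by blast
    show ?rhs using ext_mor_compose[OF e h k mod_hom_closed[OF b]] by blast
  }
  {
    assume ?rhs
    then obtain f where f: "ext_mor R L \<alpha> \<beta> (E, i, p) (E', i', p') f" by blast
    \<comment> \<open>Given \<open>f\<close>, it factors through any candidate \<open>z\<close> that
      carries one of the two partial morphisms, and the other partial morphism is the remaining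
      factor.\<close>
    have "z \<in> ext_push R N L L' \<beta> (ext_class R N L (E, i, p)) \<longleftrightarrow>
        z \<in> ext_pull R N L' \<alpha> (ext_class R N' L' (E', i', p'))" for z
    proof (cases z)
      case (fields E1 i1 p1)
      show ?thesis
        unfolding fields push pull
        using ext_mor_factor_pushout[OF e _ e' b a _ f] ext_mor_factor_pullback[OF e _ e' b a _ f] by metis
    qed
    then show ?lhs by (rule Set.set_eqI)
  }
qed

section \<open>Categories of modules and of extensions\<close>

lemma maximal_CM_module: "maximal_CM R M \<Longrightarrow> module R M"
  by (simp add: maximal_CM_def)

lemma compose_mod_hom_id:
  assumes "f \<in> mod_hom R M N"
  shows "compose (carrier M) f (\<lambda>x\<in>carrier M. x) = f"
    and "compose (carrier M) (\<lambda>x\<in>carrier N. x) f = f"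
proof -
  show "compose (carrier M) f (\<lambda>x\<in>carrier M. x) = f"
    by (rule extensionalityI[OF compose_extensional mod_hom_extensional[OF assms]]) (simp add: compose_eq)
  show "compose (carrier M) (\<lambda>x\<in>carrier N. x) f = f"
    by (rule extensionalityI[OF compose_extensional mod_hom_extensional[OF assms]])
      (simp add: compose_eq mod_hom_closed[OF assms])
qed

lemma compose_mod_hom_assoc:
  assumes "f \<in> mod_hom R K M"
  shows "compose (carrier K) h (compose (carrier K) g f) = compose (carrier K) (compose (carrier M) h g) f"
  by (rule extensionalityI[OF compose_extensional compose_extensional])
    (simp add: compose_eq mod_hom_closed[OF assms])

lemma CM_simps [simp]:
  "Obj (CM R) = {M. maximal_CM R M}" "Hom (CM R) = mod_hom R"
  "Id (CM R) M = (\<lambda>x\<in>carrier M. x)" "Comp (CM R) K M N g f = compose (carrier K) g f"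
  by (simp_all add: CM_def)

lemma category_CM: "category (CM R)"
proof
  show "Id (CM R) M \<in> Hom (CM R) M M" if "M \<in> Obj (CM R)" for M
    using that mod_hom_id[OF maximal_CM_module] by simp
  show "Comp (CM R) K M N g f \<in> Hom (CM R) K N"
    if "K \<in> Obj (CM R)" "f \<in> Hom (CM R) K M" "g \<in> Hom (CM R) M N" for K M N f g
    using that mod_hom_compose[OF maximal_CM_module] by simp
qed (simp_all add: compose_mod_hom_id compose_mod_hom_assoc)

section \<open>The category of elements of Ext\<close>

lemma Ext_elements_Obj:
  "(N, L, \<xi>) \<in> Obj (Ext_elements R A B a b) \<longleftrightarrow> maximal_CM A N \<and> maximal_CM B L \<and>
     \<xi> \<in> Ext1 R (restrict_scalars a N) (restrict_scalars b L)"
  by (simp add: Ext_elements_def)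

lemma Ext_elements_Id [simp]:
  "Id (Ext_elements R A B a b) (N, L, \<xi>) = (\<lambda>x\<in>carrier N. x, \<lambda>x\<in>carrier L. x)"
  by (simp add: Ext_elements_def)

lemma Ext_elements_Comp [simp]:
  "Comp (Ext_elements R A B a b) (N, L, \<xi>) V W (\<alpha>', \<beta>') (\<alpha>, \<beta>) =
     (compose (carrier N) \<alpha>' \<alpha>, compose (carrier L) \<beta>' \<beta>)"
  by (simp add: Ext_elements_def)

lemma Ext_elements_Hom:
  "(\<alpha>, \<beta>) \<in> Hom (Ext_elements R A B a b) (N, L, \<xi>) (N', L', \<xi>') \<longleftrightarrow>
     \<alpha> \<in> mod_hom R (restrict_scalars a N) (restrict_scalars a N') \<and>
     \<beta> \<in> mod_hom R (restrict_scalars b L) (restrict_scalars b L') \<and>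
     ext_push R (restrict_scalars a N) (restrict_scalars b L) (restrict_scalars b L') \<beta> \<xi> =
     ext_pull R (restrict_scalars a N) (restrict_scalars b L') \<alpha> \<xi>'"
  by (simp add: Ext_elements_def)

text \<open>The \<open>itself\<close> parameter ties the type of the universe to the locale, so that
  its infinity can be an assumption.\<close>

locale ext_bimodule =
  fixes R :: "('r, 'x) ring_scheme" and A :: "('s, 'y) ring_scheme" and B :: "('t, 'z) ring_scheme"
    and a :: "'r \<Rightarrow> 's" and b :: "'r \<Rightarrow> 't" and universe :: "'m itself"
  assumes R: "cring R" and a: "a \<in> ring_hom R A" and b: "b \<in> ring_hom R B"
    and infinite_universe: "infinite (UNIV :: 'm set)"
begin

abbreviation resa :: "('s, 'm) module \<Rightarrow> ('r, 'm) module" where "resa \<equiv> restrict_scalars a"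
abbreviation resb :: "('t, 'm) module \<Rightarrow> ('r, 'm) module" where "resb \<equiv> restrict_scalars b"

abbreviation elements where
  "elements \<equiv> (Ext_elements R A B a b :: (('s, 'm) module \<times> ('t, 'm) module
     \<times> ('r, 'm, 'm) ext set, ('m \<Rightarrow> 'm) \<times> ('m \<Rightarrow> 'm)) cat)"

text \<open>Replaces the equation of classes by a middle map \<open>f\<close>. This map is asserted
  to exist and is not part of the arrow.\<close>

lemma Hom_iff:
  fixes E E' :: "('r, 'm) module"
  assumes "extension R (resa N) (resb L) E i p"
    and "extension R (resa N') (resb L') E' i' p'"
  shows "(\<alpha>, \<beta>) \<in> Hom elements (N, L, ext_class R (resa N) (resb L) (E, i, p))
      (N', L', ext_class R (resa N') (resb L') (E', i', p')) \<longleftrightarrow>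
     \<alpha> \<in> mod_hom R (resa N) (resa N') \<and>
     \<beta> \<in> mod_hom R (resb L) (resb L') \<and>
     (\<exists>f. ext_mor R (resb L) \<alpha> \<beta> (E, i, p) (E', i', p') f)"
  unfolding Ext_elements_Hom using ext_push_eq_ext_pull_iff[OF assms _ _ infinite_universe] by blast

lemma ObjE:
  assumes "V \<in> Obj elements"
  obtains N L and E :: "('r, 'm) module" and i p where
    "V = (N, L, ext_class R (resa N) (resb L) (E, i, p))"
    "maximal_CM A N" "maximal_CM B L"
    "extension R (resa N) (resb L) E i p"
proof -
  obtain N L \<xi> where V: "V = (N, L, \<xi>)" by (rule prod_cases3)
  have *: "maximal_CM A N" "maximal_CM B L" "\<xi> \<in> Ext1 R (resa N) (resb L)"
    using assms unfolding V Ext_elements_Obj by simp_all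
  note N = module_restrict_scalars[OF R a maximal_CM_module[OF *(1)]]
  note L = module_restrict_scalars[OF R b maximal_CM_module[OF *(2)]]
  obtain E :: "('r, 'm) module" and i p where
    "extension R (resa N) (resb L) E i p"
    "\<xi> = ext_class R (resa N) (resb L) (E, i, p)"
    by (rule Ext1E[OF *(3) N L])
  then show ?thesis using that V * by blast
qed

lemma ObjI:
  fixes E :: "('r, 'm) module"
  assumes "maximal_CM A N" "maximal_CM B L" "extension R (resa N) (resb L) E i p"
  shows "(N, L, ext_class R (resa N) (resb L) (E, i, p)) \<in> Obj elements"
  unfolding Ext_elements_Obj using assms ext_class_in_Ext1 by blast

text \<open>Closure under composition comes from composing middle maps, which makes it unnecessary
  to show that push-forward and pull-back are functorial and commute with each other.\<close>

lemma category_elements: "category elements"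
proof
  fix V V' :: "('s, 'm) module \<times> ('t, 'm) module \<times> ('r, 'm, 'm) ext set"
  assume "V \<in> Obj elements"
  then obtain N L and E :: "('r, 'm) module" and i p where
    V: "V = (N, L, ext_class R (resa N) (resb L) (E, i, p))"
    and N: "maximal_CM A N" and L: "maximal_CM B L"
    and e: "extension R (resa N) (resb L) E i p"
    by (rule ObjE)
  note modN = mod_hom_id[OF extension.N[OF e], unfolded restrict_scalars_simps]
  note modL = mod_hom_id[OF extension.L[OF e], unfolded restrict_scalars_simps]
  have "ext_mor R (resb L) (\<lambda>x\<in>carrier N. x) (\<lambda>x\<in>carrier L. x) (E, i, p) (E, i, p) (\<lambda>x\<in>carrier E. x)"
    by (rule ext_mor_cong[OF e ext_mor_id[OF e]]) simp_all
  then show "Id elements V \<in> Hom elements V V"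
    unfolding V Ext_elements_Id Hom_iff[OF e e] using modN modL by blast
next
  fix V V' V'' f g
  assume V: "V \<in> Obj elements" and V': "V' \<in> Obj elements" and V'': "V'' \<in> Obj elements"
    and f: "f \<in> Hom elements V V'" and g: "g \<in> Hom elements V' V''"
  obtain N L and E :: "('r, 'm) module" and i p where
    V: "V = (N, L, ext_class R (resa N) (resb L) (E, i, p))"
    and e: "extension R (resa N) (resb L) E i p"
    using V by (rule ObjE)
  obtain N' L' and E' :: "('r, 'm) module" and i' p' where
    V': "V' = (N', L', ext_class R (resa N') (resb L') (E', i', p'))"
    and e': "extension R (resa N') (resb L') E' i' p'"
    using V' by (rule ObjE)
  obtain N'' L'' and E'' :: "('r, 'm) module" and i'' p'' where
    V'': "V'' = (N'', L'', ext_class R (resa N'') (resb L'') (E'', i'', p''))"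
    and e'': "extension R (resa N'') (resb L'') E'' i'' p''"
    using V'' by (rule ObjE)
  obtain \<alpha> \<beta> where fab: "f = (\<alpha>, \<beta>)" by (cases f)
  obtain \<alpha>' \<beta>' where gab: "g = (\<alpha>', \<beta>')" by (cases g)
  obtain k where \<alpha>: "\<alpha> \<in> mod_hom R (resa N) (resa N')"
    and \<beta>: "\<beta> \<in> mod_hom R (resb L) (resb L')"
    and k: "ext_mor R (resb L) \<alpha> \<beta> (E, i, p) (E', i', p') k"
    using f unfolding fab V V' Hom_iff[OF e e'] by blast
  obtain k' where \<alpha>': "\<alpha>' \<in> mod_hom R (resa N') (resa N'')"
    and \<beta>': "\<beta>' \<in> mod_hom R (resb L') (resb L'')"
    and k': "ext_mor R (resb L') \<alpha>' \<beta>' (E', i', p') (E'', i'', p'') k'"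
    using g unfolding gab V' V'' Hom_iff[OF e' e''] by blast
  have "ext_mor R (resb L) (compose (carrier N) \<alpha>' \<alpha>) (compose (carrier L) \<beta>' \<beta>)
      (E, i, p) (E'', i'', p'') (compose (carrier E) k' k)"
    by (rule ext_mor_cong[OF e ext_mor_compose[OF e k k' mod_hom_closed[OF \<beta>]]]) (simp_all add: compose_eq)
  then show "Comp elements V V' V'' g f \<in> Hom elements V V''"
    unfolding fab gab V V'' Ext_elements_Comp Hom_iff[OF e e'']
    using mod_hom_compose[OF extension.N[OF e] \<alpha> \<alpha>'] mod_hom_compose[OF extension.L[OF e] \<beta> \<beta>'] by auto
next
  fix V V' and f :: "('m \<Rightarrow> 'm) \<times> ('m \<Rightarrow> 'm)"
  assume "f \<in> Hom elements V V'"
  moreover obtain N L \<xi> where V: "V = (N, L, \<xi>)" by (rule prod_cases3)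
  moreover obtain N' L' \<xi>' where V': "V' = (N', L', \<xi>')" by (rule prod_cases3)
  moreover obtain \<alpha> \<beta> where f: "f = (\<alpha>, \<beta>)" by (cases f)
  ultimately have "\<alpha> \<in> mod_hom R (resa N) (resa N')"
    "\<beta> \<in> mod_hom R (resb L) (resb L')"
    by (simp_all add: Ext_elements_Hom)
  from compose_mod_hom_id[OF this(1)] compose_mod_hom_id[OF this(2)]
  show "Comp elements V V V' f (Id elements V) = f" "Comp elements V V' V' (Id elements V') f = f"
    unfolding f V V' by simp_all
next
  fix V V' V'' W and f g h :: "('m \<Rightarrow> 'm) \<times> ('m \<Rightarrow> 'm)"
  assume "f \<in> Hom elements V V'"
  moreover obtain N L \<xi> where V: "V = (N, L, \<xi>)" by (rule prod_cases3)
  moreover obtain N' L' \<xi>' where V': "V' = (N', L', \<xi>')" by (rule prod_cases3)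
  moreover obtain \<alpha> \<beta> where f: "f = (\<alpha>, \<beta>)" by (cases f)
  ultimately have *: "\<alpha> \<in> mod_hom R (resa N) (resa N')"
    "\<beta> \<in> mod_hom R (resb L) (resb L')"
    by (simp_all add: Ext_elements_Hom)
  show "Comp elements V V'' W h (Comp elements V V' V'' g f) =
      Comp elements V V' W (Comp elements V' V'' W h g) f"
    by (cases g; cases h)
      (simp add: f V V' compose_mod_hom_assoc[OF *(1), unfolded restrict_scalars_simps]
        compose_mod_hom_assoc[OF *(2), unfolded restrict_scalars_simps])
qed

end

section \<open>Finitely generated modules\<close>

text \<open>Linear combinations built by adding one multiple of one generator at a time, possibly
  the same generator repeatedly. Inductions then have a single step and avoid finite sums.\<close>

inductive_set mspan ::
  "('r, 'x) ring_scheme \<Rightarrow> ('r, 'm, 'd) module_scheme \<Rightarrow> 'm set \<Rightarrow> 'm set"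
  for R M S where
  zero: "\<zero>\<^bsub>M\<^esub> \<in> mspan R M S"
| step: "\<lbrakk>r \<in> carrier R; s \<in> S; x \<in> mspan R M S\<rbrakk> \<Longrightarrow> r \<odot>\<^bsub>M\<^esub> s \<oplus>\<^bsub>M\<^esub> x \<in> mspan R M S"

context module
begin

lemma mspan_closed:
  assumes "S \<subseteq> carrier M" "x \<in> mspan R M S" shows "x \<in> carrier M"
  using assms(2) by induction (use assms(1) in auto)

lemma mspan_incl:
  assumes "S \<subseteq> carrier M" "s \<in> S" shows "s \<in> mspan R M S"
proof -
  have "\<one>\<^bsub>R\<^esub> \<odot>\<^bsub>M\<^esub> s \<oplus>\<^bsub>M\<^esub> \<zero>\<^bsub>M\<^esub> \<in> mspan R M S"
    using assms by (intro mspan.intros) auto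
  moreover have "s \<in> carrier M" using assms by blast
  ultimately show ?thesis by simp
qed

lemma mspan_add:
  assumes S: "S \<subseteq> carrier M" and x: "x \<in> mspan R M S" and y: "y \<in> mspan R M S"
  shows "x \<oplus>\<^bsub>M\<^esub> y \<in> mspan R M S"
  using x
proof induction
  case zero
  then show ?case using y mspan_closed[OF S y] by simp
next
  case (step r s x)
  have "s \<in> carrier M" using step S by blast
  then have "r \<odot>\<^bsub>M\<^esub> s \<oplus>\<^bsub>M\<^esub> x \<oplus>\<^bsub>M\<^esub> y = r \<odot>\<^bsub>M\<^esub> s \<oplus>\<^bsub>M\<^esub> (x \<oplus>\<^bsub>M\<^esub> y)"
    using step mspan_closed[OF S] y by (simp add: M.a_assoc)
  then show ?case using mspan.step[OF step(1,2,4)] by simp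
qed

lemma mspan_smult:
  assumes S: "S \<subseteq> carrier M" and r: "r \<in> carrier R" and x: "x \<in> mspan R M S"
  shows "r \<odot>\<^bsub>M\<^esub> x \<in> mspan R M S"
  using x
proof induction
  case zero
  then show ?case using r mspan.zero by simp
next
  case (step t s x)
  have "s \<in> carrier M" using step S by blast
  then have "r \<odot>\<^bsub>M\<^esub> (t \<odot>\<^bsub>M\<^esub> s \<oplus>\<^bsub>M\<^esub> x) = (r \<otimes> t) \<odot>\<^bsub>M\<^esub> s \<oplus>\<^bsub>M\<^esub> r \<odot>\<^bsub>M\<^esub> x"
    using step mspan_closed[OF S] r by (simp add: smult_r_distr smult_assoc1)
  then show ?case using mspan.step[OF _ step(2,4), where r = "r \<otimes> t"] r step(1) by simp
qed

lemma mspan_submodule: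
  assumes S: "S \<subseteq> carrier M" shows "submodule (mspan R M S) R M"
proof (rule submoduleI)
  show "\<ominus>\<^bsub>M\<^esub> x \<in> mspan R M S" if "x \<in> mspan R M S" for x
    using mspan_smult[OF S _ that, of "\<ominus> \<one>"] mspan_closed[OF S that] by (simp add: smult_l_minus)
qed (use mspan_closed[OF S] mspan.zero mspan_add[OF S] mspan_smult[OF S] in auto)

lemma mspan_least:
  assumes P: "submodule P R M" and S: "S \<subseteq> P" and x: "x \<in> mspan R M S"
  shows "x \<in> P"
  using x
proof induction
  case zero
  have "P \<noteq> {}" by (rule submoduleE(2)[OF P])
  then obtain y where y: "y \<in> P" by blast
  have "\<zero> \<odot>\<^bsub>M\<^esub> y \<in> P" by (rule submoduleE(4)[OF P _ y]) simp
  moreover have "y \<in> carrier M" using y submoduleE(1)[OF P] by blast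
  ultimately show ?case by simp
next
  case (step r s x)
  then show ?case using submoduleE(4,5)[OF P] S by blast
qed

lemma mspan_mono:
  assumes "S \<subseteq> T" "x \<in> mspan R M S" shows "x \<in> mspan R M T"
  using assms(2)
proof induction
  case zero
  show ?case by (rule mspan.zero)
next
  case (step r s x)
  then show ?case using assms(1) by (intro mspan.step) auto
qed

lemma mspan_empty: "mspan R M {} = {\<zero>\<^bsub>M\<^esub>}"
proof -
  have "x = \<zero>\<^bsub>M\<^esub>" if "x \<in> mspan R M {}" for x using that by induction simp_all
  then show ?thesis using mspan.zero by blast
qed

text \<open>Splits off one generator with a single coefficient. The inductions over generators in
  \<open>nakayama\<close> and \<open>finitely_generated_submodule\<close> rest on it.\<close>

lemma mspan_insertE:
  assumes S: "insert s S \<subseteq> carrier M" and z: "z \<in> mspan R M (insert s S)"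
  obtains r y where "r \<in> carrier R" "y \<in> mspan R M S" "z = r \<odot>\<^bsub>M\<^esub> s \<oplus>\<^bsub>M\<^esub> y"
proof -
  have S': "S \<subseteq> carrier M" "s \<in> carrier M" using S by auto
  have "\<exists>r\<in>carrier R. \<exists>y\<in>mspan R M S. z = r \<odot>\<^bsub>M\<^esub> s \<oplus>\<^bsub>M\<^esub> y"
    using z
  proof induction
    case zero
    show ?case
      by (intro bexI[of _ "\<zero>"] bexI[of _ "\<zero>\<^bsub>M\<^esub>"] mspan.zero) (use S' in simp_all)
  next
    case (step t u x)
    from step(4) obtain r y where ry: "r \<in> carrier R" "y \<in> mspan R M S" "x = r \<odot>\<^bsub>M\<^esub> s \<oplus>\<^bsub>M\<^esub> y"
      by (elim bexE)
    note y = mspan_closed[OF S'(1) ry(2)]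
    show ?case
    proof (cases "u = s")
      case True
      have "t \<odot>\<^bsub>M\<^esub> u \<oplus>\<^bsub>M\<^esub> x = (t \<oplus> r) \<odot>\<^bsub>M\<^esub> s \<oplus>\<^bsub>M\<^esub> y"
        using step(1) ry y S' True by (simp add: smult_l_distr M.a_assoc)
      then show ?thesis using step(1) ry by (intro bexI[of _ "t \<oplus> r"] bexI[of _ y]) auto
    next
      case False
      then have u: "u \<in> S" "u \<in> carrier M" using step(2) S' by auto
      have "t \<odot>\<^bsub>M\<^esub> u \<oplus>\<^bsub>M\<^esub> x = r \<odot>\<^bsub>M\<^esub> s \<oplus>\<^bsub>M\<^esub> (t \<odot>\<^bsub>M\<^esub> u \<oplus>\<^bsub>M\<^esub> y)"
        using step(1) ry y S' u by (simp add: M.a_lcomm)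
      then show ?thesis
        using ry mspan.step[OF step(1) u(1) ry(2)] by (intro bexI[of _ r] bexI[of _ "t \<odot>\<^bsub>M\<^esub> u \<oplus>\<^bsub>M\<^esub> y"]) auto
    qed
  qed
  then show thesis using that by (elim bexE)
qed

lemma finsum_mem_mspan:
  assumes "finite S" "S \<subseteq> carrier M" "f \<in> S \<rightarrow> carrier R"
  shows "(\<Oplus>\<^bsub>M\<^esub>s\<in>S. f s \<odot>\<^bsub>M\<^esub> s) \<in> mspan R M S"
  using assms
proof (induction S)
  case empty
  then show ?case by (simp add: mspan.zero)
next
  case (insert s S)
  have "(\<lambda>s. f s \<odot>\<^bsub>M\<^esub> s) \<in> S \<rightarrow> carrier M" using insert.prems by (auto simp: Pi_iff subset_iff)
  then have eq: "(\<Oplus>\<^bsub>M\<^esub>s\<in>insert s S. f s \<odot>\<^bsub>M\<^esub> s) = f s \<odot>\<^bsub>M\<^esub> s \<oplus>\<^bsub>M\<^esub> (\<Oplus>\<^bsub>M\<^esub>s\<in>S. f s \<odot>\<^bsub>M\<^esub> s)"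
    using insert.hyps insert.prems by (subst M.finsum_insert) auto
  show ?case
    unfolding eq using insert by (intro mspan.step mspan_mono[OF subset_insertI[of S s]]) auto
qed

lemma mspan_finsumE:
  assumes "finite S" "S \<subseteq> carrier M" "x \<in> mspan R M S"
  shows "\<exists>f \<in> S \<rightarrow> carrier R. x = (\<Oplus>\<^bsub>M\<^esub>s\<in>S. f s \<odot>\<^bsub>M\<^esub> s)"
  using assms
proof (induction S arbitrary: x)
  case empty
  then show ?case by (simp add: mspan_empty)
next
  case (insert s S)
  obtain r y where ry: "r \<in> carrier R" "y \<in> mspan R M S" "x = r \<odot>\<^bsub>M\<^esub> s \<oplus>\<^bsub>M\<^esub> y"
    by (rule mspan_insertE[OF insert.prems])
  obtain f where f: "f \<in> S \<rightarrow> carrier R" "y = (\<Oplus>\<^bsub>M\<^esub>s\<in>S. f s \<odot>\<^bsub>M\<^esub> s)"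
    using insert.IH[OF _ ry(2)] insert.prems by auto
  let ?f = "f(s := r)"
  have clos: "(\<lambda>u. ?f u \<odot>\<^bsub>M\<^esub> u) \<in> S \<rightarrow> carrier M"
    using insert.prems f(1) ry(1) by (auto simp: Pi_iff subset_iff)
  have "(\<Oplus>\<^bsub>M\<^esub>u\<in>insert s S. ?f u \<odot>\<^bsub>M\<^esub> u) = ?f s \<odot>\<^bsub>M\<^esub> s \<oplus>\<^bsub>M\<^esub> (\<Oplus>\<^bsub>M\<^esub>u\<in>S. ?f u \<odot>\<^bsub>M\<^esub> u)"
    using insert.hyps insert.prems clos ry(1) by (subst M.finsum_insert) auto
  also have "(\<Oplus>\<^bsub>M\<^esub>u\<in>S. ?f u \<odot>\<^bsub>M\<^esub> u) = y"
    unfolding f(2)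
  proof (rule M.finsum_cong'[OF refl])
    show "(\<lambda>s. f s \<odot>\<^bsub>M\<^esub> s) \<in> S \<rightarrow> carrier M"
      using insert.prems f(1) by (auto simp: Pi_iff subset_iff)
    show "?f u \<odot>\<^bsub>M\<^esub> u = f u \<odot>\<^bsub>M\<^esub> u" if "u \<in> S" for u
      using that insert.hyps by (cases "u = s") simp_all
  qed
  finally have "x = (\<Oplus>\<^bsub>M\<^esub>u\<in>insert s S. ?f u \<odot>\<^bsub>M\<^esub> u)" using ry by simp
  moreover have "?f \<in> insert s S \<rightarrow> carrier R" using f(1) ry(1) by auto
  ultimately show ?case by (rule bexI)
qed

end

lemma finitely_generated_iff:
  assumes "module R M"
  shows "finitely_generated R M \<longleftrightarrow> (\<exists>S. finite S \<and> S \<subseteq> carrier M \<and> mspan R M S = carrier M)"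
proof -
  interpret module R M by fact
  have "(\<forall>m \<in> carrier M. \<exists>c \<in> S \<rightarrow> carrier R. m = (\<Oplus>\<^bsub>M\<^esub>s\<in>S. c s \<odot>\<^bsub>M\<^esub> s)) \<longleftrightarrow> mspan R M S = carrier M"
    if S: "finite S" "S \<subseteq> carrier M" for S
  proof
    assume *: "\<forall>m \<in> carrier M. \<exists>c \<in> S \<rightarrow> carrier R. m = (\<Oplus>\<^bsub>M\<^esub>s\<in>S. c s \<odot>\<^bsub>M\<^esub> s)"
    have "m \<in> mspan R M S" if "m \<in> carrier M" for m
      using bspec[OF * that] finsum_mem_mspan[OF S] by (elim bexE) simp
    then show "mspan R M S = carrier M" using mspan_closed[OF S(2)] by (intro subset_antisym subsetI)
  next
    assume "mspan R M S = carrier M"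
    then show "\<forall>m \<in> carrier M. \<exists>c \<in> S \<rightarrow> carrier R. m = (\<Oplus>\<^bsub>M\<^esub>s\<in>S. c s \<odot>\<^bsub>M\<^esub> s)"
      using mspan_finsumE[OF S] by (intro ballI) simp
  qed
  then show ?thesis unfolding finitely_generated_def by (simp cong: conj_cong)
qed

lemma finitely_generatedI:
  assumes "module R M" "finite S" "S \<subseteq> carrier M" "\<And>x. x \<in> carrier M \<Longrightarrow> x \<in> mspan R M S"
  shows "finitely_generated R M"
proof -
  interpret module R M by fact
  have "mspan R M S = carrier M"
    using mspan_closed[OF assms(3)] assms(4) by (intro subset_antisym subsetI)
  then show ?thesis using finitely_generated_iff[OF assms(1)] assms(2,3) by blast
qed

lemma finitely_generatedE:
  assumes "module R M" "finitely_generated R M"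
  obtains S where "finite S" "S \<subseteq> carrier M" "carrier M \<subseteq> mspan R M S"
  using assms(2) unfolding finitely_generated_iff[OF assms(1)] by (elim exE conjE) simp

text \<open>As \<open>h\<close> is onto, every scalar of \<open>A\<close> acts as a scalar of
  \<open>R\<close>, so generators over one ring are generators over the other.\<close>

lemma mspan_restrict_scalars:
  assumes "h ` carrier R = carrier A"
  shows "mspan R (restrict_scalars h M) S = mspan A M S"
proof (intro subset_antisym subsetI)
  show "x \<in> mspan A M S" if "x \<in> mspan R (restrict_scalars h M) S" for x
    using that
  proof induction
    case zero
    then show ?case using mspan.zero[of M A S] by simp
  next
    case (step r s x)
    have "h r \<in> carrier A" using step(1) assms by blast
    then show ?case using mspan.step[OF _ step(2,4), where r = "h r"] by simp
  qed
  show "x \<in> mspan R (restrict_scalars h M) S" if "x \<in> mspan A M S" for x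
    using that
  proof induction
    case zero
    then show ?case using mspan.zero[of "restrict_scalars h M" R S] by simp
  next
    case (step r s x)
    obtain t where t: "t \<in> carrier R" "r = h t" using step(1) assms by blast
    then show ?case using mspan.step[OF t(1) step(2,4)] by simp
  qed
qed

lemma finitely_generated_restrict_scalars:
  assumes "module A M" "module R (restrict_scalars h M)" "h ` carrier R = carrier A"
  shows "finitely_generated R (restrict_scalars h M) \<longleftrightarrow> finitely_generated A M"
  by (simp add: finitely_generated_iff[OF assms(1)] finitely_generated_iff[OF assms(2)]
      mspan_restrict_scalars[OF assms(3)])

lemma mspan_image:
  assumes f: "f \<in> mod_hom R M N" and M: "module R M" "module R N" and S: "S \<subseteq> carrier M"
    and x: "x \<in> mspan R M S"
  shows "f x \<in> mspan R N (f ` S)"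
  using x
proof induction
  interpret M: module R M by fact
  case zero
  show ?case using mspan.zero[of N R "f ` S"] mod_hom_zero[OF f M] by simp
next
  interpret M: module R M by fact
  case (step r s x)
  have "s \<in> carrier M" "x \<in> carrier M" using step S M.mspan_closed[OF S step(3)] by auto
  then show ?case
    using step mspan.step[OF step(1) _ step(4), where s = "f s"] by (simp add: mod_hom_add[OF f] mod_hom_smult[OF f])
qed

lemma finitely_generated_image:
  assumes f: "f \<in> mod_hom R M N" and M: "module R M" "module R N" and fg: "finitely_generated R M"
    and surj: "\<And>y. y \<in> carrier N \<Longrightarrow> \<exists>x\<in>carrier M. f x = y"
  shows "finitely_generated R N"
proof -
  obtain S where S: "finite S" "S \<subseteq> carrier M" "carrier M \<subseteq> mspan R M S"
    by (rule finitely_generatedE[OF M(1) fg])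
  show ?thesis
  proof (rule finitely_generatedI[OF M(2)])
    show "finite (f ` S)" "f ` S \<subseteq> carrier N" using S mod_hom_closed[OF f] by auto
    show "y \<in> mspan R N (f ` S)" if "y \<in> carrier N" for y
      using surj[OF that] mspan_image[OF f M S(2) subsetD[OF S(3)]] by metis
  qed
qed

text \<open>Generators of \<open>L\<close> together with lifts of generators of \<open>N\<close>
  suffice: an element and a combination of the lifts with the same image differ by an element of
  \<open>L\<close>.\<close>

lemma (in extension) finitely_generated_middle:
  assumes fgL: "finitely_generated R L" and fgN: "finitely_generated R N"
  shows "finitely_generated R E"
proof -
  obtain S where S: "finite S" "S \<subseteq> carrier L" "carrier L \<subseteq> mspan R L S"
    by (rule finitely_generatedE[OF L fgL])
  obtain T where T: "finite T" "T \<subseteq> carrier N" "carrier N \<subseteq> mspan R N T"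
    by (rule finitely_generatedE[OF N fgN])
  have "\<exists>x. x \<in> carrier E \<and> p x = n" if "n \<in> carrier N" for n
    by (rule surjE[OF that]) (intro exI conjI)
  then obtain s where s: "n \<in> carrier N \<Longrightarrow> s n \<in> carrier E \<and> p (s n) = n" for n by metis
  let ?G = "i ` S \<union> s ` T"
  have G: "?G \<subseteq> carrier E" using S T s by auto
  have lift: "\<exists>x\<in>mspan R E ?G. p x = n" if "n \<in> mspan R N T" for n
    using that
  proof induction
    case zero
    then show ?case using mspan.zero[of E R ?G] by (intro bexI[of _ "\<zero>\<^bsub>E\<^esub>"]) auto
  next
    case (step r t n)
    from step(4) obtain x where x: "x \<in> mspan R E ?G" "p x = n" by (elim bexE)
    have t: "s t \<in> carrier E" "p (s t) = t" using s T(2) step(2) by auto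
    have "r \<odot>\<^bsub>E\<^esub> s t \<oplus>\<^bsub>E\<^esub> x \<in> mspan R E ?G" using step x by (intro mspan.step) auto
    moreover have "p (r \<odot>\<^bsub>E\<^esub> s t \<oplus>\<^bsub>E\<^esub> x) = r \<odot>\<^bsub>N\<^esub> t \<oplus>\<^bsub>N\<^esub> n"
      using t x E.mspan_closed[OF G x(1)] step(1) by (simp add: p_add p_smult)
    ultimately show ?case by (intro bexI)
  qed
  show ?thesis
  proof (rule finitely_generatedI[OF E])
    show "finite ?G" using S T by blast
    show "?G \<subseteq> carrier E" by (rule G)
    show "x \<in> mspan R E ?G" if x: "x \<in> carrier E" for x
    proof -
      from lift[OF subsetD[OF T(3) p_closed[OF x]]] obtain y where y: "y \<in> mspan R E ?G" "p y = p x" by (elim bexE)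
      obtain l where l: "l \<in> carrier L" "x = y \<oplus>\<^bsub>E\<^esub> i l"
        by (rule same_fibreE[of x y]) (use x y E.mspan_closed[OF G] in auto)
      have "i l \<in> mspan R E ?G"
        by (rule E.mspan_mono[OF _ mspan_image[OF i_hom L E S(2) subsetD[OF S(3) l(1)]]]) blast
      then show ?thesis using E.mspan_add[OF G y(1)] l(2) by simp
    qed
  qed
qed

section \<open>Rings with discrete valuation branches\<close>

text \<open>\<open>a\<close> is a unit times a power of t. The surplus exponent \<open>c\<close> is
  handed on to the cofactor so that cofactors on different branches can be glued by the
  conductor.\<close>

lemma fps_power_dvd_factor:
  fixes a g :: "'k :: field fps"
  assumes "a \<noteq> 0" "fps_X ^ (subdegree a + c) dvd g"
  obtains h where "g = a * h" "fps_X ^ c dvd h"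
proof -
  obtain g' where g': "g = fps_X ^ (subdegree a + c) * g'" using assms(2) by (elim dvdE)
  obtain u where u: "a = u * fps_X ^ subdegree a" "is_unit u"
  proof
    show "a = unit_factor a * fps_X ^ subdegree a" by (simp add: subdegree_decompose)
    show "is_unit (unit_factor a)" using assms(1) by simp
  qed
  obtain v where v: "u * v = 1" using u(2) by (metis dvdE)
  have "a * (fps_X ^ c * (v * g')) = (u * v) * (fps_X ^ subdegree a * fps_X ^ c * g')"
    by (subst u(1)) (simp only: mult_ac)
  also have "\<dots> = g" using g' v by (simp add: power_add)
  finally have "g = a * (fps_X ^ c * (v * g'))" ..
  then show ?thesis using that dvd_triv_left by blast
qed

lemma fps_X_dvd_iff: "fps_X dvd h \<longleftrightarrow> fps_nth (h :: 'k :: field fps) 0 = 0"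
proof
  assume "fps_X dvd h"
  then show "fps_nth h 0 = 0" by (elim dvdE) simp
next
  assume "fps_nth h 0 = 0"
  then have "h = fps_X * fps_shift 1 h"
    by (intro fps_ext) (metis Suc_pred' One_nat_def add.commute fps_X_mult_nth fps_shift_nth neq0_conv plus_1_eq_Suc)
  then show "fps_X dvd h" by (rule dvdI)
qed

text \<open>A subring of the product over \<open>I\<close> of copies of k[[t]], with projections
  \<open>b i\<close>, which are jointly injective by \<open>b_eqI\<close>. By \<open>b_const\<close>
  the branches share their constant term, which makes the ring local; \<open>conductor\<close> says
  that it contains all tuples of series divisible by t^c. Locality and the Noetherian property are
  derived from this.\<close>

locale branched_ring = cring A for A :: "('a, 'x) ring_scheme" (structure) +
  fixes I :: "nat set" and b :: "nat \<Rightarrow> 'a \<Rightarrow> 'k :: field fps" and c :: nat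
  assumes finite_branches: "finite I" and branches_nonempty: "I \<noteq> {}"
    and b_add: "\<lbrakk>i \<in> I; x \<in> carrier A; y \<in> carrier A\<rbrakk> \<Longrightarrow> b i (x \<oplus> y) = b i x + b i y"
    and b_mult: "\<lbrakk>i \<in> I; x \<in> carrier A; y \<in> carrier A\<rbrakk> \<Longrightarrow> b i (x \<otimes> y) = b i x * b i y"
    and b_one: "i \<in> I \<Longrightarrow> b i \<one> = 1"
    and b_eqI: "\<lbrakk>x \<in> carrier A; y \<in> carrier A; \<And>i. i \<in> I \<Longrightarrow> b i x = b i y\<rbrakk> \<Longrightarrow> x = y"
    and b_surj: "i \<in> I \<Longrightarrow> \<exists>x\<in>carrier A. b i x = h"
    and b_const: "\<lbrakk>i \<in> I; j \<in> I; x \<in> carrier A\<rbrakk> \<Longrightarrow> fps_nth (b i x) 0 = fps_nth (b j x) 0"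
    and conductor: "(\<And>i. i \<in> I \<Longrightarrow> fps_X ^ c dvd g i) \<Longrightarrow> \<exists>x\<in>carrier A. \<forall>i\<in>I. b i x = g i"
begin

section \<open>Order filtration, locality and Krull dimension\<close>

lemma b_zero: "i \<in> I \<Longrightarrow> b i \<zero> = 0"
  using b_add[of i \<zero> \<zero>] by (metis add_cancel_left_right l_zero zero_closed)

lemma b_a_inv: "\<lbrakk>i \<in> I; x \<in> carrier A\<rbrakk> \<Longrightarrow> b i (\<ominus> x) = - b i x"
  using b_add[of i "\<ominus> x" x] b_zero by (simp add: l_neg eq_neg_iff_add_eq_0)

lemma b_minus: "\<lbrakk>i \<in> I; x \<in> carrier A; y \<in> carrier A\<rbrakk> \<Longrightarrow> b i (x \<ominus> y) = b i x - b i y"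
  by (simp add: minus_eq b_add b_a_inv)

lemma b_pow: "\<lbrakk>i \<in> I; x \<in> carrier A\<rbrakk> \<Longrightarrow> b i (x [^] (n :: nat)) = b i x ^ n"
  by (induction n) (simp_all add: b_one b_mult mult.commute)

lemmas b_simps = b_zero b_one b_add b_mult b_a_inv b_minus b_pow

definition order_ge :: "nat \<Rightarrow> 'a set" where
  "order_ge n = {x \<in> carrier A. \<forall>i\<in>I. fps_X ^ n dvd b i x}"

abbreviation mx :: "'a set" where "mx \<equiv> order_ge (Suc 0)"

definition br_ker :: "nat \<Rightarrow> 'a set" where
  "br_ker i = {x \<in> carrier A. b i x = 0}"

text \<open>One branch decides membership, since constant terms agree on all branches.\<close>

lemma mx_iff: "i \<in> I \<Longrightarrow> x \<in> mx \<longleftrightarrow> x \<in> carrier A \<and> fps_nth (b i x) 0 = 0"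
  unfolding order_ge_def using b_const[of i _ x] by (auto simp: fps_X_dvd_iff)

lemma order_ge_pow: "x \<in> mx \<Longrightarrow> x [^] n \<in> order_ge n"
  unfolding order_ge_def by (auto simp: b_pow intro: dvd_power_same)

lemma order_ge_mult: "\<lbrakk>x \<in> order_ge m; y \<in> order_ge n\<rbrakk> \<Longrightarrow> x \<otimes> y \<in> order_ge (m + n)"
  unfolding order_ge_def by (auto simp: b_mult power_add intro: mult_dvd_mono)

lemma order_ge_closed: "x \<in> order_ge n \<Longrightarrow> x \<in> carrier A"
  by (simp add: order_ge_def)

text \<open>Dividing by t^n on each branch leaves order at least \<open>c\<close>, and the conductor
  assembles the quotients to a ring element.\<close>

lemma order_ge_factor:
  assumes s: "s \<in> carrier A" "\<And>i. i \<in> I \<Longrightarrow> b i s = fps_X ^ n" and w: "w \<in> order_ge (n + c)"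
  shows "\<exists>r\<in>carrier A. w = s \<otimes> r"
proof -
  have "\<exists>h. b i w = fps_X ^ n * h \<and> fps_X ^ c dvd h" if i: "i \<in> I" for i
  proof -
    have "fps_X ^ (n + c) dvd b i w" using w i by (simp add: order_ge_def)
    then obtain k where "b i w = fps_X ^ (n + c) * k" by (elim dvdE)
    then show ?thesis by (intro exI[of _ "fps_X ^ c * k"]) (simp add: power_add mult_ac)
  qed
  then obtain h where h: "\<And>i. i \<in> I \<Longrightarrow> b i w = fps_X ^ n * h i \<and> fps_X ^ c dvd h i" by metis
  obtain r where r: "r \<in> carrier A" "\<And>i. i \<in> I \<Longrightarrow> b i r = h i"
    using conductor[of h] h by metis
  have "w = s \<otimes> r"
    by (rule b_eqI) (use w s r h in \<open>simp_all add: order_ge_def b_mult\<close>)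
  then show ?thesis using r by blast
qed

text \<open>The inverse on each branch is known, but it has to come from the ring. A truncated
  geometric series agrees with it up to order \<open>c\<close>, and the conductor supplies the
  rest.\<close>

lemma unit_outside_mx:
  assumes x: "x \<in> carrier A" "x \<notin> mx"
  shows "\<exists>y\<in>carrier A. x \<otimes> y = \<one>"
proof -
  obtain j where j: "j \<in> I" using branches_nonempty by blast
  define u where "u = fps_nth (b j x) 0"
  have u: "u \<noteq> 0" "\<And>i. i \<in> I \<Longrightarrow> fps_nth (b i x) 0 = u"
    using mx_iff[OF j] x b_const[OF _ j] by (auto simp: u_def)
  \<comment> \<open>\<open>d\<close> is prescribed on one branch only, yet its constant term is the
    inverse of \<open>u\<close> on all of them, so \<open>w\<close> has constant term 1
    everywhere.\<close>
  obtain d where d: "d \<in> carrier A" "b j d = fps_const (inverse u)" using b_surj[OF j] by blast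
  define w where "w = x \<otimes> d"
  have w: "w \<in> carrier A" using x d by (simp add: w_def)
  have w0: "fps_nth (b i w) 0 = 1" if "i \<in> I" for i
    using b_const[OF that j w] x d u j by (simp add: w_def b_mult)
  \<comment> \<open>\<open>s\<close> is the sum of the powers of 1 - w with exponent below
    \<open>n\<close>, a polynomial in \<open>w\<close> and thus an element of the ring.\<close>
  have "\<exists>s\<in>carrier A. \<forall>i\<in>I. b i w * b i s = 1 - (1 - b i w) ^ n" for n
  proof (induction n)
    case 0
    show ?case by (rule bexI[of _ \<zero>]) (simp_all add: b_zero)
  next
    case (Suc n)
    then obtain s where s: "s \<in> carrier A" "\<forall>i\<in>I. b i w * b i s = 1 - (1 - b i w) ^ n" by blast
    have "b i w * b i (s \<oplus> (\<one> \<ominus> w) [^] n) = 1 - (1 - b i w) ^ Suc n" if i: "i \<in> I" for i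
    proof -
      have "b i (s \<oplus> (\<one> \<ominus> w) [^] n) = b i s + (1 - b i w) ^ n"
        using i s(1) w by (simp add: b_simps)
      then have "b i w * b i (s \<oplus> (\<one> \<ominus> w) [^] n) = (1 - (1 - b i w) ^ n) + b i w * (1 - b i w) ^ n"
        using s(2) i by (simp add: distrib_left)
      also have "\<dots> = 1 - (1 - b i w) ^ Suc n" by (simp add: left_diff_distrib)
      finally show ?thesis .
    qed
    moreover have "s \<oplus> (\<one> \<ominus> w) [^] n \<in> carrier A" using s(1) w by simp
    ultimately show ?case by blast
  qed
  then obtain s where s: "s \<in> carrier A" "\<forall>i\<in>I. b i w * b i s = 1 - (1 - b i w) ^ c" by blast
  \<comment> \<open>The tail of the geometric series has order at least \<open>c\<close> on every
    branch.\<close>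
  have "fps_X ^ c dvd inverse (b i w) * (1 - b i w) ^ c" if "i \<in> I" for i
    using w0[OF that] by (intro dvd_mult dvd_power_same) (simp add: fps_X_dvd_iff)
  from conductor[of "\<lambda>i. inverse (b i w) * (1 - b i w) ^ c", OF this]
  obtain e where e: "e \<in> carrier A" "\<forall>i\<in>I. b i e = inverse (b i w) * (1 - b i w) ^ c" by blast
  have "x \<otimes> (d \<otimes> (s \<oplus> e)) = \<one>"
  proof (rule b_eqI)
    fix i assume i: "i \<in> I"
    have inv: "b i w * inverse (b i w) = 1"
      using w0[OF i] by (intro inverse_mult_eq_1') simp
    have "b i (x \<otimes> (d \<otimes> (s \<oplus> e))) = b i w * b i s + (b i w * inverse (b i w)) * (1 - b i w) ^ c"
      using x d s(1) e i by (simp add: w_def b_simps algebra_simps)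
    also have "\<dots> = 1" using s(2) i by (simp add: inv)
    finally show "b i (x \<otimes> (d \<otimes> (s \<oplus> e))) = b i \<one>" using i by (simp add: b_one)
  qed (use x d s e in auto)
  then show ?thesis using d s e by blast
qed

lemma ideal_mx: "ideal mx A"
proof (rule idealI)
  obtain j where j: "j \<in> I" using branches_nonempty by blast
  have "\<zero> \<in> mx" using j by (simp add: mx_iff[OF j] b_zero)
  then have "mx \<noteq> {}" by blast
  then show "subgroup mx (add_monoid A)"
    by (rule add.subgroupI[rotated]) (auto simp: mx_iff[OF j] j b_simps a_inv_def[symmetric])
  show "y \<otimes> x \<in> mx" "x \<otimes> y \<in> mx" if "x \<in> mx" "y \<in> carrier A" for x y
    using that j by (auto simp: mx_iff[OF j] b_mult)
qed (rule ring_axioms)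

lemma one_notin_mx: "\<one> \<notin> mx"
proof -
  obtain j where "j \<in> I" using branches_nonempty by blast
  then show ?thesis using mx_iff[of j \<one>] b_one[of j] by simp
qed

text \<open>An ideal that leaves \<open>mx\<close> contains a unit.\<close>

lemma proper_ideal_subset_mx:
  assumes "ideal J A" "J \<noteq> carrier A"
  shows "J \<subseteq> mx"
proof (rule ccontr)
  assume "\<not> J \<subseteq> mx"
  then obtain x where x: "x \<in> J" "x \<notin> mx" by blast
  have xA: "x \<in> carrier A" by (rule additive_subgroup.a_Hcarr[OF ideal.axioms(1)[OF assms(1)] x(1)])
  obtain y where y: "y \<in> carrier A" "x \<otimes> y = \<one>" using unit_outside_mx[OF xA x(2)] by blast
  have "\<one> \<in> J" using ideal.I_r_closed[OF assms(1) x(1) y(1)] y(2) by simp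
  then show False using ideal.one_imp_carrier[OF assms(1)] assms(2) by blast
qed

lemma maximalideal_mx: "maximalideal mx A"
proof (rule maximalidealI[OF ideal_mx])
  show "carrier A \<noteq> mx" using one_notin_mx one_closed by blast
  show "J = mx \<or> J = carrier A" if "ideal J A" "mx \<subseteq> J" "J \<subseteq> carrier A" for J
    using proper_ideal_subset_mx[OF that(1)] that(2) by blast
qed

lemma the_maximalideal: "(THE J. maximalideal J A) = mx"
proof (rule the_equality)
  show "maximalideal mx A" by (rule maximalideal_mx)
  fix J assume J: "maximalideal J A"
  have id: "ideal J A" by (rule maximalideal.axioms(1)[OF J])
  have "J \<noteq> carrier A" using maximalideal.I_notcarr[OF J] by blast
  then have "J \<subseteq> mx" by (rule proper_ideal_subset_mx[OF id])
  moreover have "mx \<subseteq> carrier A" using order_ge_closed by blast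
  ultimately have "mx = J \<or> mx = carrier A"
    using maximalideal.I_maximal[OF J ideal_mx] by blast
  then show "J = mx" using one_notin_mx one_closed by blast
qed

lemma primeideal_br_ker:
  assumes i: "i \<in> I" shows "primeideal (br_ker i) A"
proof (rule primeidealI)
  show "ideal (br_ker i) A"
  proof (rule idealI)
    show "subgroup (br_ker i) (add_monoid A)"
      by (rule add.subgroupI) (auto simp: br_ker_def i b_simps a_inv_def[symmetric] intro: exI[of _ \<zero>])
    show "y \<otimes> x \<in> br_ker i" "x \<otimes> y \<in> br_ker i" if "x \<in> br_ker i" "y \<in> carrier A" for x y
      using that i by (auto simp: br_ker_def b_mult)
  qed (rule ring_axioms)
  show "carrier A \<noteq> br_ker i"
    using one_closed b_one[OF i] unfolding br_ker_def by (metis (mono_tags, lifting) mem_Collect_eq zero_neq_one)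
  show "x \<in> br_ker i \<or> y \<in> br_ker i" if "x \<in> carrier A" "y \<in> carrier A" "x \<otimes> y \<in> br_ker i" for x y
    using that i by (auto simp: br_ker_def b_mult)
qed (rule is_cring)

lemma pow_in_primeideal:
  assumes "primeideal P A" "x \<in> carrier A" "x [^] (n :: nat) \<in> P"
  shows "x \<in> P"
  using assms(3)
proof (induction n)
  case 0
  then have "\<one> \<in> P" by simp
  then have "P = carrier A"
    using ideal.one_imp_carrier[OF primeideal.axioms(1)[OF assms(1)]] by blast
  then show ?case using primeideal.I_notcarr[OF assms(1)] by blast
next
  case (Suc n)
  then have "x [^] n \<otimes> x \<in> P" by simp
  then have "x [^] n \<in> P \<or> x \<in> P"
    using primeideal.I_prime[OF assms(1), of "x [^] n" x] assms(2) by simp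
  then show ?case using Suc.IH by blast
qed

text \<open>The kernels of the branches intersect in zero, so a prime contains one of them. The
  quotient by that kernel is k[[t]], whose only primes are zero and the maximal ideal; the proof
  carries this out by elements.\<close>

lemma primeideal_cases:
  assumes P: "primeideal P A"
  shows "P = mx \<or> (\<exists>i\<in>I. P = br_ker i)"
proof -
  have idP: "ideal P A" by (rule primeideal.axioms(1)[OF P])
  have Pc: "x \<in> carrier A" if "x \<in> P" for x
    by (rule additive_subgroup.a_Hcarr[OF ideal.axioms(1)[OF idP] that])
  have Pne: "P \<noteq> carrier A" using primeideal.I_notcarr[OF P] by blast
  have "\<exists>i\<in>I. br_ker i \<subseteq> P"
  proof (rule ccontr)
    assume *: "\<not> (\<exists>i\<in>I. br_ker i \<subseteq> P)"
    \<comment> \<open>A product of elements outside \<open>P\<close>, one from each kernel, stays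
      outside the prime \<open>P\<close>; taken over all branches it is zero.\<close>
    have "\<exists>x\<in>carrier A - P. \<forall>j\<in>J. b j x = 0" if "J \<subseteq> I" for J
      using finite_subset[OF that finite_branches] that
    proof (induction J)
      case empty
      show ?case using Pne Pc by blast
    next
      case (insert j J)
      then obtain x where x: "x \<in> carrier A" "x \<notin> P" "\<forall>j\<in>J. b j x = 0" by blast
      obtain y where y: "y \<in> carrier A" "b j y = 0" "y \<notin> P"
        using * insert.prems unfolding br_ker_def by blast
      have "x \<otimes> y \<notin> P" using primeideal.I_prime[OF P x(1) y(1)] x(2) y(3) by blast
      moreover have "\<forall>k\<in>insert j J. b k (x \<otimes> y) = 0"
        using x y insert.prems by (auto simp: b_mult)
      ultimately show ?case using x(1) y(1) by blast
    qed
    from this[OF order_refl] obtain x where x: "x \<in> carrier A" "x \<notin> P" "\<forall>j\<in>I. b j x = 0" by blast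
    have "x = \<zero>" by (rule b_eqI) (use x in \<open>simp_all add: b_zero\<close>)
    then show False using x additive_subgroup.zero_closed[OF ideal.axioms(1)[OF idP]] by simp
  qed
  then obtain i where i: "i \<in> I" "br_ker i \<subseteq> P" by blast
  show ?thesis
  proof (cases "P = br_ker i")
    case True
    then show ?thesis using i by blast
  next
    case False
    \<comment> \<open>On branch \<open>i\<close> the element \<open>a\<close> has some finite order
      d, so it divides the d-th power of any \<open>y\<close> in \<open>mx\<close> there. The error
      lies in \<open>br_ker i\<close>, hence in \<open>P\<close>.\<close>
    then obtain a where a: "a \<in> P" "b i a \<noteq> 0" using i Pc unfolding br_ker_def by blast
    have "mx \<subseteq> P"
    proof
      fix y assume y: "y \<in> mx"
      let ?d = "subdegree (b i a)"
      have yA: "y \<in> carrier A" using y by (rule order_ge_closed)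
      \<comment> \<open>The surplus exponent is 0: the cofactor is needed on the single branch
        \<open>i\<close>, where \<open>b_surj\<close> realises it.\<close>
      have "fps_X ^ (?d + 0) dvd b i (y [^] ?d)"
        using order_ge_pow[OF y, of ?d] i(1) by (simp add: order_ge_def)
      then obtain h where h: "b i (y [^] ?d) = b i a * h"
        by (rule fps_power_dvd_factor[OF a(2)])
      obtain r where r: "r \<in> carrier A" "b i r = h" using b_surj[OF i(1)] by blast
      have "y [^] ?d \<ominus> a \<otimes> r \<in> br_ker i"
        using yA r h Pc[OF a(1)] i(1) by (simp add: br_ker_def b_minus b_mult)
      then have "y [^] ?d \<ominus> a \<otimes> r \<in> P" using i(2) by blast
      moreover have "a \<otimes> r \<in> P" by (rule ideal.I_r_closed[OF idP a(1) r(1)])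
      ultimately have "a \<otimes> r \<oplus> (y [^] ?d \<ominus> a \<otimes> r) \<in> P"
        using additive_subgroup.a_closed[OF ideal.axioms(1)[OF idP]] by blast
      then have "y [^] ?d \<in> P"
        using add_minus_cancel[of "y [^] ?d" "a \<otimes> r"] yA r Pc[OF a(1)] by simp
      then show "y \<in> P" by (rule pow_in_primeideal[OF P yA])
    qed
    then show ?thesis using proper_ideal_subset_mx[OF idP Pne] by blast
  qed
qed

lemma br_ker_psubset_mx:
  assumes i: "i \<in> I" shows "br_ker i \<subset> mx"
proof -
  obtain x where x: "x \<in> carrier A" "b i x = fps_X" using b_surj[OF i] by blast
  have "x \<in> mx" "x \<notin> br_ker i" using x by (simp_all add: mx_iff[OF i] br_ker_def)
  moreover have "br_ker i \<subseteq> mx" by (rule subsetI) (simp add: mx_iff[OF i] br_ker_def)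
  ultimately show ?thesis by blast
qed

text \<open>The conductor contains an element that is zero on branch \<open>i\<close> and t^c on all
  others.\<close>

lemma br_ker_incomparable:
  assumes i: "i \<in> I" and j: "j \<in> I" and sub: "br_ker i \<subseteq> br_ker j"
  shows "i = j"
proof (rule ccontr)
  assume "i \<noteq> j"
  have "fps_X ^ c dvd (if k = i then 0 else fps_X ^ c :: 'k fps)" for k by simp
  then obtain x where x: "x \<in> carrier A" "\<forall>k\<in>I. b k x = (if k = i then 0 else fps_X ^ c)"
    using conductor[of "\<lambda>k. if k = i then 0 else fps_X ^ c"] by blast
  then have "x \<in> br_ker i" "x \<notin> br_ker j" using i j \<open>i \<noteq> j\<close> by (auto simp: br_ker_def)
  then show False using sub by blast
qed

text \<open>In a chain of primes every member but the last differs from \<open>mx\<close>, hence is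
  the kernel of a branch; two such kernels are never properly nested.\<close>

lemma krull_dim: "krull_dim A = 1"
proof -
  let ?S = "{enat n | n. \<exists>p :: nat \<Rightarrow> 'a set. (\<forall>i\<le>n. primeideal (p i) A) \<and> (\<forall>i<n. p i \<subset> p (Suc i))}"
  obtain i where i: "i \<in> I" using branches_nonempty by blast
  have "enat 1 \<in> ?S"
  proof (intro CollectI exI conjI)
    show "\<forall>k\<le>1. primeideal ((\<lambda>n. if n = 0 then br_ker i else mx) k) A"
      using primeideal_br_ker[OF i] maximalideal_prime[OF maximalideal_mx] by simp
    show "\<forall>k<1. (\<lambda>n. if n = 0 then br_ker i else mx) k \<subset> (\<lambda>n. if n = 0 then br_ker i else mx) (Suc k)"
      using br_ker_psubset_mx[OF i] by simp
  qed simp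
  then have "enat 1 \<le> Sup ?S" by (rule Sup_upper)
  moreover have "Sup ?S \<le> enat 1"
  proof (rule Sup_least)
    fix m assume "m \<in> ?S"
    then obtain n p where m: "m = enat n" and p: "\<forall>i\<le>n. primeideal (p i) A" "\<forall>i<n. p i \<subset> p (Suc i)" by blast
    have "n \<le> 1"
    proof (rule ccontr)
      assume "\<not> n \<le> 1"
      then have n: "0 < n" "Suc 0 < n" "Suc (Suc 0) \<le> n" by auto
      have "p k \<noteq> mx" if "k < n" for k
      proof -
        have "primeideal (p (Suc k)) A" using p(1) that by simp
        then have "p (Suc k) \<subseteq> mx"
          using proper_ideal_subset_mx primeideal.I_notcarr primeideal.axioms(1) by metis
        then show ?thesis using p(2) that by blast
      qed
      then obtain i j where ij: "i \<in> I" "p 0 = br_ker i" "j \<in> I" "p (Suc 0) = br_ker j"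
        using primeideal_cases p(1) n by (metis le0 order.strict_implies_order)
      have "br_ker i \<subset> br_ker j" using p(2) n(1) ij by metis
      then show False using br_ker_incomparable[OF ij(1,3)] by blast
    qed
    then show "m \<le> enat 1" by (simp add: m)
  qed
  ultimately have "Sup ?S = enat 1" by (rule order_antisym[rotated])
  then show ?thesis unfolding krull_dim_def by (simp add: one_enat_def)
qed

end

section \<open>Regular sequences, depth and socle\<close>

lemma regular_sequence_single:
  assumes "module R M"
  shows "regular_sequence M [a] \<longleftrightarrow>
    (\<forall>x\<in>carrier M. a \<odot>\<^bsub>M\<^esub> x = \<zero>\<^bsub>M\<^esub> \<longrightarrow> x = \<zero>\<^bsub>M\<^esub>) \<and> {a \<odot>\<^bsub>M\<^esub> x \<oplus>\<^bsub>M\<^esub> \<zero>\<^bsub>M\<^esub> | x. x \<in> carrier M} \<noteq> carrier M"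
  by (simp add: regular_sequence_def)


context branched_ring
begin

text \<open>The condition Hom(k, M) = 0 for the residue field k, which for a nonzero finitely
  generated module amounts to positive depth.\<close>

definition socle_free :: "('a, 'm) module \<Rightarrow> bool" where
  "socle_free M \<longleftrightarrow> (\<forall>x\<in>carrier M. (\<forall>a\<in>mx. a \<odot>\<^bsub>M\<^esub> x = \<zero>\<^bsub>M\<^esub>) \<longrightarrow> x = \<zero>\<^bsub>M\<^esub>)"

text \<open>If order \<open>Suc n\<close> annihilates \<open>x\<close>, then order \<open>n\<close>
  annihilates \<open>a x\<close> for every \<open>a\<close> in \<open>mx\<close>. By induction all
  these products vanish, and then \<open>x\<close> does.\<close>

lemma socle_free_order_ge:
  assumes M: "module A M" and sf: "socle_free M" and x: "x \<in> carrier M"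
    and ann: "\<And>w. w \<in> order_ge n \<Longrightarrow> w \<odot>\<^bsub>M\<^esub> x = \<zero>\<^bsub>M\<^esub>"
  shows "x = \<zero>\<^bsub>M\<^esub>"
  using x ann
proof (induction n arbitrary: x)
  interpret M: module A M by (rule M)
  case 0
  have "\<one> \<in> order_ge 0" by (simp add: order_ge_def)
  then show ?case using 0 by fastforce
next
  interpret M: module A M by (rule M)
  case (Suc n)
  have "a \<odot>\<^bsub>M\<^esub> x = \<zero>\<^bsub>M\<^esub>" if a: "a \<in> mx" for a
  proof (rule Suc.IH)
    note aA = order_ge_closed[OF a]
    show "a \<odot>\<^bsub>M\<^esub> x \<in> carrier M" using aA Suc.prems(1) by simp
    show "w \<odot>\<^bsub>M\<^esub> (a \<odot>\<^bsub>M\<^esub> x) = \<zero>\<^bsub>M\<^esub>" if w: "w \<in> order_ge n" for w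
    proof -
      have "w \<otimes> a \<in> order_ge (Suc n)" using order_ge_mult[OF w a] by simp
      then have "(w \<otimes> a) \<odot>\<^bsub>M\<^esub> x = \<zero>\<^bsub>M\<^esub>" by (rule Suc.prems(2))
      then show ?thesis using M.smult_assoc1[OF order_ge_closed[OF w] aA Suc.prems(1)] by simp
    qed
  qed
  then show ?case using sf Suc.prems(1) unfolding socle_free_def by blast
qed

lemma obtain_conductor_power:
  obtains s where "s \<in> carrier A" "\<forall>i\<in>I. b i s = fps_X ^ (c + n)"
proof -
  have "\<exists>x\<in>carrier A. \<forall>i\<in>I. b i x = fps_X ^ (c + n)"
    by (rule conductor) (simp add: power_add)
  then show ?thesis using that by blast
qed

text \<open>All elements of order at least \<open>n + c\<close> are multiples of \<open>s\<close>,
  so whatever \<open>s\<close> kills is killed by them.\<close>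

lemma socle_free_nonzerodivisor:
  assumes M: "module A M" and sf: "socle_free M"
    and s: "s \<in> carrier A" "\<And>i. i \<in> I \<Longrightarrow> b i s = fps_X ^ n"
    and x: "x \<in> carrier M" "s \<odot>\<^bsub>M\<^esub> x = \<zero>\<^bsub>M\<^esub>"
  shows "x = \<zero>\<^bsub>M\<^esub>"
proof (rule socle_free_order_ge[OF M sf x(1)])
  interpret M: module A M by (rule M)
  fix w assume "w \<in> order_ge (n + c)"
  then obtain r where r: "r \<in> carrier A" "w = s \<otimes> r" using order_ge_factor[OF s] by blast
  then have "w = r \<otimes> s" using s m_comm by simp
  then have "w \<odot>\<^bsub>M\<^esub> x = r \<odot>\<^bsub>M\<^esub> (s \<odot>\<^bsub>M\<^esub> x)"
    using M.smult_assoc1[OF r(1) s(1) x(1)] by simp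
  then show "w \<odot>\<^bsub>M\<^esub> x = \<zero>\<^bsub>M\<^esub>" using x(2) r(1) by simp
qed

text \<open>Generators are discarded one at a time: writing \<open>s = a y\<close> and
  \<open>y = r s + z\<close> gives \<open>(1 - a r) s = a z\<close>, and \<open>1 - a r\<close> is a
  unit, so \<open>s\<close> lies in the span of the others.\<close>

lemma nakayama:
  assumes M: "module A M" and fg: "finitely_generated A M" and a: "a \<in> mx"
    and surj: "\<And>x. x \<in> carrier M \<Longrightarrow> \<exists>y\<in>carrier M. x = a \<odot>\<^bsub>M\<^esub> y"
  shows "carrier M = {\<zero>\<^bsub>M\<^esub>}"
proof -
  interpret M: module A M by (rule M)
  obtain S where S: "finite S" "S \<subseteq> carrier M" "carrier M \<subseteq> mspan A M S"
    by (rule finitely_generatedE[OF M fg])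
  note aA = order_ge_closed[OF a]
  show ?thesis using S
  proof (induction S)
    case empty
    then show ?case using M.mspan_empty M.M.zero_closed by blast
  next
    case (insert s S)
    have s: "s \<in> carrier M" and SM: "S \<subseteq> carrier M" using insert.prems by auto
    obtain y where y: "y \<in> carrier M" "s = a \<odot>\<^bsub>M\<^esub> y" using surj[OF s] by blast
    have "y \<in> mspan A M (insert s S)" using y insert.prems by blast
    then obtain r z where r: "r \<in> carrier A" "z \<in> mspan A M S" "y = r \<odot>\<^bsub>M\<^esub> s \<oplus>\<^bsub>M\<^esub> z"
      by (rule M.mspan_insertE[OF insert.prems(1)])
    note zM = M.mspan_closed[OF SM r(2)]
    have "s = (a \<otimes> r) \<odot>\<^bsub>M\<^esub> s \<oplus>\<^bsub>M\<^esub> a \<odot>\<^bsub>M\<^esub> z"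
      using y(2) unfolding r(3) using aA r(1) s zM by (simp add: M.smult_r_distr M.smult_assoc1)
    moreover have "s = (a \<otimes> r) \<odot>\<^bsub>M\<^esub> s \<oplus>\<^bsub>M\<^esub> (\<one> \<ominus> a \<otimes> r) \<odot>\<^bsub>M\<^esub> s"
      using M.smult_l_distr[of "a \<otimes> r" "\<one> \<ominus> a \<otimes> r" s] add_minus_cancel[of \<one> "a \<otimes> r"] aA r(1) s by simp
    ultimately have "(a \<otimes> r) \<odot>\<^bsub>M\<^esub> s \<oplus>\<^bsub>M\<^esub> (\<one> \<ominus> a \<otimes> r) \<odot>\<^bsub>M\<^esub> s = (a \<otimes> r) \<odot>\<^bsub>M\<^esub> s \<oplus>\<^bsub>M\<^esub> a \<odot>\<^bsub>M\<^esub> z"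
      by metis
    then have eq: "(\<one> \<ominus> a \<otimes> r) \<odot>\<^bsub>M\<^esub> s = a \<odot>\<^bsub>M\<^esub> z"
      using aA r(1) s zM by simp
    have "\<one> \<ominus> a \<otimes> r \<notin> mx"
    proof
      obtain j where j: "j \<in> I" using branches_nonempty by blast
      assume "\<one> \<ominus> a \<otimes> r \<in> mx"
      then show False using a aA r(1) j by (simp add: mx_iff[OF j] b_simps)
    qed
    from unit_outside_mx[OF _ this]
    obtain v where v: "v \<in> carrier A" "(\<one> \<ominus> a \<otimes> r) \<otimes> v = \<one>"
      using aA r(1) by auto
    have "s = (v \<otimes> (\<one> \<ominus> a \<otimes> r)) \<odot>\<^bsub>M\<^esub> s" using v aA r(1) s by (simp add: m_comm)
    also have "\<dots> = v \<odot>\<^bsub>M\<^esub> (a \<odot>\<^bsub>M\<^esub> z)" using eq v aA r(1) s by (simp add: M.smult_assoc1)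
    finally have "s = v \<odot>\<^bsub>M\<^esub> (a \<odot>\<^bsub>M\<^esub> z)" .
    then have sS: "s \<in> mspan A M S"
      using M.mspan_smult[OF SM v(1) M.mspan_smult[OF SM aA r(2)]] by simp
    have "insert s S \<subseteq> mspan A M S" using sS M.mspan_incl[OF SM] by blast
    then have "carrier M \<subseteq> mspan A M S"
      using M.mspan_least[OF M.mspan_submodule[OF SM]] insert.prems(2) by blast
    then show ?case by (rule insert.IH[OF SM])
  qed
qed

text \<open>For regular \<open>a1\<close>, \<open>a2\<close>, some power of \<open>a2\<close> sends
  \<open>M\<close> into \<open>a1 M\<close>, because up to an element killed by \<open>a1\<close>
  that power is a multiple of \<open>a1\<close>. Cancelling the factors \<open>a2\<close> gives
  \<open>M = a1 M\<close>, against the properness demanded of a regular sequence.\<close>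

lemma regular_sequence_length:
  assumes M: "module A M" and as: "set as \<subseteq> mx" and reg: "regular_sequence M as"
  shows "length as \<le> 1"
proof (rule ccontr)
  interpret M: module A M by (rule M)
  assume "\<not> length as \<le> 1"
  then obtain a1 a2 bs where as_eq: "as = a1 # a2 # bs"
    by (cases as; cases "tl as") auto
  have a1: "a1 \<in> mx" and a2: "a2 \<in> mx" using as by (auto simp: as_eq)
  note a1A = order_ge_closed[OF a1] and a2A = order_ge_closed[OF a2]
  have r1: "x = \<zero>\<^bsub>M\<^esub>" if "x \<in> carrier M" "a1 \<odot>\<^bsub>M\<^esub> x = \<zero>\<^bsub>M\<^esub>" for x
    using reg that unfolding regular_sequence_def as_eq by fastforce
  let ?P = "seq_mult M [a1]"
  have P: "z \<in> ?P \<longleftrightarrow> (\<exists>x\<in>carrier M. z = a1 \<odot>\<^bsub>M\<^esub> x)" for z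
  proof -
    have "a1 \<odot>\<^bsub>M\<^esub> x \<oplus>\<^bsub>M\<^esub> \<zero>\<^bsub>M\<^esub> = a1 \<odot>\<^bsub>M\<^esub> x" if "x \<in> carrier M" for x
      using that a1A by simp
    then show ?thesis unfolding seq_mult.simps mem_Collect_eq by (metis singletonI singletonD)
  qed
  have r2: "x \<in> ?P" if "x \<in> carrier M" "a2 \<odot>\<^bsub>M\<^esub> x \<in> ?P" for x
  proof -
    have "\<forall>i<length as. \<forall>x\<in>carrier M. as ! i \<odot>\<^bsub>M\<^esub> x \<in> seq_mult M (take i as) \<longrightarrow> x \<in> seq_mult M (take i as)"
      using reg unfolding regular_sequence_def by blast
    from this[rule_format, of "Suc 0" x] show ?thesis using that by (simp add: as_eq)
  qed
  have ne: "seq_mult M as \<noteq> carrier M" using reg unfolding regular_sequence_def by blast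
  \<comment> \<open>Large enough for all branches at once: where \<open>a1\<close> has order d, the
    exponent is at least d + c. Where \<open>a1\<close> vanishes, the cofactor is unconstrained
    apart from divisibility by t^c and 0 serves.\<close>
  define n where "n = (\<Sum>i\<in>I. subdegree (b i a1)) + c"
  have ex: "\<exists>h. fps_X ^ c dvd h \<and> (b i a1 \<noteq> 0 \<longrightarrow> b i a2 ^ n = b i a1 * h)" if i: "i \<in> I" for i
  proof (cases "b i a1 = 0")
    case False
    have "subdegree (b i a1) + c \<le> n"
      unfolding n_def using member_le_sum[OF i, of "\<lambda>i. subdegree (b i a1)"] finite_branches by simp
    then have "fps_X ^ (subdegree (b i a1) + c) dvd fps_X ^ n" by (rule le_imp_power_dvd)
    also have "fps_X ^ n dvd b i a2 ^ n"
      using a2 i by (intro dvd_power_same) (simp add: order_ge_def)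
    finally obtain h where "b i a2 ^ n = b i a1 * h" "fps_X ^ c dvd h"
      by (rule fps_power_dvd_factor[OF False])
    then show ?thesis by blast
  qed (auto intro: exI[of _ 0])
  then obtain h where h: "\<And>i. i \<in> I \<Longrightarrow> fps_X ^ c dvd h i \<and> (b i a1 \<noteq> 0 \<longrightarrow> b i a2 ^ n = b i a1 * h i)"
    by metis
  obtain r where r: "r \<in> carrier A" "\<forall>i\<in>I. b i r = h i" using conductor[of h] h by blast
  define w where "w = a1 \<otimes> r \<ominus> a2 [^] n"
  have wA: "w \<in> carrier A" using a1A a2A r(1) by (simp add: w_def)
  \<comment> \<open>\<open>w\<close> vanishes on the branches where \<open>a1\<close> does not, so
    the product is zero on every branch. As \<open>a1\<close> is regular on \<open>M\<close>, it
    follows that \<open>w\<close> annihilates \<open>M\<close>.\<close>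
  have a1w: "a1 \<otimes> w = \<zero>"
  proof (rule b_eqI)
    fix i assume i: "i \<in> I"
    have "b i (a1 \<otimes> w) = b i a1 * (b i a1 * h i - b i a2 ^ n)"
      using i a1A a2A r wA by (simp add: w_def b_simps)
    then show "b i (a1 \<otimes> w) = b i \<zero>" using h[OF i] i by (cases "b i a1 = 0") (simp_all add: b_zero)
  qed (use a1A wA in auto)
  have pow: "a2 [^] n \<odot>\<^bsub>M\<^esub> x \<in> ?P" if x: "x \<in> carrier M" for x
  proof -
    have "w \<odot>\<^bsub>M\<^esub> x = \<zero>\<^bsub>M\<^esub>"
      by (rule r1) (use x wA a1A a1w in \<open>simp_all add: M.smult_assoc1[symmetric]\<close>)
    then have "a2 [^] n \<odot>\<^bsub>M\<^esub> x \<oplus>\<^bsub>M\<^esub> w \<odot>\<^bsub>M\<^esub> x = a2 [^] n \<odot>\<^bsub>M\<^esub> x" using a2A x by simp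
    moreover have "a2 [^] n \<odot>\<^bsub>M\<^esub> x \<oplus>\<^bsub>M\<^esub> w \<odot>\<^bsub>M\<^esub> x = (a1 \<otimes> r) \<odot>\<^bsub>M\<^esub> x"
      using M.smult_l_distr[of "a2 [^] n" w x] add_minus_cancel[of "a1 \<otimes> r" "a2 [^] n"] a1A a2A r(1) wA x
      by (simp add: w_def)
    ultimately have "a2 [^] n \<odot>\<^bsub>M\<^esub> x = a1 \<odot>\<^bsub>M\<^esub> (r \<odot>\<^bsub>M\<^esub> x)"
      using M.smult_assoc1[OF a1A r(1) x] by simp
    then show ?thesis unfolding P using r(1) x by (intro bexI[of _ "r \<odot>\<^bsub>M\<^esub> x"]) auto
  qed
  \<comment> \<open>Regularity of \<open>a2\<close> modulo \<open>a1 M\<close> removes one factor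
    \<open>a2\<close> at a time.\<close>
  have desc: "x \<in> ?P" if "x \<in> carrier M" "a2 [^] m \<odot>\<^bsub>M\<^esub> x \<in> ?P" for m :: nat and x
    using that
  proof (induction m arbitrary: x)
    case 0
    then show ?case by (simp only: nat_pow_0 M.smult_one)
  next
    case (Suc m)
    have "a2 [^] m \<odot>\<^bsub>M\<^esub> (a2 \<odot>\<^bsub>M\<^esub> x) \<in> ?P"
      using Suc.prems a2A M.smult_assoc1[of "a2 [^] m" a2 x] by (simp only: nat_pow_Suc nat_pow_closed)
    then have "a2 \<odot>\<^bsub>M\<^esub> x \<in> ?P" using Suc.IH[of "a2 \<odot>\<^bsub>M\<^esub> x"] a2A Suc.prems(1) M.smult_closed by blast
    then show ?case by (rule r2[OF Suc.prems(1)])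
  qed
  have "x \<in> seq_mult M as" if x: "x \<in> carrier M" for x
  proof -
    obtain y where y: "y \<in> carrier M" "x = a1 \<odot>\<^bsub>M\<^esub> y" using desc[OF x pow[OF x]] P by blast
    \<comment> \<open>The remaining members of the sequence contribute zero, so \<open>a1 M\<close>
      is contained in the submodule generated by the whole sequence.\<close>
    have zero: "\<zero>\<^bsub>M\<^esub> \<in> seq_mult M cs" if "set cs \<subseteq> carrier A" for cs
      using that
    proof (induction cs)
      case (Cons d cs)
      then have "\<zero>\<^bsub>M\<^esub> = d \<odot>\<^bsub>M\<^esub> \<zero>\<^bsub>M\<^esub> \<oplus>\<^bsub>M\<^esub> \<zero>\<^bsub>M\<^esub>" "\<zero>\<^bsub>M\<^esub> \<in> seq_mult M cs" by simp_all
      then show ?case unfolding seq_mult.simps by blast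
    qed simp
    have "x = a1 \<odot>\<^bsub>M\<^esub> y \<oplus>\<^bsub>M\<^esub> \<zero>\<^bsub>M\<^esub>" using y x by simp
    moreover have "\<zero>\<^bsub>M\<^esub> \<in> seq_mult M (a2 # bs)"
      by (rule zero) (use as order_ge_closed in \<open>auto simp: as_eq\<close>)
    ultimately show ?thesis unfolding as_eq seq_mult.simps(2)[of M a1] using y(1) by blast
  qed
  moreover have "x \<in> carrier M" if "set cs \<subseteq> carrier A" "x \<in> seq_mult M cs" for x cs
    using that by (induction cs arbitrary: x) auto
  moreover have "set as \<subseteq> carrier A" using as order_ge_closed by blast
  ultimately show False using ne by blast
qed

text \<open>Both numbers are at most one and the dimension is one. Without a regular element in
  \<open>mx\<close> the empty sequence is the longest candidate.\<close>

lemma depth_eq_krull_dim_iff: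
  assumes M: "module A M" and ne: "carrier M \<noteq> {\<zero>\<^bsub>M\<^esub>}"
  shows "depth A M = krull_dim A \<longleftrightarrow> (\<exists>a\<in>mx. regular_sequence M [a])"
proof -
  let ?S = "{enat (length as) | as. set as \<subseteq> mx \<and> regular_sequence M as}"
  have "depth A M = Sup ?S" unfolding depth_def the_maximalideal ..
  have le: "Sup ?S \<le> 1"
    using regular_sequence_length[OF M] by (intro Sup_least) (auto simp: one_enat_def)
  have "Sup ?S = 1 \<longleftrightarrow> (\<exists>a\<in>mx. regular_sequence M [a])"
  proof
    assume 1: "Sup ?S = 1"
    show "\<exists>a\<in>mx. regular_sequence M [a]"
    proof (rule ccontr)
      assume *: "\<not> (\<exists>a\<in>mx. regular_sequence M [a])"
      have "length as = 0" if as: "set as \<subseteq> mx" "regular_sequence M as" for as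
        using regular_sequence_length[OF M as] as * by (cases as) auto
      then have "Sup ?S \<le> 0" by (intro Sup_least) (auto simp: zero_enat_def)
      then show False using 1 by simp
    qed
  next
    assume "\<exists>a\<in>mx. regular_sequence M [a]"
    then obtain a where a: "a \<in> mx" "regular_sequence M [a]" by blast
    have "enat (length [a]) \<in> ?S" using a by (intro CollectI exI[of _ "[a]"]) simp
    then have "enat (length [a]) \<le> Sup ?S" by (rule Sup_upper)
    then show "Sup ?S = 1" using le by (simp add: one_enat_def order_antisym)
  qed
  then show ?thesis unfolding \<open>depth A M = Sup ?S\<close> krull_dim .
qed

text \<open>Reduces the homological condition to one on elements that passes visibly to submodules,
  to extensions and along surjections of rings. The zero module satisfies both sides.\<close>

theorem maximal_CM_iff:
  "maximal_CM A M \<longleftrightarrow> module A M \<and> finitely_generated A M \<and> socle_free M"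
proof (cases "module A M \<and> finitely_generated A M")
  case True
  then have M: "module A M" and fg: "finitely_generated A M" by blast+
  interpret M: module A M by (rule M)
  have "carrier M = {\<zero>\<^bsub>M\<^esub>} \<or> depth A M = krull_dim A \<longleftrightarrow> socle_free M"
  proof (cases "carrier M = {\<zero>\<^bsub>M\<^esub>}")
    case True
    then show ?thesis by (simp add: socle_free_def)
  next
    case False
    have "(\<exists>a\<in>mx. regular_sequence M [a]) \<longleftrightarrow> socle_free M"
    proof
      assume "\<exists>a\<in>mx. regular_sequence M [a]"
      then show "socle_free M"
        unfolding socle_free_def regular_sequence_single[OF M] by blast
    next
      assume sf: "socle_free M"
      \<comment> \<open>The exponent \<open>c + 1\<close> puts \<open>s\<close> into
        \<open>mx\<close> even for \<open>c = 0\<close>; then \<open>nakayama\<close> forbids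
        \<open>s M = M\<close>.\<close>
      obtain s where s: "s \<in> carrier A" "\<forall>i\<in>I. b i s = fps_X ^ (c + 1)"
        by (rule obtain_conductor_power)
      have smx: "s \<in> mx" using s by (simp add: order_ge_def)
      have "{s \<odot>\<^bsub>M\<^esub> x \<oplus>\<^bsub>M\<^esub> \<zero>\<^bsub>M\<^esub> | x. x \<in> carrier M} \<noteq> carrier M"
      proof
        assume eq: "{s \<odot>\<^bsub>M\<^esub> x \<oplus>\<^bsub>M\<^esub> \<zero>\<^bsub>M\<^esub> | x. x \<in> carrier M} = carrier M"
        have "\<exists>y\<in>carrier M. x = s \<odot>\<^bsub>M\<^esub> y" if "x \<in> carrier M" for x
        proof -
          from that have "x \<in> {s \<odot>\<^bsub>M\<^esub> x \<oplus>\<^bsub>M\<^esub> \<zero>\<^bsub>M\<^esub> | x. x \<in> carrier M}" by (simp only: eq)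
          then obtain y where y: "y \<in> carrier M" "x = s \<odot>\<^bsub>M\<^esub> y \<oplus>\<^bsub>M\<^esub> \<zero>\<^bsub>M\<^esub>" by (elim CollectE exE conjE)
          then have "x = s \<odot>\<^bsub>M\<^esub> y" using s(1) by simp
          then show ?thesis using y(1) by (rule bexI)
        qed
        then show False using nakayama[OF M fg smx] False by blast
      qed
      then have "regular_sequence M [s]"
        unfolding regular_sequence_single[OF M] using socle_free_nonzerodivisor[OF M sf s(1) s(2)[rule_format]] by blast
      then show "\<exists>a\<in>mx. regular_sequence M [a]" using smx by blast
    qed
    then show ?thesis using False depth_eq_krull_dim_iff[OF M False] by simp
  qed
  then show ?thesis using True by (simp add: maximal_CM_def)
qed (auto simp: maximal_CM_def)

text \<open>The ring is Noetherian because each branch maps onto a discrete valuation ring; the induction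
  below removes the branches one at a time.\<close>

theorem finitely_generated_submodule:
  assumes M: "module A M" and fg: "finitely_generated A M" and P: "submodule P A M"
  shows "finitely_generated A (M\<lparr>carrier := P\<rparr>)"
proof -
  interpret M: module A M by (rule M)
  obtain S where S: "finite S" "S \<subseteq> carrier M" "carrier M \<subseteq> mspan A M S"
    by (rule finitely_generatedE[OF M fg])
  \<comment> \<open>Induction on the generators of \<open>M\<close>, for all submodules of their
    span at once.\<close>
  have main: "\<exists>T. finite T \<and> T \<subseteq> P \<and> P \<subseteq> mspan A M T"
    if "submodule P A M" "P \<subseteq> mspan A M S" for P
    using S(1,2) that
  proof (induction S arbitrary: P)
    case empty
    then show ?case using M.mspan_empty mspan.zero[of M A "{}"] by (intro exI[of _ "{}"]) auto
  next
    case (insert s S)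
    have s: "s \<in> carrier M" and SM: "S \<subseteq> carrier M" using insert.prems by auto
    note P = M.submoduleE[OF insert.prems(2)]
    \<comment> \<open>Elements of \<open>P\<close> that admit a coefficient at \<open>s\<close>
      vanishing on the branches in \<open>T\<close>. For \<open>T = I\<close> the coefficient is
      zero and the induction hypothesis for \<open>S\<close> applies; \<open>T = {}\<close> gives
      all of \<open>P\<close>.\<close>
    define Q where "Q T = {z \<in> P. \<exists>r\<in>carrier A. \<exists>y\<in>mspan A M S.
      z = r \<odot>\<^bsub>M\<^esub> s \<oplus>\<^bsub>M\<^esub> y \<and> (\<forall>i\<in>T. b i r = 0)}" for T
    have "\<exists>G. finite G \<and> G \<subseteq> P \<and> Q (I - J) \<subseteq> mspan A M G" if "J \<subseteq> I" for J
      using finite_subset[OF that finite_branches] that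
    proof (induction J)
      case empty
      have sub: "submodule (P \<inter> mspan A M S) A M"
      proof (rule M.submoduleI)
        note mS = M.submoduleE[OF M.mspan_submodule[OF SM]]
        show "P \<inter> mspan A M S \<subseteq> carrier M" using P(1) by blast
        show "\<zero>\<^bsub>M\<^esub> \<in> P \<inter> mspan A M S"
          using M.mspan_least[OF insert.prems(2) empty_subsetI mspan.zero] mspan.zero by (rule IntI)
        show "\<ominus>\<^bsub>M\<^esub> x \<in> P \<inter> mspan A M S" if "x \<in> P \<inter> mspan A M S" for x
          using that P(3)[of x] mS(3)[of x] by simp
        show "x \<oplus>\<^bsub>M\<^esub> y \<in> P \<inter> mspan A M S" if "x \<in> P \<inter> mspan A M S" "y \<in> P \<inter> mspan A M S" for x y
          using that P(5)[of x y] mS(5)[of x y] by simp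
        show "r \<odot>\<^bsub>M\<^esub> x \<in> P \<inter> mspan A M S" if "r \<in> carrier A" "x \<in> P \<inter> mspan A M S" for r x
          using that P(4)[of r x] mS(4)[of r x] by simp
      qed
      have "Q I \<subseteq> P \<inter> mspan A M S"
      proof
        fix z assume "z \<in> Q I"
        then obtain r y where z: "z \<in> P" "r \<in> carrier A" "y \<in> mspan A M S"
          "z = r \<odot>\<^bsub>M\<^esub> s \<oplus>\<^bsub>M\<^esub> y" "\<forall>i\<in>I. b i r = 0" unfolding Q_def by blast
        have "r = \<zero>" by (rule b_eqI) (use z in \<open>simp_all add: b_zero\<close>)
        then show "z \<in> P \<inter> mspan A M S" using z s M.mspan_closed[OF SM z(3)] by simp
      qed
      moreover obtain T where "finite T" "T \<subseteq> P \<inter> mspan A M S" "P \<inter> mspan A M S \<subseteq> mspan A M T"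
        using insert.IH[OF SM sub] by blast
      ultimately show ?case by (intro exI[of _ T]) auto
    next
      case (insert i J)
      then obtain G where G: "finite G" "G \<subseteq> P" "Q (I - J) \<subseteq> mspan A M G" by auto
      have i: "i \<in> I" using insert.prems by blast
      have GM: "G \<subseteq> carrier M" using G(2) P(1) by blast
      let ?K = "I - insert i J"
      have KJ: "I - J = insert i ?K" using insert.hyps insert.prems by blast
      \<comment> \<open>The coefficients that survive on branch \<open>i\<close> and vanish on the
        branches still constrained. One of least order on branch \<open>i\<close> divides all others
        there, as in a discrete valuation ring.\<close>
      define V where "V = {r \<in> carrier A. b i r \<noteq> 0 \<and> (\<forall>k\<in>?K. b k r = 0) \<and>
        (\<exists>y\<in>mspan A M S. r \<odot>\<^bsub>M\<^esub> s \<oplus>\<^bsub>M\<^esub> y \<in> P)}"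
      show ?case
      proof (cases "V = {}")
        case True
        have "Q ?K \<subseteq> Q (I - J)"
          using True unfolding Q_def V_def KJ by blast
        then show ?thesis using G by (intro exI[of _ G]) auto
      next
        case False
        then obtain v where "v \<in> V" by blast
        then obtain r0 where r0: "r0 \<in> V" and min: "\<And>r. r \<in> V \<Longrightarrow> subdegree (b i r0) \<le> subdegree (b i r)"
          using ex_has_least_nat[of "\<lambda>r. r \<in> V" v "\<lambda>r. subdegree (b i r)"] by blast
        have r0A: "r0 \<in> carrier A" and r00: "b i r0 \<noteq> 0" "\<forall>k\<in>?K. b k r0 = 0"
          using r0 unfolding V_def by blast+
        obtain y0 where y0: "y0 \<in> mspan A M S" "r0 \<odot>\<^bsub>M\<^esub> s \<oplus>\<^bsub>M\<^esub> y0 \<in> P"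
          using r0 unfolding V_def by blast
        define z0 where "z0 = r0 \<odot>\<^bsub>M\<^esub> s \<oplus>\<^bsub>M\<^esub> y0"
        note y0M = M.mspan_closed[OF SM y0(1)]
        have z0: "z0 \<in> P" "z0 \<in> carrier M" using y0 r0A s y0M by (simp_all add: z0_def)
        have "z \<in> mspan A M (insert z0 G)" if z: "z \<in> Q ?K" for z
        proof -
          obtain r y where r: "z \<in> P" "r \<in> carrier A" "y \<in> mspan A M S"
            "z = r \<odot>\<^bsub>M\<^esub> s \<oplus>\<^bsub>M\<^esub> y" "\<forall>k\<in>?K. b k r = 0" using z unfolding Q_def by blast
          note yM = M.mspan_closed[OF SM r(3)]
          have "\<exists>h. b i r = b i r0 * h"
          proof (cases "b i r = 0")
            case False
            then have "r \<in> V" using r unfolding V_def by blast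
            then have "subdegree (b i r0) \<le> subdegree (b i r)" by (rule min)
            then have "b i r0 dvd b i r" using r00(1) False by (simp add: fps_dvd_iff)
            then show ?thesis by (elim dvdE) (rule exI)
          qed (auto intro: exI[of _ 0])
          then obtain h where h: "b i r = b i r0 * h" by blast
          \<comment> \<open>\<open>q\<close> is prescribed on branch \<open>i\<close> only. On the
            branches in \<open>?K\<close> both \<open>r\<close> and \<open>r0\<close> vanish, so
            subtracting \<open>q r0\<close> creates nothing there.\<close>
          obtain q where q: "q \<in> carrier A" "b i q = h" using b_surj[OF i] by blast
          define z' where "z' = z \<oplus>\<^bsub>M\<^esub> (\<ominus> q) \<odot>\<^bsub>M\<^esub> z0"
          have "z' = (r \<ominus> q \<otimes> r0) \<odot>\<^bsub>M\<^esub> s \<oplus>\<^bsub>M\<^esub> (y \<oplus>\<^bsub>M\<^esub> (\<ominus> q) \<odot>\<^bsub>M\<^esub> y0)"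
            unfolding z'_def r(4) z0_def using r(2) q(1) r0A s yM y0M
            by (simp add: M.smult_r_distr M.smult_assoc1[symmetric] l_minus minus_eq M.smult_l_distr M.M.a_ac)
          moreover have "z' \<in> P" unfolding z'_def using P r(1) z0(1) q(1) by simp
          moreover have "y \<oplus>\<^bsub>M\<^esub> (\<ominus> q) \<odot>\<^bsub>M\<^esub> y0 \<in> mspan A M S"
            using M.mspan_add[OF SM r(3) M.mspan_smult[OF SM _ y0(1)]] q(1) by simp
          moreover have "\<forall>k\<in>insert i ?K. b k (r \<ominus> q \<otimes> r0) = 0"
            using r q r0A r00(2) h i by (auto simp: b_simps)
          ultimately have "z' \<in> Q (I - J)"
            unfolding Q_def KJ using r(2) q(1) r0A by blast
          then have "z' \<in> mspan A M G" using G(3) by blast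
          then have "q \<odot>\<^bsub>M\<^esub> z0 \<oplus>\<^bsub>M\<^esub> z' \<in> mspan A M (insert z0 G)"
            using q(1) M.mspan_mono[OF subset_insertI] by (intro mspan.step) auto
          moreover have "q \<odot>\<^bsub>M\<^esub> z0 \<oplus>\<^bsub>M\<^esub> z' = z"
          proof -
            have zM: "z \<in> carrier M" using r(1) P(1) by blast
            have "z' = z \<ominus>\<^bsub>M\<^esub> q \<odot>\<^bsub>M\<^esub> z0"
              using q(1) z0(2) by (simp add: z'_def M.smult_l_minus M.M.minus_eq)
            then show ?thesis using M.M.add_minus_cancel[of z "q \<odot>\<^bsub>M\<^esub> z0"] zM q(1) z0(2) by simp
          qed
          ultimately show ?thesis by simp
        qed
        then show ?thesis using G z0(1) by (intro exI[of _ "insert z0 G"]) auto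
      qed
    qed
    from this[OF order_refl] obtain G where G: "finite G" "G \<subseteq> P" "Q {} \<subseteq> mspan A M G" by auto
    have "P \<subseteq> Q {}"
    proof
      fix z assume z: "z \<in> P"
      then have "z \<in> mspan A M (insert s S)" using insert.prems(3) by blast
      then obtain r y where "r \<in> carrier A" "y \<in> mspan A M S" "z = r \<odot>\<^bsub>M\<^esub> s \<oplus>\<^bsub>M\<^esub> y"
        by (rule M.mspan_insertE[OF insert.prems(1)])
      then show "z \<in> Q {}" unfolding Q_def using z by blast
    qed
    then show ?case using G by blast
  qed
  have "P \<subseteq> mspan A M S" using M.submoduleE(1)[OF P] S(3) by blast
  then obtain T where T: "finite T" "T \<subseteq> P" "P \<subseteq> mspan A M T" using main[OF P] by blast
  have modP: "module A (M\<lparr>carrier := P\<rparr>)" by (rule submodule.submodule_is_module[OF P M])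
  \<comment> \<open>Spans are formed with the operations alone, so shrinking the carrier does not
    change them.\<close>
  have "x \<in> mspan A (M\<lparr>carrier := P\<rparr>) T" if "x \<in> mspan A M T" for x
    using that
  proof induction
    case zero
    show ?case using mspan.zero[of "M\<lparr>carrier := P\<rparr>" A T] by simp
  next
    case (step r s x)
    then show ?case using mspan.step[OF step(1,2,4)] by simp
  qed
  then show ?thesis using T by (intro finitely_generatedI[OF modP T(1)]) auto
qed

end

section \<open>Splitting a module along two quotient rings\<close>

text \<open>Partial inverse of \<open>restrict_scalars\<close> along a surjection: a scalar acts
  through an arbitrary preimage, which is well defined once the kernel of \<open>h\<close>
  annihilates the module.\<close>

definition corestrict_scalars ::
  "('r, 'x) ring_scheme \<Rightarrow> ('r \<Rightarrow> 's) \<Rightarrow> ('r, 'm) module \<Rightarrow> ('s, 'm) module" where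
  "corestrict_scalars R h M = ring.extend (ring.truncate M)
     (module.fields (\<lambda>s x. inv_into (carrier R) h s \<odot>\<^bsub>M\<^esub> x))"

lemma corestrict_scalars_simps [simp]:
  "carrier (corestrict_scalars R h M) = carrier M"
  "\<zero>\<^bsub>corestrict_scalars R h M\<^esub> = \<zero>\<^bsub>M\<^esub>"
  "x \<oplus>\<^bsub>corestrict_scalars R h M\<^esub> y = x \<oplus>\<^bsub>M\<^esub> y"
  by (simp_all add: corestrict_scalars_def ring.defs module.defs)

lemma corestrict_scalars_smult:
  assumes M: "module R M" and h: "h \<in> ring_hom R A" and A: "ring A"
    and ann: "\<And>r x. \<lbrakk>r \<in> carrier R; h r = \<zero>\<^bsub>A\<^esub>; x \<in> carrier M\<rbrakk> \<Longrightarrow> r \<odot>\<^bsub>M\<^esub> x = \<zero>\<^bsub>M\<^esub>"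
    and r: "r \<in> carrier R" and x: "x \<in> carrier M"
  shows "h r \<odot>\<^bsub>corestrict_scalars R h M\<^esub> x = r \<odot>\<^bsub>M\<^esub> x"
proof -
  interpret M: module R M by fact
  interpret A: ring A by fact
  interpret h: ring_hom_ring R A h by (intro ring_hom_ringI2 M.R.ring_axioms A h)
  let ?t = "inv_into (carrier R) h (h r)"
  have t: "?t \<in> carrier R" "h ?t = h r"
    using r by (auto intro: inv_into_into f_inv_into_f)
  have "h (r \<ominus>\<^bsub>R\<^esub> ?t) = \<zero>\<^bsub>A\<^esub>"
    using r t by (simp add: M.R.minus_eq A.r_neg)
  then have "(r \<ominus>\<^bsub>R\<^esub> ?t) \<odot>\<^bsub>M\<^esub> x = \<zero>\<^bsub>M\<^esub>"
    using ann[of "r \<ominus>\<^bsub>R\<^esub> ?t" x] r t x by simp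
  moreover have "(?t \<oplus>\<^bsub>R\<^esub> (r \<ominus>\<^bsub>R\<^esub> ?t)) \<odot>\<^bsub>M\<^esub> x = ?t \<odot>\<^bsub>M\<^esub> x \<oplus>\<^bsub>M\<^esub> (r \<ominus>\<^bsub>R\<^esub> ?t) \<odot>\<^bsub>M\<^esub> x"
    using r t x by (intro M.smult_l_distr) simp_all
  ultimately have "r \<odot>\<^bsub>M\<^esub> x = ?t \<odot>\<^bsub>M\<^esub> x"
    using M.R.add_minus_cancel[OF r t(1)] t x by simp
  then show ?thesis by (simp add: corestrict_scalars_def ring.defs module.defs)
qed

lemma module_corestrict_scalars:
  assumes M: "module R M" and h: "h \<in> ring_hom R A" and A: "cring A" and surj: "h ` carrier R = carrier A"
    and ann: "\<And>r x. \<lbrakk>r \<in> carrier R; h r = \<zero>\<^bsub>A\<^esub>; x \<in> carrier M\<rbrakk> \<Longrightarrow> r \<odot>\<^bsub>M\<^esub> x = \<zero>\<^bsub>M\<^esub>"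
  shows "module A (corestrict_scalars R h M)"
proof -
  interpret M: module R M by fact
  interpret A: cring A by fact
  let ?M = "corestrict_scalars R h M"
  have sm: "h r \<odot>\<^bsub>?M\<^esub> x = r \<odot>\<^bsub>M\<^esub> x" if "r \<in> carrier R" "x \<in> carrier M" for r x
    by (rule corestrict_scalars_smult[OF M h A.ring_axioms]) (use ann that in auto)
  have preimE: thesis if "s \<in> carrier A" "\<And>r. \<lbrakk>r \<in> carrier R; s = h r\<rbrakk> \<Longrightarrow> thesis" for s thesis
    using that(1) unfolding surj[symmetric] by (rule imageE) (rule that(2))
  have "abelian_group ?M"
  proof (rule abelian_groupI)
    show "\<exists>y\<in>carrier ?M. y \<oplus>\<^bsub>?M\<^esub> x = \<zero>\<^bsub>?M\<^esub>" if "x \<in> carrier ?M" for x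
      using that by (auto intro!: bexI[of _ "\<ominus>\<^bsub>M\<^esub> x"] simp: M.M.l_neg)
  qed (auto simp: M.M.a_ac)
  then show ?thesis
  proof (intro moduleI A)
    show "s \<odot>\<^bsub>?M\<^esub> x \<in> carrier ?M" if "s \<in> carrier A" "x \<in> carrier ?M" for s x
      by (rule preimE[OF that(1)]) (use that(2) in \<open>simp add: sm\<close>)
    show "(s \<oplus>\<^bsub>A\<^esub> t) \<odot>\<^bsub>?M\<^esub> x = s \<odot>\<^bsub>?M\<^esub> x \<oplus>\<^bsub>?M\<^esub> t \<odot>\<^bsub>?M\<^esub> x"
      if s: "s \<in> carrier A" and t: "t \<in> carrier A" and x: "x \<in> carrier ?M" for s t x
    proof -
      obtain r where r: "r \<in> carrier R" "s = h r" by (rule preimE[OF s])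
      obtain q where q: "q \<in> carrier R" "t = h q" by (rule preimE[OF t])
      from r q show ?thesis
        using x sm[of "r \<oplus>\<^bsub>R\<^esub> q" x] ring_hom_add[OF h, of r q] by (simp add: sm M.smult_l_distr)
    qed
    show "s \<odot>\<^bsub>?M\<^esub> (x \<oplus>\<^bsub>?M\<^esub> y) = s \<odot>\<^bsub>?M\<^esub> x \<oplus>\<^bsub>?M\<^esub> s \<odot>\<^bsub>?M\<^esub> y"
      if s: "s \<in> carrier A" and x: "x \<in> carrier ?M" "y \<in> carrier ?M" for s x y
    proof -
      obtain r where r: "r \<in> carrier R" "s = h r" by (rule preimE[OF s])
      then show ?thesis using x by (simp add: sm M.smult_r_distr)
    qed
    show "(s \<otimes>\<^bsub>A\<^esub> t) \<odot>\<^bsub>?M\<^esub> x = s \<odot>\<^bsub>?M\<^esub> (t \<odot>\<^bsub>?M\<^esub> x)"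
      if s: "s \<in> carrier A" and t: "t \<in> carrier A" and x: "x \<in> carrier ?M" for s t x
    proof -
      obtain r where r: "r \<in> carrier R" "s = h r" by (rule preimE[OF s])
      obtain q where q: "q \<in> carrier R" "t = h q" by (rule preimE[OF t])
      from r q show ?thesis
        using x sm[of "r \<otimes>\<^bsub>R\<^esub> q" x] ring_hom_mult[OF h, of r q] by (simp add: sm M.smult_assoc1)
    qed
    show "\<one>\<^bsub>A\<^esub> \<odot>\<^bsub>?M\<^esub> x = x" if "x \<in> carrier ?M" for x
      using that sm[of "\<one>\<^bsub>R\<^esub>" x] ring_hom_one[OF h] by simp
  qed
qed

text \<open>Generators and socle are the same over both rings, since \<open>h\<close> is onto and
  matches the maximal ideals. This allows Cohen--Macaulayness over the quotient rings to be tested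
  over \<open>R\<close>.\<close>

lemma maximal_CM_restrict_scalars:
  assumes R: "branched_ring R I b c" and A: "branched_ring A I' b' c'"
    and h: "h \<in> ring_hom R A" and surj: "h ` carrier R = carrier A"
    and mx: "\<And>r. r \<in> carrier R \<Longrightarrow>
      h r \<in> branched_ring.order_ge A I' b' (Suc 0) \<longleftrightarrow> r \<in> branched_ring.order_ge R I b (Suc 0)"
    and N: "module A N"
  shows "maximal_CM A N \<longleftrightarrow> maximal_CM R (restrict_scalars h N)"
proof -
  interpret R: branched_ring R I b c by (rule R)
  interpret A: branched_ring A I' b' c' by (rule A)
  note modN = module_restrict_scalars[OF R.is_cring h N]
  have eq: "(\<forall>s\<in>A.mx. s \<odot>\<^bsub>N\<^esub> x = \<zero>\<^bsub>N\<^esub>) \<longleftrightarrow> (\<forall>r\<in>R.mx. h r \<odot>\<^bsub>N\<^esub> x = \<zero>\<^bsub>N\<^esub>)" for x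
  proof (intro iffI ballI)
    show "h r \<odot>\<^bsub>N\<^esub> x = \<zero>\<^bsub>N\<^esub>" if "\<forall>s\<in>A.mx. s \<odot>\<^bsub>N\<^esub> x = \<zero>\<^bsub>N\<^esub>" "r \<in> R.mx" for r
      using that mx R.order_ge_closed by blast
    show "s \<odot>\<^bsub>N\<^esub> x = \<zero>\<^bsub>N\<^esub>" if *: "\<forall>r\<in>R.mx. h r \<odot>\<^bsub>N\<^esub> x = \<zero>\<^bsub>N\<^esub>" and s: "s \<in> A.mx" for s
    proof -
      obtain r where r: "r \<in> carrier R" "s = h r" using A.order_ge_closed[OF s] surj by blast
      then show ?thesis using * s mx by blast
    qed
  qed
  have "A.socle_free N \<longleftrightarrow> R.socle_free (restrict_scalars h N)"
    by (simp add: A.socle_free_def R.socle_free_def eq)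
  then show ?thesis
    unfolding A.maximal_CM_iff R.maximal_CM_iff
    using N modN finitely_generated_restrict_scalars[OF N modN surj] by simp
qed

text \<open>\<open>ker_a\<close> and \<open>ker_b\<close> hold because an element that dies in
  \<open>A\<close> is supported on the branches of \<open>B\<close>, where \<open>g\<close>
  vanishes, and symmetrically. \<open>spanned\<close> provides the power of the maximal ideal
  contained in (f, g).\<close>

locale splitting =
  R: branched_ring R I bR cR + A: branched_ring A J bA cA + B: branched_ring B K bB cB
  for R :: "('r, 'x) ring_scheme" and I and bR :: "nat \<Rightarrow> 'r \<Rightarrow> 'k :: field fps" and cR
    and A :: "('s, 'y) ring_scheme" and J and bA :: "nat \<Rightarrow> 's \<Rightarrow> 'k fps" and cA
    and B :: "('t, 'z) ring_scheme" and K and bB :: "nat \<Rightarrow> 't \<Rightarrow> 'k fps" and cB +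
  fixes a :: "'r \<Rightarrow> 's" and b :: "'r \<Rightarrow> 't" and f g :: 'r and n :: nat
  assumes a_hom: "a \<in> ring_hom R A" and a_surj: "a ` carrier R = carrier A"
    and b_hom: "b \<in> ring_hom R B" and b_surj: "b ` carrier R = carrier B"
    and a_mx: "r \<in> carrier R \<Longrightarrow> a r \<in> A.mx \<longleftrightarrow> r \<in> R.mx"
    and b_mx: "r \<in> carrier R \<Longrightarrow> b r \<in> B.mx \<longleftrightarrow> r \<in> R.mx"
    and f: "f \<in> carrier R" and g: "g \<in> carrier R"
    and a_f: "a f = \<zero>\<^bsub>A\<^esub>" and b_g: "b g = \<zero>\<^bsub>B\<^esub>"
    and ker_a: "\<lbrakk>r \<in> carrier R; a r = \<zero>\<^bsub>A\<^esub>\<rbrakk> \<Longrightarrow> r \<otimes>\<^bsub>R\<^esub> g = \<zero>\<^bsub>R\<^esub>"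
    and ker_b: "\<lbrakk>r \<in> carrier R; b r = \<zero>\<^bsub>B\<^esub>\<rbrakk> \<Longrightarrow> r \<otimes>\<^bsub>R\<^esub> f = \<zero>\<^bsub>R\<^esub>"
    and spanned: "w \<in> R.order_ge n \<Longrightarrow> \<exists>u\<in>carrier R. \<exists>v\<in>carrier R. w = u \<otimes>\<^bsub>R\<^esub> f \<oplus>\<^bsub>R\<^esub> v \<otimes>\<^bsub>R\<^esub> g"
begin

abbreviation resa :: "('s, 'm) module \<Rightarrow> ('r, 'm) module" where "resa \<equiv> restrict_scalars a"
abbreviation resb :: "('t, 'm) module \<Rightarrow> ('r, 'm) module" where "resb \<equiv> restrict_scalars b"

lemma maximal_CM_restrict_a: "module A N \<Longrightarrow> maximal_CM A N \<longleftrightarrow> maximal_CM R (resa N)"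
  by (rule maximal_CM_restrict_scalars[OF R.branched_ring_axioms A.branched_ring_axioms a_hom a_surj])
    (rule a_mx)

lemma maximal_CM_restrict_b: "module B L \<Longrightarrow> maximal_CM B L \<longleftrightarrow> maximal_CM R (resb L)"
  by (rule maximal_CM_restrict_scalars[OF R.branched_ring_axioms B.branched_ring_axioms b_hom b_surj])
    (rule b_mx)

lemma annihilated_eq_zero:
  assumes M: "module R M" and sf: "R.socle_free M" and x: "x \<in> carrier M"
    and "f \<odot>\<^bsub>M\<^esub> x = \<zero>\<^bsub>M\<^esub>" "g \<odot>\<^bsub>M\<^esub> x = \<zero>\<^bsub>M\<^esub>"
  shows "x = \<zero>\<^bsub>M\<^esub>"
proof (rule R.socle_free_order_ge[OF M sf x])
  interpret M: module R M by (rule M)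
  fix w assume "w \<in> R.order_ge n"
  then obtain u v where "u \<in> carrier R" "v \<in> carrier R" "w = u \<otimes>\<^bsub>R\<^esub> f \<oplus>\<^bsub>R\<^esub> v \<otimes>\<^bsub>R\<^esub> g" using spanned by blast
  then show "w \<odot>\<^bsub>M\<^esub> x = \<zero>\<^bsub>M\<^esub>"
    using assms(4,5) x f g by (simp add: M.smult_l_distr M.smult_assoc1)
qed

lemma f_g_zero: "f \<otimes>\<^bsub>R\<^esub> g = \<zero>\<^bsub>R\<^esub>"
  using ker_a[OF f a_f] .

section \<open>Kernel and image of multiplication by g\<close>

definition ker_g :: "('r, 'm) module \<Rightarrow> 'm set" where
  "ker_g M = {x \<in> carrier M. g \<odot>\<^bsub>M\<^esub> x = \<zero>\<^bsub>M\<^esub>}"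

definition im_g :: "('r, 'm) module \<Rightarrow> 'm set" where
  "im_g M = (\<lambda>x. g \<odot>\<^bsub>M\<^esub> x) ` carrier M"

definition subm :: "('r, 'm) module \<Rightarrow> ('t, 'm) module" where
  "subm M = corestrict_scalars R b (M\<lparr>carrier := ker_g M\<rparr>)"

text \<open>A copy of M modulo the kernel of \<open>g\<close> that stays on the type
  \<open>'m\<close>, where a quotient by cosets would leave it.\<close>

definition quotm :: "('r, 'm) module \<Rightarrow> ('s, 'm) module" where
  "quotm M = corestrict_scalars R a (M\<lparr>carrier := im_g M\<rparr>)"

lemma subm_simps [simp]:
  "carrier (subm M) = ker_g M" "\<zero>\<^bsub>subm M\<^esub> = \<zero>\<^bsub>M\<^esub>" "x \<oplus>\<^bsub>subm M\<^esub> y = x \<oplus>\<^bsub>M\<^esub> y"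
  by (simp_all add: subm_def)

lemma quotm_simps [simp]:
  "carrier (quotm M) = im_g M" "\<zero>\<^bsub>quotm M\<^esub> = \<zero>\<^bsub>M\<^esub>" "x \<oplus>\<^bsub>quotm M\<^esub> y = x \<oplus>\<^bsub>M\<^esub> y"
  by (simp_all add: quotm_def)

lemma g_smult_comm:
  assumes "module R M" "r \<in> carrier R" "x \<in> carrier M"
  shows "g \<odot>\<^bsub>M\<^esub> (r \<odot>\<^bsub>M\<^esub> x) = r \<odot>\<^bsub>M\<^esub> (g \<odot>\<^bsub>M\<^esub> x)"
proof -
  interpret M: module R M by fact
  show ?thesis using assms(2,3) g R.m_comm[OF g assms(2)] by (simp add: M.smult_assoc1[symmetric])
qed

lemma ker_g_submodule:
  assumes M: "module R M" shows "submodule (ker_g M) R M"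
proof -
  interpret M: module R M by (rule M)
  show ?thesis
  proof (rule M.submoduleI)
    show "\<ominus>\<^bsub>M\<^esub> x \<in> ker_g M" if "x \<in> ker_g M" for x
      using that g M.smult_r_minus[of g x] M.smult_r_minus[of "\<zero>\<^bsub>R\<^esub>" x] M.smult_r_null[of g]
        M.smult_r_minus[of "\<zero>\<^bsub>R\<^esub>" "\<zero>\<^bsub>M\<^esub>"]
      by (simp add: ker_g_def)
    show "x \<oplus>\<^bsub>M\<^esub> y \<in> ker_g M" if "x \<in> ker_g M" "y \<in> ker_g M" for x y
      using that g by (simp add: ker_g_def M.smult_r_distr)
    show "r \<odot>\<^bsub>M\<^esub> x \<in> ker_g M" if "r \<in> carrier R" "x \<in> ker_g M" for r x
      using that g by (simp add: ker_g_def g_smult_comm[OF M])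
  qed (use g in \<open>auto simp: ker_g_def\<close>)
qed

lemma im_g_submodule:
  assumes M: "module R M" shows "submodule (im_g M) R M"
proof -
  interpret M: module R M by (rule M)
  have I: "g \<odot>\<^bsub>M\<^esub> x \<in> im_g M" if "x \<in> carrier M" for x
    unfolding im_g_def using that by (rule imageI)
  have E: thesis if "z \<in> im_g M" "\<And>x. \<lbrakk>x \<in> carrier M; z = g \<odot>\<^bsub>M\<^esub> x\<rbrakk> \<Longrightarrow> thesis" for z thesis
    using that(1) unfolding im_g_def by (rule imageE) (rule that(2))
  show ?thesis
  proof (rule M.submoduleI)
    show "im_g M \<subseteq> carrier M" unfolding im_g_def by (rule image_subsetI) (use g in simp)
    show "\<zero>\<^bsub>M\<^esub> \<in> im_g M" using I[of "\<zero>\<^bsub>M\<^esub>"] g by simp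
    show "\<ominus>\<^bsub>M\<^esub> z \<in> im_g M" if z: "z \<in> im_g M" for z
    proof (rule E[OF z])
      fix x assume "x \<in> carrier M" "z = g \<odot>\<^bsub>M\<^esub> x"
      then show ?thesis using I[of "\<ominus>\<^bsub>M\<^esub> x"] g by (simp add: M.smult_r_minus)
    qed
    show "z \<oplus>\<^bsub>M\<^esub> w \<in> im_g M" if z: "z \<in> im_g M" and w: "w \<in> im_g M" for z w
    proof (rule E[OF z], rule E[OF w])
      fix x y assume "x \<in> carrier M" "z = g \<odot>\<^bsub>M\<^esub> x" "y \<in> carrier M" "w = g \<odot>\<^bsub>M\<^esub> y"
      then show ?thesis using I[of "x \<oplus>\<^bsub>M\<^esub> y"] g by (simp add: M.smult_r_distr)
    qed
    show "r \<odot>\<^bsub>M\<^esub> z \<in> im_g M" if r: "r \<in> carrier R" and z: "z \<in> im_g M" for r z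
    proof (rule E[OF z])
      fix x assume "x \<in> carrier M" "z = g \<odot>\<^bsub>M\<^esub> x"
      then show ?thesis using I[of "r \<odot>\<^bsub>M\<^esub> x"] r by (simp add: g_smult_comm[OF M])
    qed
  qed
qed

lemma socle_free_submodule:
  assumes "R.socle_free M" "P \<subseteq> carrier M" shows "R.socle_free (M\<lparr>carrier := P\<rparr>)"
  using assms unfolding R.socle_free_def by auto

text \<open>In dimension one the property descends to submodules: finite generation because the ring
  is Noetherian, the socle condition trivially.\<close>

lemma maximal_CM_submodule:
  assumes "maximal_CM R M" "submodule P R M" shows "maximal_CM R (M\<lparr>carrier := P\<rparr>)"
proof -
  have M: "module R M" using assms(1) by (rule maximal_CM_module)
  have "P \<subseteq> carrier M" by (rule module.submoduleE(1)[OF M assms(2)])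
  then show ?thesis
    using assms R.finitely_generated_submodule[OF M _ assms(2)] socle_free_submodule
      submodule.submodule_is_module[OF assms(2) M]
    unfolding R.maximal_CM_iff by blast
qed

text \<open>Corestricting and restricting again yields a different record that agrees with the
  original one on the carrier only, so the property has to be carried over by hand.\<close>

lemma maximal_CM_cong:
  assumes CM': "maximal_CM R M'" and M'': "module R M''"
    and eq: "carrier M'' = carrier M'" "\<zero>\<^bsub>M''\<^esub> = \<zero>\<^bsub>M'\<^esub>" "\<And>x y. x \<oplus>\<^bsub>M''\<^esub> y = x \<oplus>\<^bsub>M'\<^esub> y"
      "\<And>r x. \<lbrakk>r \<in> carrier R; x \<in> carrier M'\<rbrakk> \<Longrightarrow> r \<odot>\<^bsub>M''\<^esub> x = r \<odot>\<^bsub>M'\<^esub> x"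
  shows "maximal_CM R M''"
proof -
  have M': "module R M'" using CM' by (rule maximal_CM_module)
  interpret M': module R M' by (rule M')
  interpret M'': module R M'' by (rule M'')
  have "(\<lambda>x\<in>carrier M'. x) \<in> mod_hom R M' M''"
    by (rule mod_hom_restrictI[OF M']) (simp_all add: eq)
  then have "finitely_generated R M''"
    by (rule finitely_generated_image[OF _ M' M'']) (use CM' eq(1) in \<open>auto simp: R.maximal_CM_iff\<close>)
  moreover have "R.socle_free M''"
    using CM' R.order_ge_closed[of _ 1] unfolding R.maximal_CM_iff R.socle_free_def
    by (simp add: eq)
  ultimately show ?thesis using M'' by (simp add: R.maximal_CM_iff)
qed

context
  fixes M :: "('r, 'm) module"
  assumes CM: "maximal_CM R M"
begin

private lemma M: "module R M" using CM by (rule maximal_CM_module)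

interpretation M: module R M by (rule M)

private lemma sf: "R.socle_free M" using CM by (simp add: R.maximal_CM_iff)

text \<open>The product \<open>r x\<close> is killed by \<open>f\<close>, since
  \<open>r f = 0\<close>, and by \<open>g\<close>, since \<open>g x = 0\<close>.\<close>

lemma ker_b_annihilates:
  assumes r: "r \<in> carrier R" "b r = \<zero>\<^bsub>B\<^esub>" and x: "x \<in> ker_g M"
  shows "r \<odot>\<^bsub>M\<^esub> x = \<zero>\<^bsub>M\<^esub>"
proof (rule annihilated_eq_zero[OF M sf])
  have xM: "x \<in> carrier M" "g \<odot>\<^bsub>M\<^esub> x = \<zero>\<^bsub>M\<^esub>" using x by (simp_all add: ker_g_def)
  show "r \<odot>\<^bsub>M\<^esub> x \<in> carrier M" using r xM by simp
  have "f \<odot>\<^bsub>M\<^esub> (r \<odot>\<^bsub>M\<^esub> x) = (r \<otimes>\<^bsub>R\<^esub> f) \<odot>\<^bsub>M\<^esub> x"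
    using f r(1) xM R.m_comm[OF f r(1)] by (simp add: M.smult_assoc1[symmetric])
  then show "f \<odot>\<^bsub>M\<^esub> (r \<odot>\<^bsub>M\<^esub> x) = \<zero>\<^bsub>M\<^esub>" using ker_b[OF r] xM by simp
  show "g \<odot>\<^bsub>M\<^esub> (r \<odot>\<^bsub>M\<^esub> x) = \<zero>\<^bsub>M\<^esub>" using g_smult_comm[OF M r(1) xM(1)] xM r by simp
qed

lemma ker_a_annihilates:
  assumes r: "r \<in> carrier R" "a r = \<zero>\<^bsub>A\<^esub>" and z: "z \<in> im_g M"
  shows "r \<odot>\<^bsub>M\<^esub> z = \<zero>\<^bsub>M\<^esub>"
proof -
  obtain x where x: "x \<in> carrier M" "z = g \<odot>\<^bsub>M\<^esub> x" using z unfolding im_g_def by (rule imageE)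
  then show ?thesis using M.smult_assoc1[OF r(1) g x(1)] ker_a[OF r] by simp
qed

lemma module_subm: "module B (subm M)"
  unfolding subm_def
  by (rule module_corestrict_scalars[OF submodule.submodule_is_module[OF ker_g_submodule[OF M] M] b_hom B.is_cring b_surj])
    (simp add: ker_b_annihilates)

lemma module_quotm: "module A (quotm M)"
  unfolding quotm_def
  by (rule module_corestrict_scalars[OF submodule.submodule_is_module[OF im_g_submodule[OF M] M] a_hom A.is_cring a_surj])
    (simp add: ker_a_annihilates)

lemma subm_smult: "\<lbrakk>r \<in> carrier R; x \<in> ker_g M\<rbrakk> \<Longrightarrow> b r \<odot>\<^bsub>subm M\<^esub> x = r \<odot>\<^bsub>M\<^esub> x"
  using corestrict_scalars_smult[OF submodule.submodule_is_module[OF ker_g_submodule[OF M] M] b_hom B.ring_axioms, of r x]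
  by (simp add: subm_def ker_b_annihilates)

lemma quotm_smult: "\<lbrakk>r \<in> carrier R; x \<in> im_g M\<rbrakk> \<Longrightarrow> a r \<odot>\<^bsub>quotm M\<^esub> x = r \<odot>\<^bsub>M\<^esub> x"
  using corestrict_scalars_smult[OF submodule.submodule_is_module[OF im_g_submodule[OF M] M] a_hom A.ring_axioms, of r x]
  by (simp add: quotm_def ker_a_annihilates)

lemma maximal_CM_subm: "maximal_CM B (subm M)"
  unfolding maximal_CM_restrict_b[OF module_subm]
  by (rule maximal_CM_cong[OF maximal_CM_submodule[OF CM ker_g_submodule[OF M]]
        module_restrict_scalars[OF R.is_cring b_hom module_subm]])
    (simp_all add: subm_smult)

lemma maximal_CM_quotm: "maximal_CM A (quotm M)"
  unfolding maximal_CM_restrict_a[OF module_quotm]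
  by (rule maximal_CM_cong[OF maximal_CM_submodule[OF CM im_g_submodule[OF M]]
        module_restrict_scalars[OF R.is_cring a_hom module_quotm]])
    (simp_all add: quotm_smult)

lemma canonical_extension:
  "extension R (resa (quotm M)) (resb (subm M)) M
     (\<lambda>x\<in>ker_g M. x) (\<lambda>x\<in>carrier M. g \<odot>\<^bsub>M\<^esub> x)"
proof -
  note modN = module_restrict_scalars[OF R.is_cring a_hom module_quotm]
  note modL = module_restrict_scalars[OF R.is_cring b_hom module_subm]
  have i: "restrict (\<lambda>x. x) (carrier (resb (subm M))) \<in> mod_hom R (resb (subm M)) M"
    by (rule mod_hom_restrictI[OF modL]) (auto simp: subm_smult ker_g_def)
  have gI: "g \<odot>\<^bsub>M\<^esub> x \<in> im_g M" if "x \<in> carrier M" for x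
    unfolding im_g_def using that by (rule imageI)
  have p: "(\<lambda>x\<in>carrier M. g \<odot>\<^bsub>M\<^esub> x) \<in> mod_hom R M (resa (quotm M))"
    by (rule mod_hom_restrictI[OF M]) (simp_all add: gI quotm_smult g_smult_comm[OF M] M.smult_r_distr g)
  have im: "(\<lambda>x\<in>ker_g M. x) ` ker_g M = {x \<in> carrier M. (\<lambda>x\<in>carrier M. g \<odot>\<^bsub>M\<^esub> x) x = \<zero>\<^bsub>M\<^esub>}"
    unfolding image_restrict_eq by (auto simp: ker_g_def)
  have inj: "inj_on (\<lambda>x\<in>ker_g M. x) (ker_g M)" by (simp add: inj_on_def)
  have p_im: "(\<lambda>x\<in>carrier M. g \<odot>\<^bsub>M\<^esub> x) ` carrier M = im_g M"
    unfolding im_g_def by (rule image_restrict_eq)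
  show ?thesis
    by (intro extension.intro modN modL)
      (simp only: extensions_def mem_Collect_eq case_prod_conv restrict_scalars_simps subm_simps quotm_simps
        simp_thms M inj im p_im p i[unfolded restrict_scalars_simps subm_simps])
qed

end

section \<open>Functoriality of kernel and image\<close>

lemma hom_im_g:
  assumes "h \<in> mod_hom R M M'" "module R M" "z \<in> im_g M"
  shows "h z \<in> im_g M'"
proof -
  obtain x where x: "x \<in> carrier M" "z = g \<odot>\<^bsub>M\<^esub> x" using assms(3) unfolding im_g_def by (rule imageE)
  then have "h z = g \<odot>\<^bsub>M'\<^esub> h x" using mod_hom_smult[OF assms(1) g] by simp
  then show ?thesis unfolding im_g_def using mod_hom_closed[OF assms(1) x(1)] by (rule image_eqI)
qed

lemma hom_ker_g:
  assumes "h \<in> mod_hom R M M'" "module R M" "module R M'" "x \<in> ker_g M"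
  shows "h x \<in> ker_g M'"
  using assms(4) mod_hom_closed[OF assms(1)] mod_hom_smult[OF assms(1) g, of x, symmetric] mod_hom_zero[OF assms(1-3)]
  by (simp add: ker_g_def)

lemma im_g_subset: "module R M \<Longrightarrow> im_g M \<subseteq> carrier M"
  by (rule module.submoduleE(1)[OF _ im_g_submodule])

lemma ker_g_subset: "ker_g M \<subseteq> carrier M"
  by (auto simp: ker_g_def)

lemma restrict_hom_quotm:
  assumes CM: "maximal_CM R M" "maximal_CM R M'" and h: "h \<in> mod_hom R M M'"
  shows "restrict h (im_g M) \<in> mod_hom R (resa (quotm M)) (resa (quotm M'))"
proof -
  note M = maximal_CM_module[OF CM(1)] and M' = maximal_CM_module[OF CM(2)]
  note im = hom_im_g[OF h M] and sub = subsetD[OF im_g_subset[OF M]]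
  have "restrict h (carrier (resa (quotm M)))
      \<in> mod_hom R (resa (quotm M)) (resa (quotm M'))"
    by (rule mod_hom_restrictI[OF module_restrict_scalars[OF R.is_cring a_hom module_quotm[OF CM(1)]]])
      (simp_all add: im sub mod_hom_add[OF h] mod_hom_smult[OF h] quotm_smult[OF CM(1)] quotm_smult[OF CM(2)])
  then show ?thesis by simp
qed

lemma restrict_hom_subm:
  assumes CM: "maximal_CM R M" "maximal_CM R M'" and h: "h \<in> mod_hom R M M'"
  shows "restrict h (ker_g M) \<in> mod_hom R (resb (subm M)) (resb (subm M'))"
proof -
  note M = maximal_CM_module[OF CM(1)] and M' = maximal_CM_module[OF CM(2)]
  note ker = hom_ker_g[OF h M M'] and sub = subsetD[OF ker_g_subset]
  have "restrict h (carrier (resb (subm M)))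
      \<in> mod_hom R (resb (subm M)) (resb (subm M'))"
    by (rule mod_hom_restrictI[OF module_restrict_scalars[OF R.is_cring b_hom module_subm[OF CM(1)]]])
      (simp_all add: ker sub mod_hom_add[OF h] mod_hom_smult[OF h] subm_smult[OF CM(1)] subm_smult[OF CM(2)])
  then show ?thesis by simp
qed

text \<open>For \<open>x\<close> in \<open>M\<close> the element \<open>g x\<close> lies in the
  image and \<open>f x\<close> in the kernel of \<open>g\<close>, because \<open>f g = 0\<close>.
  Hence \<open>f\<close> and \<open>g\<close> both kill the difference of the two values at
  \<open>x\<close>.\<close>

lemma hom_eqI:
  assumes CM: "maximal_CM R M" "maximal_CM R M'" and h: "h \<in> mod_hom R M M'" and h': "h' \<in> mod_hom R M M'"
    and eq_im: "restrict h (im_g M) = restrict h' (im_g M)" and eq_ker: "restrict h (ker_g M) = restrict h' (ker_g M)"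
  shows "h = h'"
proof (rule mod_hom_eqI[OF h h'])
  fix x assume x: "x \<in> carrier M"
  note M = maximal_CM_module[OF CM(1)] and M' = maximal_CM_module[OF CM(2)]
  interpret M: module R M by (rule M)
  interpret M': module R M' by (rule M')
  note [simp] = mod_hom_closed[OF h] mod_hom_closed[OF h']
  let ?d = "h x \<ominus>\<^bsub>M'\<^esub> h' x"
  have act: "r \<odot>\<^bsub>M'\<^esub> ?d = h (r \<odot>\<^bsub>M\<^esub> x) \<ominus>\<^bsub>M'\<^esub> h' (r \<odot>\<^bsub>M\<^esub> x)" if "r \<in> carrier R" for r
    using that x by (simp add: mod_hom_smult[OF h] mod_hom_smult[OF h'] M'.M.minus_eq M'.smult_r_distr M'.smult_r_minus)
  have "g \<odot>\<^bsub>M\<^esub> x \<in> im_g M" unfolding im_g_def using x by (rule imageI)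
  then have "h (g \<odot>\<^bsub>M\<^esub> x) = h' (g \<odot>\<^bsub>M\<^esub> x)" using fun_cong[OF eq_im, of "g \<odot>\<^bsub>M\<^esub> x"] by simp
  then have gd: "g \<odot>\<^bsub>M'\<^esub> ?d = \<zero>\<^bsub>M'\<^esub>" unfolding act[OF g] using x g by (simp add: M'.M.minus_zero_iff)
  have "g \<odot>\<^bsub>M\<^esub> (f \<odot>\<^bsub>M\<^esub> x) = (f \<otimes>\<^bsub>R\<^esub> g) \<odot>\<^bsub>M\<^esub> x"
    using g_smult_comm[OF M f x] M.smult_assoc1[OF f g x] by simp
  then have "f \<odot>\<^bsub>M\<^esub> x \<in> ker_g M" using x f f_g_zero by (simp add: ker_g_def)
  then have "h (f \<odot>\<^bsub>M\<^esub> x) = h' (f \<odot>\<^bsub>M\<^esub> x)" using fun_cong[OF eq_ker, of "f \<odot>\<^bsub>M\<^esub> x"] by simp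
  then have fd: "f \<odot>\<^bsub>M'\<^esub> ?d = \<zero>\<^bsub>M'\<^esub>" unfolding act[OF f] using x f by (simp add: M'.M.minus_zero_iff)
  have "R.socle_free M'" using CM(2) by (simp add: R.maximal_CM_iff)
  then have "?d = \<zero>\<^bsub>M'\<^esub>" using annihilated_eq_zero[OF M' _ _ fd gd] x by simp
  then show "h x = h' x" using x by (simp add: M'.M.minus_zero_iff)
qed

text \<open>A socle element of \<open>E\<close> maps to one of \<open>N\<close>, so it comes from
  \<open>L\<close>, and there it is again a socle element.\<close>

lemma middle_maximal_CM:
  assumes N: "maximal_CM A N" and L: "maximal_CM B L"
    and e: "extension R (resa N) (resb L) E i p"
  shows "maximal_CM R E"
proof -
  interpret e: extension R "resa N" "resb L" E i p by (rule e)
  have N': "maximal_CM R (resa N)" using N maximal_CM_restrict_a[OF maximal_CM_module[OF N]] by simp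
  have L': "maximal_CM R (resb L)" using L maximal_CM_restrict_b[OF maximal_CM_module[OF L]] by simp
  have "R.socle_free E"
    unfolding R.socle_free_def
  proof (intro ballI impI)
    fix x assume x: "x \<in> carrier E" and ann: "\<forall>r\<in>R.mx. r \<odot>\<^bsub>E\<^esub> x = \<zero>\<^bsub>E\<^esub>"
    have "r \<odot>\<^bsub>resa N\<^esub> p x = \<zero>\<^bsub>N\<^esub>" if r: "r \<in> R.mx" for r
      using e.p_smult[OF R.order_ge_closed[OF r] x] bspec[OF ann r] e.p_zero by simp
    then have "p x = \<zero>\<^bsub>resa N\<^esub>"
      using N' e.p_closed[OF x] unfolding R.maximal_CM_iff R.socle_free_def by simp
    then obtain l where l: "l \<in> carrier (resb L)" "x = i l" using e.kerE x by metis
    have "r \<odot>\<^bsub>resb L\<^esub> l = \<zero>\<^bsub>resb L\<^esub>" if r: "r \<in> R.mx" for r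
      using e.i_smult[OF R.order_ge_closed[OF r] l(1)] bspec[OF ann r] l
      by (intro e.i_eq_zero e.L.smult_closed R.order_ge_closed[OF r]) simp_all
    then have "l = \<zero>\<^bsub>resb L\<^esub>"
      using L' l(1) unfolding R.maximal_CM_iff R.socle_free_def by blast
    then show "x = \<zero>\<^bsub>E\<^esub>" using l(2) e.i_zero by simp
  qed
  moreover have "finitely_generated R E"
    using e.finitely_generated_middle N' L' by (simp add: R.maximal_CM_iff)
  ultimately show ?thesis using e.E by (simp add: R.maximal_CM_iff)
qed

text \<open>On \<open>L\<close> the element \<open>g\<close> acts as zero. On \<open>N\<close> the
  element \<open>f\<close> acts as zero, so what \<open>g\<close> kills there vanishes. Therefore
  \<open>p\<close> and multiplication by \<open>g\<close> have the same kernel, and the extension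
  can be recovered from \<open>E\<close> alone.\<close>

lemma smult_g_eq_iff:
  assumes N: "maximal_CM A N" and L: "maximal_CM B L"
    and e: "extension R (resa N) (resb L) E i p"
    and x: "x \<in> carrier E" "y \<in> carrier E"
  shows "g \<odot>\<^bsub>E\<^esub> x = g \<odot>\<^bsub>E\<^esub> y \<longleftrightarrow> p x = p y"
proof -
  interpret e: extension R "resa N" "resb L" E i p by (rule e)
  have modN: "module A N" using N by (rule maximal_CM_module)
  interpret N: module A N by (rule modN)
  interpret L: module B L by (rule maximal_CM_module[OF L])
  have N': "maximal_CM R (resa N)" using N maximal_CM_restrict_a[OF modN] by simp
  have "g \<odot>\<^bsub>E\<^esub> z = \<zero>\<^bsub>E\<^esub> \<longleftrightarrow> p z = \<zero>\<^bsub>N\<^esub>" if z: "z \<in> carrier E" for z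
  proof
    assume gz: "g \<odot>\<^bsub>E\<^esub> z = \<zero>\<^bsub>E\<^esub>"
    have pz: "p z \<in> carrier (resa N)" using e.p_closed[OF z] .
    have "p z = \<zero>\<^bsub>resa N\<^esub>"
    proof (rule annihilated_eq_zero[OF e.N _ pz])
      show "R.socle_free (resa N)" using N' by (simp add: R.maximal_CM_iff)
      show "f \<odot>\<^bsub>resa N\<^esub> p z = \<zero>\<^bsub>resa N\<^esub>" using pz a_f by simp
      show "g \<odot>\<^bsub>resa N\<^esub> p z = \<zero>\<^bsub>resa N\<^esub>"
        using e.p_smult[OF g z] gz e.p_zero by simp
    qed
    then show "p z = \<zero>\<^bsub>N\<^esub>" by simp
  next
    assume "p z = \<zero>\<^bsub>N\<^esub>"
    then obtain l where l: "l \<in> carrier (resb L)" "z = i l"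
      using e.kerE[OF z] by (metis restrict_scalars_simps(2))
    have "g \<odot>\<^bsub>resb L\<^esub> l = \<zero>\<^bsub>resb L\<^esub>"
      using l(1) b_g by simp
    then show "g \<odot>\<^bsub>E\<^esub> z = \<zero>\<^bsub>E\<^esub>" using e.i_smult[OF g l(1)] l(2) e.i_zero by simp
  qed
  from this[of "x \<ominus>\<^bsub>E\<^esub> y"] have "g \<odot>\<^bsub>E\<^esub> (x \<ominus>\<^bsub>E\<^esub> y) = \<zero>\<^bsub>E\<^esub> \<longleftrightarrow> p (x \<ominus>\<^bsub>E\<^esub> y) = \<zero>\<^bsub>resa N\<^esub>"
    using x by simp
  moreover have "g \<odot>\<^bsub>E\<^esub> (x \<ominus>\<^bsub>E\<^esub> y) = g \<odot>\<^bsub>E\<^esub> x \<ominus>\<^bsub>E\<^esub> g \<odot>\<^bsub>E\<^esub> y"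
    using x g by (simp add: e.E.M.minus_eq e.E.smult_r_distr e.E.smult_r_minus)
  ultimately show ?thesis
    using x g e.E.M.minus_zero_iff[of "g \<odot>\<^bsub>E\<^esub> x" "g \<odot>\<^bsub>E\<^esub> y"]
      e.N.M.minus_zero_iff[OF e.p_closed[OF x(1)] e.p_closed[OF x(2)]] e.p_minus[OF x] by simp
qed

text \<open>Compares an arbitrary extension with the canonical one of its middle term, which gives
  essential surjectivity. On the left end the comparison is \<open>i\<close> itself, now read as a
  map into \<open>ker_g E\<close>.\<close>

lemma canonical_extension_iso:
  assumes N: "maximal_CM A N" and L: "maximal_CM B L"
    and e: "extension R (resa N) (resb L) E i p"
  obtains \<alpha> where
    "\<alpha> \<in> mod_hom R (resa N) (resa (quotm E))"
    "bij_betw \<alpha> (carrier N) (im_g E)" "\<forall>x\<in>carrier E. \<alpha> (p x) = g \<odot>\<^bsub>E\<^esub> x"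
    "i \<in> mod_hom R (resb L) (resb (subm E))"
    "bij_betw i (carrier L) (ker_g E)"
proof -
  interpret e: extension R "resa N" "resb L" E i p by (rule e)
  note CM = middle_maximal_CM[OF N L e]
  \<comment> \<open>Lift to \<open>E\<close> and multiply by \<open>g\<close>; the lift does not
    matter because \<open>p\<close> and \<open>g\<close> have the same fibres.\<close>
  define \<alpha> where "\<alpha> = (\<lambda>n\<in>carrier (resa N). g \<odot>\<^bsub>E\<^esub> (SOME x. x \<in> carrier E \<and> p x = n))"
  have ap: "\<alpha> (p x) = g \<odot>\<^bsub>E\<^esub> x" if x: "x \<in> carrier E" for x
  proof -
    let ?y = "SOME y. y \<in> carrier E \<and> p y = p x"
    have "?y \<in> carrier E \<and> p ?y = p x"
      by (rule someI[of _ x]) (use x in simp)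
    then have "g \<odot>\<^bsub>E\<^esub> ?y = g \<odot>\<^bsub>E\<^esub> x" using smult_g_eq_iff[OF N L e, of ?y x] x by blast
    then show ?thesis using e.p_closed[OF x] by (simp add: \<alpha>_def)
  qed
  have preim: thesis if "n \<in> carrier N" "\<And>x. \<lbrakk>x \<in> carrier E; n = p x\<rbrakk> \<Longrightarrow> thesis" for n thesis
    by (rule e.surjE[of n]) (use that in auto)
  have gI: "g \<odot>\<^bsub>E\<^esub> x \<in> im_g E" if "x \<in> carrier E" for x
    unfolding im_g_def using that by (rule imageI)
  have "\<alpha> \<in> mod_hom R (resa N) (resa (quotm E))"
  proof (rule mod_homI)
    show "\<alpha> \<in> carrier (resa N) \<rightarrow>\<^sub>E carrier (resa (quotm E))"
    proof (rule PiE_I)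
      fix n assume "n \<in> carrier (resa N)"
      then have "n \<in> carrier N" by simp
      then show "\<alpha> n \<in> carrier (resa (quotm E))"
        by (rule preim) (simp add: ap gI)
    qed (simp add: \<alpha>_def)
    show "\<alpha> (n \<oplus>\<^bsub>resa N\<^esub> n') = \<alpha> n \<oplus>\<^bsub>resa (quotm E)\<^esub> \<alpha> n'"
      if n: "n \<in> carrier (resa N)" and n': "n' \<in> carrier (resa N)" for n n'
    proof (rule preim[OF n[unfolded restrict_scalars_simps]], rule preim[OF n'[unfolded restrict_scalars_simps]])
      fix x y assume x: "x \<in> carrier E" "n = p x" and y: "y \<in> carrier E" "n' = p y"
      then have "n \<oplus>\<^bsub>resa N\<^esub> n' = p (x \<oplus>\<^bsub>E\<^esub> y)" using e.p_add by simp
      then have "\<alpha> (n \<oplus>\<^bsub>resa N\<^esub> n') = g \<odot>\<^bsub>E\<^esub> (x \<oplus>\<^bsub>E\<^esub> y)"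
        using ap x y by (metis e.E.M.a_closed)
      then show ?thesis using x y g ap by (simp add: e.E.smult_r_distr)
    qed
    show "\<alpha> (r \<odot>\<^bsub>resa N\<^esub> n) = r \<odot>\<^bsub>resa (quotm E)\<^esub> \<alpha> n"
      if r: "r \<in> carrier R" and n: "n \<in> carrier (resa N)" for r n
    proof (rule preim[OF n[unfolded restrict_scalars_simps]])
      fix x assume x: "x \<in> carrier E" "n = p x"
      then have "r \<odot>\<^bsub>resa N\<^esub> n = p (r \<odot>\<^bsub>E\<^esub> x)" using e.p_smult r by simp
      then have "\<alpha> (r \<odot>\<^bsub>resa N\<^esub> n) = g \<odot>\<^bsub>E\<^esub> (r \<odot>\<^bsub>E\<^esub> x)"
        using ap x r by (metis e.E.smult_closed)
      then show ?thesis using x r ap quotm_smult[OF CM r gI[OF x(1)]] g_smult_comm[OF e.E r x(1)] by simp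
    qed
  qed
  moreover have "bij_betw \<alpha> (carrier N) (im_g E)"
    unfolding bij_betw_def
  proof
    show "inj_on \<alpha> (carrier N)"
    proof (rule inj_onI)
      fix n n' assume n: "n \<in> carrier N" and n': "n' \<in> carrier N" and eq: "\<alpha> n = \<alpha> n'"
      show "n = n'"
      proof (rule preim[OF n], rule preim[OF n'])
        fix x y assume "x \<in> carrier E" "n = p x" "y \<in> carrier E" "n' = p y"
        then show ?thesis using eq ap smult_g_eq_iff[OF N L e] by metis
      qed
    qed
    have "im_g E = \<alpha> ` p ` carrier E"
      unfolding im_g_def image_image using ap by (rule image_cong[OF refl, symmetric])
    then show "\<alpha> ` carrier N = im_g E" using e.p_image by simp
  qed
  moreover have "i ` carrier L = ker_g E"
  proof -
    have "g \<odot>\<^bsub>E\<^esub> x = \<zero>\<^bsub>E\<^esub> \<longleftrightarrow> p x = \<zero>\<^bsub>N\<^esub>" if "x \<in> carrier E" for x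
      using smult_g_eq_iff[OF N L e that e.E.M.zero_closed] g e.p_zero by simp
    then show ?thesis using e.i_image by (auto simp: ker_g_def)
  qed
  moreover have "i \<in> mod_hom R (resb L) (resb (subm E))"
  proof (rule mod_homI)
    have iL: "i l \<in> ker_g E" if "l \<in> carrier L" for l
      using \<open>i ` carrier L = ker_g E\<close> that by blast
    show "i \<in> carrier (resb L) \<rightarrow>\<^sub>E carrier (resb (subm E))"
      using iL mod_hom_extensional[OF e.i_hom] by (auto simp: PiE_def)
    show "i (l \<oplus>\<^bsub>resb L\<^esub> m) = i l \<oplus>\<^bsub>resb (subm E)\<^esub> i m"
      if "l \<in> carrier (resb L)" "m \<in> carrier (resb L)" for l m
      using e.i_add[OF that] by simp
    show "i (r \<odot>\<^bsub>resb L\<^esub> l) = r \<odot>\<^bsub>resb (subm E)\<^esub> i l"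
      if "r \<in> carrier R" "l \<in> carrier (resb L)" for r l
      using e.i_smult[OF that] subm_smult[OF CM that(1) iL] that(2) by simp
  qed
  moreover have "inj_on i (carrier L)" using e.i_inj by simp
  ultimately show ?thesis using that ap by (simp add: bij_betw_def)
qed

theorem equivalent_CM_elements:
  assumes inf: "infinite (UNIV :: 'm set)"
  shows "equivalent_categories
    (CM R :: (('r, 'm) module, 'm \<Rightarrow> 'm) cat)
    (Ext_elements R A B a b :: (('s, 'm) module \<times> ('t, 'm) module \<times> ('r, 'm, 'm) ext set,
       ('m \<Rightarrow> 'm) \<times> ('m \<Rightarrow> 'm)) cat)"
proof -
  interpret Ext: ext_bimodule R A B a b "TYPE('m)"
    using R.is_cring a_hom b_hom inf by (rule ext_bimodule.intro)
  define \<xi> :: "('r, 'm) module \<Rightarrow> ('r, 'm, 'm) ext set"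
    where "\<xi> M = ext_class R (resa (quotm M)) (resb (subm M))
      (M, \<lambda>x\<in>ker_g M. x, \<lambda>x\<in>carrier M. g \<odot>\<^bsub>M\<^esub> x)" for M
  define F :: "(('r, 'm) module, 'm \<Rightarrow> 'm, ('s, 'm) module \<times> ('t, 'm) module \<times> ('r, 'm, 'm) ext set,
       ('m \<Rightarrow> 'm) \<times> ('m \<Rightarrow> 'm)) func"
    where "F = \<lparr>obj_map = (\<lambda>M. (quotm M, subm M, \<xi> M)),
      hom_map = (\<lambda>M M' h. (restrict h (im_g M), restrict h (ker_g M)))\<rparr>"
  have F_obj: "obj_map F M = (quotm M, subm M, \<xi> M)" for M by (simp add: F_def)
  have F_hom: "hom_map F M M' h = (restrict h (im_g M), restrict h (ker_g M))" for M M' h by (simp add: F_def)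
  \<comment> \<open>For canonical extensions the existence of a middle map becomes a statement about
    homomorphisms from \<open>M\<close> to \<open>M'\<close>, and such a map is the preimage that
    fullness asks for.\<close>
  have Hom: "(\<alpha>, \<beta>) \<in> Hom Ext.elements (obj_map F M) (obj_map F M') \<longleftrightarrow>
      \<alpha> \<in> mod_hom R (resa (quotm M)) (resa (quotm M')) \<and>
      \<beta> \<in> mod_hom R (resb (subm M)) (resb (subm M')) \<and>
      (\<exists>h. h \<in> mod_hom R M M' \<and> (\<forall>l\<in>ker_g M. h l = \<beta> l) \<and>
         (\<forall>x\<in>carrier M. g \<odot>\<^bsub>M'\<^esub> h x = \<alpha> (g \<odot>\<^bsub>M\<^esub> x)))"
    if CM: "maximal_CM R M" "maximal_CM R M'" for \<alpha> \<beta> M M'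
  proof -
    have "ext_mor R (resb (subm M)) \<alpha> \<beta> (M, \<lambda>x\<in>ker_g M. x, \<lambda>x\<in>carrier M. g \<odot>\<^bsub>M\<^esub> x)
        (M', \<lambda>x\<in>ker_g M'. x, \<lambda>x\<in>carrier M'. g \<odot>\<^bsub>M'\<^esub> x) h \<longleftrightarrow>
      h \<in> mod_hom R M M' \<and> (\<forall>l\<in>ker_g M. h l = \<beta> l) \<and> (\<forall>x\<in>carrier M. g \<odot>\<^bsub>M'\<^esub> h x = \<alpha> (g \<odot>\<^bsub>M\<^esub> x))"
      if \<beta>: "\<beta> \<in> mod_hom R (resb (subm M)) (resb (subm M'))" for h
      unfolding ext_mor_iff using mod_hom_closed[OF \<beta>] mod_hom_closed[of h R M M'] by auto
    then show ?thesis
      unfolding F_obj \<xi>_def Ext.Hom_iff[OF canonical_extension[OF CM(1)] canonical_extension[OF CM(2)]]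
      by blast
  qed
  have F: "is_functor (CM R) Ext.elements F"
  proof
    show "obj_map F M \<in> Obj Ext.elements" if "M \<in> Obj (CM R)" for M
    proof -
      have CM: "maximal_CM R M" using that by simp
      show ?thesis
        unfolding F_obj \<xi>_def
        by (rule Ext.ObjI[OF maximal_CM_quotm[OF CM] maximal_CM_subm[OF CM] canonical_extension[OF CM]])
    qed
    show "hom_map F M M' h \<in> Hom Ext.elements (obj_map F M) (obj_map F M')"
      if "M \<in> Obj (CM R)" "M' \<in> Obj (CM R)" "h \<in> Hom (CM R) M M'" for M M' h
    proof -
      have CM: "maximal_CM R M" "maximal_CM R M'" and h: "h \<in> mod_hom R M M'" using that by simp_all
      have "restrict h (im_g M) (g \<odot>\<^bsub>M\<^esub> x) = g \<odot>\<^bsub>M'\<^esub> h x" if "x \<in> carrier M" for x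
        using that mod_hom_smult[OF h g that] by (simp add: im_g_def)
      then show ?thesis
        unfolding F_hom Hom[OF CM] using restrict_hom_quotm[OF CM h] restrict_hom_subm[OF CM h] h
        by (intro conjI exI[of _ h]) simp_all
    qed
    show "hom_map F M M (Id (CM R) M) = Id Ext.elements (obj_map F M)" if "M \<in> Obj (CM R)" for M
    proof -
      have "module R M" using that maximal_CM_module by simp
      then have "im_g M \<inter> carrier M = im_g M" by (intro Int_absorb2 im_g_subset)
      moreover have "ker_g M \<inter> carrier M = ker_g M" by (intro Int_absorb2 ker_g_subset)
      ultimately show ?thesis by (simp add: F_hom F_obj restrict_restrict Int_commute)
    qed
    show "hom_map F M M'' (Comp (CM R) M M' M'' k h) = Comp Ext.elements (obj_map F M) (obj_map F M') (obj_map F M'')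
        (hom_map F M' M'' k) (hom_map F M M' h)"
      if "M \<in> Obj (CM R)" "M' \<in> Obj (CM R)" "M'' \<in> Obj (CM R)" "h \<in> Hom (CM R) M M'"
        "k \<in> Hom (CM R) M' M''" for M M' M'' h k
    proof -
      have M: "module R M" "module R M'" and h: "h \<in> mod_hom R M M'" using that maximal_CM_module by auto
      have "restrict (compose (carrier M) k h) (im_g M) = compose (im_g M) (restrict k (im_g M')) (restrict h (im_g M))"
      proof (rule extensionalityI[OF restrict_extensional compose_extensional])
        fix z assume z: "z \<in> im_g M"
        then show "restrict (compose (carrier M) k h) (im_g M) z =
            compose (im_g M) (restrict k (im_g M')) (restrict h (im_g M)) z"
          using hom_im_g[OF h M(1) z] subsetD[OF im_g_subset[OF M(1)] z] by (simp add: compose_eq)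
      qed
      moreover have "restrict (compose (carrier M) k h) (ker_g M) = compose (ker_g M) (restrict k (ker_g M')) (restrict h (ker_g M))"
      proof (rule extensionalityI[OF restrict_extensional compose_extensional])
        fix z assume z: "z \<in> ker_g M"
        then show "restrict (compose (carrier M) k h) (ker_g M) z =
            compose (ker_g M) (restrict k (ker_g M')) (restrict h (ker_g M)) z"
          using hom_ker_g[OF h M z] subsetD[OF ker_g_subset z] by (simp add: compose_eq)
      qed
      ultimately show ?thesis by (simp add: F_hom F_obj)
    qed
  qed
  show ?thesis
  proof (rule fully_faithful_ess_surj_equivalence[OF category_CM Ext.category_elements F])
    show "h = h'" if "M \<in> Obj (CM R)" "M' \<in> Obj (CM R)" "h \<in> Hom (CM R) M M'" "h' \<in> Hom (CM R) M M'"
      "hom_map F M M' h = hom_map F M M' h'" for M M' h h'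
      using hom_eqI[of M M' h h'] that by (simp add: F_hom)
    show "\<exists>h\<in>Hom (CM R) M M'. hom_map F M M' h = k"
      if objs: "M \<in> Obj (CM R)" "M' \<in> Obj (CM R)"
        and kH: "k \<in> Hom Ext.elements (obj_map F M) (obj_map F M')" for M M' k
    proof -
      have CM: "maximal_CM R M" "maximal_CM R M'" using objs by simp_all
      note M = maximal_CM_module[OF CM(1)]
      obtain \<alpha> \<beta> where k: "k = (\<alpha>, \<beta>)" by (cases k)
      obtain h where \<alpha>: "\<alpha> \<in> mod_hom R (resa (quotm M)) (resa (quotm M'))"
        and \<beta>: "\<beta> \<in> mod_hom R (resb (subm M)) (resb (subm M'))"
        and h: "h \<in> mod_hom R M M'" "\<forall>l\<in>ker_g M. h l = \<beta> l"
          "\<forall>x\<in>carrier M. g \<odot>\<^bsub>M'\<^esub> h x = \<alpha> (g \<odot>\<^bsub>M\<^esub> x)"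
        using kH unfolding k Hom[OF CM] by blast
      \<comment> \<open>An element of the image is some \<open>g x\<close>, and
        \<open>h (g x) = g (h x) = \<alpha> (g x)\<close>.\<close>
      have "restrict h (im_g M) = \<alpha>"
      proof (rule extensionalityI[OF restrict_extensional])
        show "\<alpha> \<in> extensional (im_g M)" using mod_hom_extensional[OF \<alpha>] by simp
        fix z assume z: "z \<in> im_g M"
        then obtain x where x: "x \<in> carrier M" "z = g \<odot>\<^bsub>M\<^esub> x" unfolding im_g_def by (rule imageE)
        then show "restrict h (im_g M) z = \<alpha> z" using z h(3) mod_hom_smult[OF h(1) g x(1)] by simp
      qed
      moreover have "restrict h (ker_g M) = \<beta>"
      proof (rule extensionalityI[OF restrict_extensional])
        show "\<beta> \<in> extensional (ker_g M)" using mod_hom_extensional[OF \<beta>] by simp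
      qed (use h(2) in simp)
      ultimately show ?thesis using h(1) by (intro bexI[of _ h]) (simp_all add: F_hom k)
    qed
    show "\<exists>M\<in>Obj (CM R). \<exists>k. is_iso Ext.elements (obj_map F M) V k" if V: "V \<in> Obj Ext.elements" for V
    proof -
      obtain N L and E :: "('r, 'm) module" and i p where
        V: "V = (N, L, ext_class R (resa N) (resb L) (E, i, p))"
        and N: "maximal_CM A N" and L: "maximal_CM B L"
        and e: "extension R (resa N) (resb L) E i p"
        using V by (rule Ext.ObjE)
      interpret e: extension R "resa N" "resb L" E i p by (rule e)
      note CM = middle_maximal_CM[OF N L e]
      note ce = canonical_extension[OF CM]
      interpret ce: extension R "resa (quotm E)" "resb (subm E)" E
        "\<lambda>x\<in>ker_g E. x" "\<lambda>x\<in>carrier E. g \<odot>\<^bsub>E\<^esub> x" by (rule ce)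
      obtain \<alpha> where \<alpha>: "\<alpha> \<in> mod_hom R (resa N) (resa (quotm E))"
        "bij_betw \<alpha> (carrier N) (im_g E)" "\<forall>x\<in>carrier E. \<alpha> (p x) = g \<odot>\<^bsub>E\<^esub> x"
        and i: "i \<in> mod_hom R (resb L) (resb (subm E))"
        "bij_betw i (carrier L) (ker_g E)"
        by (rule canonical_extension_iso[OF N L e])
      define \<alpha>' where "\<alpha>' = restrict (inv_into (carrier N) \<alpha>) (im_g E)"
      define i' where "i' = restrict (inv_into (carrier L) i) (ker_g E)"
      have \<alpha>': "\<alpha>' \<in> mod_hom R (resa (quotm E)) (resa N)"
        using mod_hom_inv_into[OF e.N ce.N \<alpha>(1)] \<alpha>(2) by (simp add: \<alpha>'_def)
      have i': "i' \<in> mod_hom R (resb (subm E)) (resb L)"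
        using mod_hom_inv_into[OF e.L ce.L i(1)] i(2) by (simp add: i'_def)
      have inv_\<alpha>: "compose (carrier N) \<alpha>' \<alpha> = (\<lambda>x\<in>carrier N. x)" "compose (im_g E) \<alpha> \<alpha>' = (\<lambda>x\<in>im_g E. x)"
        using compose_inv_into_id[OF \<alpha>(2)] compose_id_inv_into[OF bij_betw_imp_surj_on[OF \<alpha>(2)]]
        by (simp_all add: \<alpha>'_def)
      have inv_i: "compose (carrier L) i' i = (\<lambda>x\<in>carrier L. x)" "compose (ker_g E) i i' = (\<lambda>x\<in>ker_g E. x)"
        using compose_inv_into_id[OF i(2)] compose_id_inv_into[OF bij_betw_imp_surj_on[OF i(2)]]
        by (simp_all add: i'_def)
      have ii': "i (i' x) = x" if "x \<in> ker_g E" for x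
        using fun_cong[OF inv_i(2), of x] that by (simp add: compose_eq)
      have \<alpha>'\<alpha>: "\<alpha>' (\<alpha> x) = x" if "x \<in> carrier N" for x
        using fun_cong[OF inv_\<alpha>(1), of x] that by (simp add: compose_eq)
      have i_ker: "i l \<in> ker_g E" if "l \<in> carrier L" for l
        using that bij_betw_imp_surj_on[OF i(2)] by blast
      have pN: "p x \<in> carrier N" if "x \<in> carrier E" for x using e.p_closed[OF that] by simp
      \<comment> \<open>Both extensions have middle term \<open>E\<close>, and its identity serves
        as middle map in either direction.\<close>
      have "ext_mor R (resb (subm E)) \<alpha>' i' (E, \<lambda>x\<in>ker_g E. x, \<lambda>x\<in>carrier E. g \<odot>\<^bsub>E\<^esub> x)
          (E, i, p) (\<lambda>x\<in>carrier E. x)"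
        unfolding ext_mor_iff
      proof (intro conjI ballI)
        fix x assume x: "x \<in> carrier E"
        have "\<alpha>' (g \<odot>\<^bsub>E\<^esub> x) = p x" using \<alpha>(3) \<alpha>'\<alpha>[OF pN[OF x]] x by simp
        then show "p ((\<lambda>x\<in>carrier E. x) x) = \<alpha>' ((\<lambda>x\<in>carrier E. g \<odot>\<^bsub>E\<^esub> x) x)" using x by simp
      next
        fix x assume "x \<in> carrier (resb (subm E))"
        then show "(\<lambda>x\<in>carrier E. x) ((\<lambda>x\<in>ker_g E. x) x) = i (i' x)"
          using ii'[of x] subsetD[OF ker_g_subset, of x E] by simp
      qed (rule mod_hom_id[OF e.E])
      then have 1: "(\<alpha>', i') \<in> Hom Ext.elements (obj_map F E) V"
        unfolding V F_obj \<xi>_def Ext.Hom_iff[OF ce e] using \<alpha>' i' by blast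
      have "ext_mor R (resb L) \<alpha> i (E, i, p)
          (E, \<lambda>x\<in>ker_g E. x, \<lambda>x\<in>carrier E. g \<odot>\<^bsub>E\<^esub> x) (\<lambda>x\<in>carrier E. x)"
        unfolding ext_mor_iff
        using \<alpha>(3) i_ker mod_hom_id[OF e.E] subsetD[OF ker_g_subset i_ker] by simp
      then have 2: "(\<alpha>, i) \<in> Hom Ext.elements V (obj_map F E)"
        unfolding V F_obj \<xi>_def Ext.Hom_iff[OF e ce] using \<alpha> i by blast
      have "is_iso Ext.elements (obj_map F E) V (\<alpha>', i')"
        unfolding is_iso_def using 1
      proof (intro conjI bexI[OF _ 2])
        show "Comp Ext.elements (obj_map F E) V (obj_map F E) (\<alpha>, i) (\<alpha>', i') = Id Ext.elements (obj_map F E)"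
          by (simp add: F_obj inv_\<alpha> inv_i)
        show "Comp Ext.elements V (obj_map F E) V (\<alpha>', i') (\<alpha>, i) = Id Ext.elements V"
          by (simp add: V inv_\<alpha> inv_i)
      qed
      then show ?thesis using CM by (intro bexI[of _ E]) auto
    qed
  qed
qed

end

section \<open>Restricting a power series to a line\<close>

lemma subst_line_nth:
  "fps_nth (subst_line a b f) n = (\<Sum>j\<le>n. fps_nth (fps_nth f j) (n - j) * a ^ (n - j) * b ^ j)"
  by (simp add: subst_line_def)

lemma subst_line_add: "subst_line a b (f + g) = subst_line a b f + subst_line a b g"
  by (rule fps_ext) (simp add: subst_line_nth sum.distrib algebra_simps)

lemma subst_line_diff: "subst_line a b (f - g) = subst_line a b f - subst_line a b g"
  by (rule fps_ext) (simp add: subst_line_nth sum_subtractf algebra_simps)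

lemma subst_line_zero [simp]: "subst_line a b 0 = 0"
  by (rule fps_ext) (simp add: subst_line_nth)

lemma subst_line_nth_0 [simp]: "fps_nth (subst_line a b f) 0 = fps_nth (fps_nth f 0) 0"
  by (simp add: subst_line_nth)

lemma subst_line_one [simp]: "subst_line a b 1 = 1"
proof (rule fps_ext)
  fix n
  have "(\<Sum>j\<le>n. fps_nth (fps_nth (1 :: 'a fps fps) j) (n - j) * a ^ (n - j) * b ^ j) =
      (\<Sum>j\<le>n. if j = 0 then (if n = 0 then 1 else 0) else 0)"
    by (rule sum.cong) (auto simp: fps_one_nth)
  then show "fps_nth (subst_line a b 1) n = fps_nth 1 n"
    unfolding subst_line_nth by (simp add: fps_one_nth)
qed

lemma subst_line_const_X: "subst_line a b (fps_const h) = Abs_fps (\<lambda>n. fps_nth h n * a ^ n)"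
proof (rule fps_ext)
  fix n
  have "(\<Sum>j\<le>n. fps_nth (fps_nth (fps_const h) j) (n - j) * a ^ (n - j) * b ^ j) =
      (\<Sum>j\<le>n. if j = 0 then fps_nth h n * a ^ n else 0)"
    by (rule sum.cong) auto
  then show "fps_nth (subst_line a b (fps_const h)) n = fps_nth (Abs_fps (\<lambda>n. fps_nth h n * a ^ n)) n"
    unfolding subst_line_nth by simp
qed

lemma subst_line_const_Y:
  "subst_line a b (Abs_fps (\<lambda>n. fps_const (h n))) = Abs_fps (\<lambda>n. h n * b ^ n)"
proof (rule fps_ext)
  fix n
  have "(\<Sum>j\<le>n. fps_nth (fps_nth (Abs_fps (\<lambda>n. fps_const (h n))) j) (n - j) * a ^ (n - j) * b ^ j) =
      (\<Sum>j\<le>n. if j = n then h n * b ^ n else 0)"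
    by (rule sum.cong) auto
  then show "fps_nth (subst_line a b (Abs_fps (\<lambda>n. fps_const (h n)))) n = fps_nth (Abs_fps (\<lambda>n. h n * b ^ n)) n"
    unfolding subst_line_nth by simp
qed

text \<open>Both sides sum over pairs of monomials of total degree \<open>n\<close>. The left side
  groups them by the total exponent of Y, the right side by the degree of the monomial from
  \<open>f\<close>.\<close>

lemma subst_line_mult: "subst_line a b (f * g) = subst_line a b f * subst_line a b g"
proof (rule fps_ext)
  fix n
  \<comment> \<open>The contribution of the monomial \<open>X^i Y^j\<close> of \<open>f\<close> and
    \<open>X^k Y^l\<close> of \<open>g\<close>.\<close>
  define T where "T j i l k = fps_nth (fps_nth f j) i * fps_nth (fps_nth g l) k * a ^ (i + k) * b ^ (j + l)"
    for j i l k
  have "fps_nth (subst_line a b (f * g)) n =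
      (\<Sum>j\<le>n. \<Sum>k\<le>j. \<Sum>l\<le>n - j. T k l (j - k) (n - j - l))"
    unfolding subst_line_nth
  proof (rule sum.cong[OF refl])
    fix j assume "j \<in> {..n}"
    have "fps_nth (fps_nth (f * g) j) (n - j) * a ^ (n - j) * b ^ j =
       (\<Sum>k\<le>j. \<Sum>l\<le>n - j. fps_nth (fps_nth f k) l * fps_nth (fps_nth g (j - k)) (n - j - l) * a ^ (n - j) * b ^ j)"
      by (simp add: fps_mult_nth fps_sum_nth sum_distrib_right atLeast0AtMost)
    also have "\<dots> = (\<Sum>k\<le>j. \<Sum>l\<le>n - j. T k l (j - k) (n - j - l))"
    proof (intro sum.cong refl)
      fix k l assume "k \<in> {..j}" "l \<in> {..n - j}"
      then have "l + (n - j - l) = n - j" "k + (j - k) = j" by auto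
      then show "fps_nth (fps_nth f k) l * fps_nth (fps_nth g (j - k)) (n - j - l) * a ^ (n - j) * b ^ j =
          T k l (j - k) (n - j - l)"
        by (simp only: T_def)
    qed
    finally show "fps_nth (fps_nth (f * g) j) (n - j) * a ^ (n - j) * b ^ j =
       (\<Sum>k\<le>j. \<Sum>l\<le>n - j. T k l (j - k) (n - j - l))" .
  qed
  also have "\<dots> = (\<Sum>(j, k, l)\<in>(SIGMA j:{..n}. {..j} \<times> {..n - j}). T k l (j - k) (n - j - l))"
    by (simp add: sum.Sigma sum.cartesian_product case_prod_unfold)
  \<comment> \<open>Before, (j, k, l) are the total Y-exponent and the Y- and X-exponents in
    \<open>f\<close>; after, (m, k, l) are the degree in \<open>f\<close> and the Y-exponents in
    \<open>f\<close> and \<open>g\<close>.\<close>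
  also have "\<dots> = (\<Sum>(m, k, l)\<in>(SIGMA m:{..n}. {..m} \<times> {..n - m}). T k (m - k) l (n - m - l))"
    by (rule sum.reindex_bij_witness[of _ "\<lambda>(m, k, l). (k + l, k, m - k)" "\<lambda>(j, k, l). (k + l, k, j - k)"])
      (auto simp: add.commute)
  also have "\<dots> = (\<Sum>m\<le>n. \<Sum>k\<le>m. \<Sum>l\<le>n - m. T k (m - k) l (n - m - l))"
    by (simp add: sum.Sigma sum.cartesian_product case_prod_unfold)
  also have "\<dots> = (\<Sum>m\<le>n. (\<Sum>k\<le>m. fps_nth (fps_nth f k) (m - k) * a ^ (m - k) * b ^ k) *
      (\<Sum>l\<le>n - m. fps_nth (fps_nth g l) (n - m - l) * a ^ (n - m - l) * b ^ l))"
    unfolding sum_product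
  proof (intro sum.cong refl)
    fix m k l assume "m \<in> {..n}" "k \<in> {..m}" "l \<in> {..n - m}"
    show "T k (m - k) l (n - m - l) = fps_nth (fps_nth f k) (m - k) * a ^ (m - k) * b ^ k *
        (fps_nth (fps_nth g l) (n - m - l) * a ^ (n - m - l) * b ^ l)"
      unfolding T_def power_add by (simp only: mult_ac)
  qed
  also have "\<dots> = fps_nth (subst_line a b f * subst_line a b g) n"
    by (simp add: fps_mult_nth subst_line_nth atLeast0AtMost)
  finally show "fps_nth (subst_line a b (f * g)) n = fps_nth (subst_line a b f * subst_line a b g) n" .
qed

lemma subst_line_var_X [simp]: "subst_line a b var_X = fps_const a * fps_X"
  unfolding var_X_def subst_line_const_X by (rule fps_ext) (auto simp: le_Suc_eq)

lemma subst_line_var_Y [simp]: "subst_line a b var_Y = fps_const b * fps_X"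
proof -
  have Y: "(fps_X :: 'a fps fps) = Abs_fps (\<lambda>n. fps_const (if n = 1 then 1 else 0))"
    by (rule fps_ext) simp
  then have "subst_line a b var_Y = Abs_fps (\<lambda>n. (if n = 1 then 1 else 0) * b ^ n)"
    unfolding var_Y_def by (subst Y) (rule subst_line_const_Y)
  then show ?thesis by (auto simp: fps_eq_iff le_Suc_eq)
qed

lemma subst_line_scalar [simp]: "subst_line a b (fps_const (fps_const u)) = fps_const u"
  unfolding subst_line_const_X by (rule fps_ext) simp

lemma subst_line_surj:
  assumes "a = 1 \<or> b = 1" shows "\<exists>f. subst_line a b f = h"
  using assms
proof
  assume "a = 1"
  then show ?thesis by (intro exI[of _ "fps_const h"]) (simp add: subst_line_const_X fps_eq_iff)
next
  assume "b = 1"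
  then show ?thesis
    by (intro exI[of _ "Abs_fps (\<lambda>n. fps_const (fps_nth h n))"]) (simp add: subst_line_const_Y fps_eq_iff)
qed

lemma var_Y_dvd:
  assumes "subst_line 1 0 f = 0" shows "var_Y dvd f"
proof -
  have "fps_nth (fps_nth f 0) n = 0" for n
  proof -
    have "(\<Sum>j\<le>n. fps_nth (fps_nth f j) (n - j) * 1 ^ (n - j) * 0 ^ j) =
        (\<Sum>j\<le>n. if j = 0 then fps_nth (fps_nth f 0) n else 0)"
      by (rule sum.cong) auto
    then show ?thesis using arg_cong[OF assms, of "\<lambda>h. fps_nth h n"] unfolding subst_line_nth by simp
  qed
  then have "fps_nth f 0 = 0" by (simp add: fps_eq_iff)
  then have "f = fps_X * Abs_fps (\<lambda>n. fps_nth f (Suc n))"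
    by (intro fps_ext) (simp add: fps_X_mult_nth)
  then show ?thesis unfolding var_Y_def by (rule dvdI)
qed

text \<open>Comparing coefficients in f = (X - a Y) q determines q recursively, and one condition
  remains for each degree; these conditions are the vanishing of f on the line.\<close>

lemma linear_form_dvd:
  fixes f :: "'k :: field fps fps"
  assumes "subst_line a 1 f = 0"
  shows "var_X - fps_const (fps_const a) * var_Y dvd f"
proof
  \<comment> \<open>Solves the recursion that the coefficient of \<open>X^(i+1) Y^j\<close> imposes:
    it equals that of \<open>X^i Y^j\<close> in q minus \<open>a\<close> times that of
    \<open>X^(i+1) Y^(j-1)\<close> in q.\<close>
  define q where "q = Abs_fps (\<lambda>j. Abs_fps (\<lambda>i. \<Sum>l\<le>j. a ^ (j - l) * fps_nth (fps_nth f l) (i + 1 + j - l)))"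
  have q: "fps_nth (fps_nth q j) i = (\<Sum>l\<le>j. a ^ (j - l) * fps_nth (fps_nth f l) (i + 1 + j - l))" for i j
    by (simp add: q_def)
  show "f = (var_X - fps_const (fps_const a) * var_Y) * q"
  proof (rule fps_ext, rule fps_ext)
    fix j i
    have aq: "a * fps_nth (fps_nth q (j - 1)) i = (\<Sum>l<j. a ^ (j - l) * fps_nth (fps_nth f l) (i + j - l))"
      if "j > 0"
    proof -
      have "{..j - 1} = {..<j}" using that by auto
      show ?thesis
        unfolding q sum_distrib_left \<open>{..j - 1} = {..<j}\<close>
      proof (rule sum.cong[OF refl])
        fix l assume "l \<in> {..<j}"
        then have "j - l = Suc (j - 1 - l)" "i + 1 + (j - 1) - l = i + j - l" by auto
        then show "a * (a ^ (j - 1 - l) * fps_nth (fps_nth f l) (i + 1 + (j - 1) - l)) =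
            a ^ (j - l) * fps_nth (fps_nth f l) (i + j - l)"
          by (simp add: mult.assoc)
      qed
    qed
    have "fps_nth (fps_nth ((var_X - fps_const (fps_const a) * var_Y) * q) j) i =
       (if i = 0 then 0 else fps_nth (fps_nth q j) (i - 1)) - (if j = 0 then 0 else a * fps_nth (fps_nth q (j - 1)) i)"
      by (simp add: left_diff_distrib var_X_def var_Y_def mult.assoc fps_X_mult_nth)
    also have "\<dots> = fps_nth (fps_nth f j) i"
    proof (cases "i = 0")
      \<comment> \<open>Only here, at the coefficients free of X, does the vanishing on the line
        enter.\<close>
      case True
      have "(\<Sum>l\<le>j. fps_nth (fps_nth f l) (j - l) * a ^ (j - l)) = 0"
        using arg_cong[OF assms, of "\<lambda>h. fps_nth h j"] unfolding subst_line_nth by simp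
      then have "fps_nth (fps_nth f j) 0 = - (\<Sum>l<j. a ^ (j - l) * fps_nth (fps_nth f l) (j - l))"
        by (simp add: lessThan_Suc_atMost[symmetric] mult.commute eq_neg_iff_add_eq_0 add.commute)
      then show ?thesis using True aq by (cases "j = 0") simp_all
    next
      case False
      have "fps_nth (fps_nth q j) (i - 1) = (\<Sum>l\<le>j. a ^ (j - l) * fps_nth (fps_nth f l) (i + j - l))"
        using False by (simp add: q)
      also have "\<dots> = (\<Sum>l<j. a ^ (j - l) * fps_nth (fps_nth f l) (i + j - l)) + fps_nth (fps_nth f j) i"
        by (simp add: lessThan_Suc_atMost[symmetric])
      finally show ?thesis using False aq by (cases "j = 0") simp_all
    qed
    finally show "fps_nth (fps_nth f j) i = fps_nth (fps_nth ((var_X - fps_const (fps_const a) * var_Y) * q) j) i" ..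
  qed
qed

text \<open>The linear forms are split off one by one. On each new line the forms already removed
  restrict to nonzero multiples of t, because the four lines are distinct.\<close>

lemma F_poly_dvd:
  fixes lam :: "'k :: field"
  assumes lam: "lam \<noteq> 0" "lam \<noteq> 1" and f: "branches lam f = (0, 0, 0, 0)"
  shows "F_poly lam dvd f"
proof -
  have s: "subst_line 1 0 f = 0" "subst_line 0 1 f = 0" "subst_line 1 1 f = 0" "subst_line lam 1 f = 0"
    using f by (simp_all add: branches_def)
  obtain f1 where f1: "f = var_Y * f1" using var_Y_dvd[OF s(1)] by (elim dvdE)
  have "subst_line 0 1 f1 = 0" using s(2) by (simp add: f1 subst_line_mult)
  from linear_form_dvd[OF this] obtain f2 where f2: "f1 = var_X * f2" by (auto elim!: dvdE)
  have "subst_line 1 1 f2 = 0" using s(3) by (simp add: f1 f2 subst_line_mult)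
  from linear_form_dvd[OF this] obtain f3 where f3: "f2 = (var_X - var_Y) * f3" by (auto elim!: dvdE)
  have "subst_line lam 1 f3 = 0"
    using s(4) lam by (simp add: f1 f2 f3 subst_line_mult subst_line_diff left_diff_distrib[symmetric])
  from linear_form_dvd[OF this] obtain f4 where f4: "f3 = (var_X - fps_const (fps_const lam) * var_Y) * f4"
    by (elim dvdE)
  have "f = F_poly lam * f4" by (simp add: f1 f2 f3 f4 F_poly_def mult_ac)
  then show ?thesis by (rule dvdI)
qed

section \<open>The ring of four lines\<close>

lemma ring_of_type_algebra_simps [simp]:
  "carrier ring_of_type_algebra = UNIV" "x \<otimes>\<^bsub>ring_of_type_algebra\<^esub> y = x * y"
  "x \<oplus>\<^bsub>ring_of_type_algebra\<^esub> y = x + y" "\<one>\<^bsub>ring_of_type_algebra\<^esub> = 1" "\<zero>\<^bsub>ring_of_type_algebra\<^esub> = 0"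
  by (simp_all add: ring_of_type_algebra_def)

section \<open>Projections onto two branches\<close>

context branched_ring
begin

definition pair_proj :: "nat \<Rightarrow> nat \<Rightarrow> 'a \<Rightarrow> 'k fps \<times> 'k fps" where
  "pair_proj i j r = (b i r, b j r)"

definition pair_ring :: "nat \<Rightarrow> nat \<Rightarrow> ('k fps \<times> 'k fps) ring" where
  "pair_ring i j = (RDirProd ring_of_type_algebra ring_of_type_algebra)\<lparr>carrier := pair_proj i j ` carrier A\<rparr>"

lemma pair_ring_simps [simp]:
  "carrier (pair_ring i j) = pair_proj i j ` carrier A"
  "p \<otimes>\<^bsub>pair_ring i j\<^esub> q = (fst p * fst q, snd p * snd q)"
  "p \<oplus>\<^bsub>pair_ring i j\<^esub> q = (fst p + fst q, snd p + snd q)"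
  "\<one>\<^bsub>pair_ring i j\<^esub> = (1, 1)" "\<zero>\<^bsub>pair_ring i j\<^esub> = (0, 0)"
  by (auto simp: pair_ring_def RDirProd_def DirProd_def monoid.defs split: prod.splits)

lemma pair_projI: "r \<in> carrier A \<Longrightarrow> p = pair_proj i j r \<Longrightarrow> p \<in> pair_proj i j ` carrier A"
  by (rule image_eqI)

lemma cring_pair_ring:
  assumes i: "i \<in> I" and j: "j \<in> I"
  shows "cring (pair_ring i j)"
proof (rule cringI)
  note simps = pair_proj_def b_simps i j
  show "abelian_group (pair_ring i j)"
  proof (rule abelian_groupI)
    show "\<exists>q\<in>carrier (pair_ring i j). q \<oplus>\<^bsub>pair_ring i j\<^esub> p = \<zero>\<^bsub>pair_ring i j\<^esub>"
      if p: "p \<in> carrier (pair_ring i j)" for p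
    proof -
      obtain r where r: "r \<in> carrier A" "p = pair_proj i j r" using p by auto
      have "pair_proj i j (\<ominus> r) \<oplus>\<^bsub>pair_ring i j\<^esub> p = \<zero>\<^bsub>pair_ring i j\<^esub>" using r by (simp add: simps)
      then show ?thesis
        by (rule bexI) (use r(1) in \<open>simp only: pair_ring_simps imageI a_inv_closed\<close>)
    qed
    show "p \<oplus>\<^bsub>pair_ring i j\<^esub> q \<in> carrier (pair_ring i j)"
      if p: "p \<in> carrier (pair_ring i j)" and q: "q \<in> carrier (pair_ring i j)" for p q
    proof -
      obtain r s where "r \<in> carrier A" "p = pair_proj i j r" "s \<in> carrier A" "q = pair_proj i j s" using p q by auto
      then show ?thesis unfolding pair_ring_simps by (intro pair_projI[of "r \<oplus> s"]) (simp_all add: simps)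
    qed
    show "\<zero>\<^bsub>pair_ring i j\<^esub> \<in> carrier (pair_ring i j)"
      unfolding pair_ring_simps by (rule pair_projI[of \<zero>]) (simp_all add: simps)
  qed (simp_all add: algebra_simps prod_eq_iff)
  show "comm_monoid (pair_ring i j)"
  proof (rule comm_monoidI)
    show "p \<otimes>\<^bsub>pair_ring i j\<^esub> q \<in> carrier (pair_ring i j)"
      if p: "p \<in> carrier (pair_ring i j)" and q: "q \<in> carrier (pair_ring i j)" for p q
    proof -
      obtain r s where "r \<in> carrier A" "p = pair_proj i j r" "s \<in> carrier A" "q = pair_proj i j s" using p q by auto
      then show ?thesis unfolding pair_ring_simps by (intro pair_projI[of "r \<otimes> s"]) (simp_all add: simps)
    qed
    show "\<one>\<^bsub>pair_ring i j\<^esub> \<in> carrier (pair_ring i j)"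
      unfolding pair_ring_simps by (rule pair_projI[of \<one>]) (simp_all add: simps)
  qed (simp_all add: algebra_simps prod_eq_iff)
qed (simp add: algebra_simps)

lemma pair_proj_hom:
  assumes "i \<in> I" "j \<in> I"
  shows "pair_proj i j \<in> ring_hom A (pair_ring i j)"
  by (rule ring_hom_memI) (simp_all add: pair_proj_def b_simps assms)

text \<open>All properties are inherited from \<open>A\<close>, with the same conductor exponent;
  joint injectivity of the projections holds by construction.\<close>

lemma branched_pair_ring:
  assumes i: "i \<in> I" and j: "j \<in> I" and ij: "i \<noteq> j"
  shows "branched_ring (pair_ring i j) {0, 1} (\<lambda>k p. if k = 0 then fst p else snd p) c"
proof (intro branched_ring.intro cring_pair_ring[OF i j] branched_ring_axioms.intro)
  show "\<exists>p\<in>carrier (pair_ring i j). (if k = 0 then fst p else snd p) = h" if "k \<in> {0, 1}" for k and h :: "'k fps"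
  proof -
    have "\<exists>r\<in>carrier A. b (if k = 0 then i else j) r = h"
      using b_surj[OF i, of h] b_surj[OF j, of h] by simp
    then obtain r where "r \<in> carrier A" "b (if k = 0 then i else j) r = h" by blast
    then show ?thesis using that by (intro bexI[of _ "pair_proj i j r"]) (auto simp: pair_proj_def)
  qed
  show "\<exists>p\<in>carrier (pair_ring i j). \<forall>k\<in>{0, 1}. (if k = 0 then fst p else snd p) = g k"
    if g: "\<And>k. k \<in> {0, 1} \<Longrightarrow> fps_X ^ c dvd g k" for g :: "nat \<Rightarrow> 'k fps"
  proof -
    \<comment> \<open>The values on the other branches only have to satisfy the divisibility, so
      \<open>g 1\<close> is used there too.\<close>
    have "fps_X ^ c dvd (if m = i then g 0 else g 1)" for m using g[of 0] g[of 1] by simp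
    then obtain r where r: "r \<in> carrier A" "\<forall>m\<in>I. b m r = (if m = i then g 0 else g 1)"
      using conductor[of "\<lambda>m. if m = i then g 0 else g 1"] by blast
    have "\<forall>k\<in>{0, 1}. (if k = 0 then fst (pair_proj i j r) else snd (pair_proj i j r)) = g k"
      using r i j ij by (auto simp: pair_proj_def)
    then show ?thesis by (rule bexI) (use r(1) in simp)
  qed
  show "p = q" if "\<And>k :: nat. k \<in> {0, 1} \<Longrightarrow> (if k = 0 then fst p else snd p) = (if k = 0 then fst q else snd q)"
    for p q :: "'k fps \<times> 'k fps"
    using that[of 0] that[of 1] by (simp add: prod_eq_iff)
qed (auto simp: pair_proj_def b_const[OF i j] prod_eq_iff split: if_splits)

lemma splitting_pair_rings:
  assumes I: "I = {i, j, k, l}" and dist: "distinct [i, j, k, l]"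
  shows "\<exists>f g. splitting A I b c
    (pair_ring i j) {0, 1} (\<lambda>k p. if k = 0 then fst p else snd p) c
    (pair_ring k l) {0, 1} (\<lambda>k p. if k = 0 then fst p else snd p) c
    (pair_proj i j) (pair_proj k l) f g (c + c)"
proof -
  have mem: "i \<in> I" "j \<in> I" "k \<in> I" "l \<in> I" by (simp_all add: I)
  have "\<exists>x\<in>carrier A. \<forall>m\<in>I. b m x = (if m \<in> S then 0 else fps_X ^ c)" for S
    by (rule conductor) simp
  \<comment> \<open>Both elements come from the conductor: \<open>f\<close> vanishes on the first
    two branches, \<open>g\<close> on the last two, and elsewhere each is t^c.\<close>
  then obtain f g where f: "f \<in> carrier A" "\<And>m. m \<in> I \<Longrightarrow> b m f = (if m \<in> {i, j} then 0 else fps_X ^ c)"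
    and g: "g \<in> carrier A" "\<And>m. m \<in> I \<Longrightarrow> b m g = (if m \<in> {k, l} then 0 else fps_X ^ c)" by metis
  interpret P: branched_ring "pair_ring i j" "{0, 1}" "\<lambda>k p. if k = 0 then fst p else snd p" c
    using mem dist by (intro branched_pair_ring) auto
  interpret Q: branched_ring "pair_ring k l" "{0, 1}" "\<lambda>k p. if k = 0 then fst p else snd p" c
    using mem dist by (intro branched_pair_ring) auto
  have "splitting A I b c
    (pair_ring i j) {0, 1} (\<lambda>k p. if k = 0 then fst p else snd p) c
    (pair_ring k l) {0, 1} (\<lambda>k p. if k = 0 then fst p else snd p) c
    (pair_proj i j) (pair_proj k l) f g (c + c)"
  proof (intro splitting.intro splitting_axioms.intro P.branched_ring_axioms Q.branched_ring_axioms
      branched_ring_axioms pair_proj_hom mem)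
    show "pair_proj i j r \<in> P.mx \<longleftrightarrow> r \<in> mx" if "r \<in> carrier A" for r
      using that P.mx_iff[of 0] mx_iff[OF mem(1)] by (simp add: pair_proj_def)
    show "pair_proj k l r \<in> Q.mx \<longleftrightarrow> r \<in> mx" if "r \<in> carrier A" for r
      using that Q.mx_iff[of 0] mx_iff[OF mem(3)] by (simp add: pair_proj_def)
    show "r \<otimes> g = \<zero>" if "r \<in> carrier A" "pair_proj i j r = \<zero>\<^bsub>pair_ring i j\<^esub>" for r
      by (rule b_eqI) (use that g in \<open>auto simp: pair_proj_def b_simps I\<close>)
    show "r \<otimes> f = \<zero>" if "r \<in> carrier A" "pair_proj k l r = \<zero>\<^bsub>pair_ring k l\<^esub>" for r
      by (rule b_eqI) (use that f in \<open>auto simp: pair_proj_def b_simps I\<close>)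
    show "pair_proj i j f = \<zero>\<^bsub>pair_ring i j\<^esub>" "pair_proj k l g = \<zero>\<^bsub>pair_ring k l\<^esub>"
      using f g mem by (simp_all add: pair_proj_def)
    show "\<exists>u\<in>carrier A. \<exists>v\<in>carrier A. w = u \<otimes> f \<oplus> v \<otimes> g" if w: "w \<in> order_ge (c + c)" for w
    proof -
      \<comment> \<open>One \<open>c\<close> of the bound \<open>c + c\<close> is the order of
        \<open>f \<oplus> g\<close>, the other is the order the cofactor needs to lie in the ring.
        The same cofactor serves for \<open>f\<close> and for \<open>g\<close>.\<close>
      have "b m (f \<oplus> g) = fps_X ^ c" if "m \<in> I" for m
        using that f g dist by (auto simp: b_add I)
      then obtain u where u: "u \<in> carrier A" "w = (f \<oplus> g) \<otimes> u"
        using order_ge_factor[OF _ _ w, of "f \<oplus> g"] f(1) g(1) by auto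
      then have "w = u \<otimes> f \<oplus> u \<otimes> g" using f(1) g(1) by (simp add: l_distr m_comm[OF u(1)])
      then show ?thesis using u(1) by blast
    qed
  qed (use f g in simp_all)
  then show ?thesis by blast
qed

end

text \<open>Indexes the four branches by 0 to 3. All further indices repeat the last branch, so the
  algebraic rules need no bound on the index.\<close>

definition line :: "'k :: field \<Rightarrow> nat \<Rightarrow> 'k fps fps \<Rightarrow> 'k fps" where
  "line lam i = (if i = 0 then subst_line 1 0 else if i = 1 then subst_line 0 1
     else if i = 2 then subst_line 1 1 else subst_line lam 1)"

lemma line_simps:
  "line lam i (f + g) = line lam i f + line lam i g" "line lam i (f * g) = line lam i f * line lam i g"
  "line lam i (f - g) = line lam i f - line lam i g"
  "line lam i 1 = 1" "line lam i 0 = 0" "fps_nth (line lam i f) 0 = fps_nth (fps_nth f 0) 0"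
  "line lam i (fps_const (fps_const u)) = fps_const u"
  by (simp_all add: line_def subst_line_add subst_line_mult subst_line_diff)

lemma line_vars:
  "line lam i var_X = fps_const (if i = 1 then 0 else if i = 0 \<or> i = 2 then 1 else lam) * fps_X"
  "line lam i var_Y = fps_const (if i = 0 then 0 else 1) * fps_X"
  by (auto simp: line_def)

lemma branches_line: "branches lam f = (line lam 0 f, line lam 1 f, line lam 2 f, line lam 3 f)"
  by (simp add: branches_def line_def)

lemma line_surj: "\<exists>f. line lam i f = h"
  using subst_line_surj[of 1 0 h] subst_line_surj[of 0 1 h] subst_line_surj[of 1 1 h] subst_line_surj[of lam 1 h]
  by (simp add: line_def)

text \<open>Products of three of the four linear forms vanish on all lines but one.\<close>

lemma line_separating:
  fixes lam :: "'k :: field"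
  assumes lam: "lam \<noteq> 0" "lam \<noteq> 1" and i: "i < 4"
  shows "\<exists>e u. u \<noteq> 0 \<and> (\<forall>j<4. line lam j e = (if j = i then fps_const u * fps_X ^ 3 else 0))"
proof -
  let ?X = "var_X :: 'k fps fps" and ?Y = "var_Y :: 'k fps fps"
  let ?D = "?X - ?Y" and ?E = "?X - fps_const (fps_const lam) * ?Y"
  have four: "(\<forall>j<4. Q j) \<longleftrightarrow> Q 0 \<and> Q 1 \<and> Q 2 \<and> Q (3::nat)" for Q
    by (auto simp: numeral_eq_Suc less_Suc_eq)
  note eval = line_simps line_vars
  have fps: "fps_const a * fps_X * (fps_const b * fps_X) * (fps_const c * fps_X) = fps_const (a * b * c) * fps_X ^ 3" for a b c :: 'k
    by (simp add: power3_eq_cube mult_ac fps_const_mult[symmetric] del: fps_const_mult)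
  have dl: "fps_const a * fps_X - fps_const b * (fps_const c * fps_X) = fps_const (a - b * c) * fps_X"
    "fps_const a * fps_X - fps_const b * fps_X = fps_const (a - b) * fps_X" for a b c :: 'k
    by (simp_all add: left_diff_distrib mult.assoc[symmetric] fps_const_sub[symmetric] del: fps_const_sub)
  have "i = 0 \<or> i = 1 \<or> i = 2 \<or> i = 3" using i by auto
  then show ?thesis
  proof (elim disjE)
    \<comment> \<open>The scalars in the four cases are the values of the product of the other three
      forms at (1, 0), (0, 1), (1, 1) and (lam, 1).\<close>
    assume [simp]: "i = 0"
    show ?thesis
      by (intro exI[of _ "?X * ?D * ?E"] exI[of _ "1"])
        (simp add: four eval dl fps del: fps_const_0_eq_0 fps_const_1_eq_1 fps_const_mult fps_const_sub)
  next
    assume [simp]: "i = 1"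
    show ?thesis
      by (intro exI[of _ "?Y * ?D * ?E"] exI[of _ "lam"]) (simp add: four eval dl fps lam)
  next
    assume [simp]: "i = 2"
    show ?thesis
      by (intro exI[of _ "?X * ?Y * ?E"] exI[of _ "1 - lam"]) (simp add: four eval dl fps lam)
  next
    assume [simp]: "i = 3"
    show ?thesis
      by (intro exI[of _ "?X * ?Y * ?D"] exI[of _ "lam * (lam - 1)"]) (simp add: four eval dl fps lam)
  qed
qed

text \<open>The exponent 3 is the order of the separating elements. The branches are corrected one
  after the other by adding a multiple of the element that lives on that branch only.\<close>

lemma line_conductor:
  fixes lam :: "'k :: field"
  assumes lam: "lam \<noteq> 0" "lam \<noteq> 1" and h: "\<And>i. i < 4 \<Longrightarrow> fps_X ^ 3 dvd h i"
  shows "\<exists>f. \<forall>i<4. line lam i f = h i"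
proof -
  have "\<exists>f. \<forall>i<4. line lam i f = (if i < m then h i else 0)" if "m \<le> 4" for m
    using that
  proof (induction m)
    case 0
    show ?case by (intro exI[of _ 0]) (simp add: line_simps)
  next
    case (Suc m)
    then obtain f where f: "\<forall>i<4. line lam i f = (if i < m then h i else 0)" by auto
    obtain e u where e: "u \<noteq> 0" "\<forall>j<4. line lam j e = (if j = m then fps_const u * fps_X ^ 3 else 0)"
      using line_separating[OF lam, of m] Suc.prems by auto
    obtain h' where h': "h m = fps_X ^ 3 * h'" using h[of m] Suc.prems by (auto elim: dvdE)
    obtain q where q: "line lam m q = fps_const (inverse u) * h'" using line_surj by blast
    have "fps_const u * fps_X ^ 3 * (fps_const (inverse u) * h') = (fps_const u * fps_const (inverse u)) * (fps_X ^ 3 * h')"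
      by (simp only: mult_ac)
    then have "line lam m (e * q) = h m"
      using e q h' Suc.prems by (simp add: line_simps)
    then have "\<forall>i<4. line lam i (f + e * q) = (if i < Suc m then h i else 0)"
      using f e(2) by (auto simp: line_simps less_Suc_eq)
    then show ?case by blast
  qed
  from this[of 4] show ?thesis by auto
qed

section \<open>The given ring as a branched ring\<close>

locale four_lines =
  fixes lam :: "'k :: field"
  assumes lam: "lam \<noteq> 0" "lam \<noteq> 1"
begin

abbreviation P :: "'k fps fps ring" where "P \<equiv> ring_of_type_algebra"
abbreviation J :: "'k fps fps set" where "J \<equiv> PIdl\<^bsub>P\<^esub> (F_poly lam)"

sublocale P: cring P by (rule cring_from_type_algebra)

lemma ideal_J: "ideal J P"
  by (rule P.cgenideal_ideal) simp

sublocale J: ideal J P by (rule ideal_J)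

lemma J_iff: "x \<in> J \<longleftrightarrow> F_poly lam dvd x"
  by (auto simp: cgenideal_def dvd_def mult.commute)

definition residue :: "'k fps fps \<Rightarrow> 'k fps fps set" where
  "residue f = J +>\<^bsub>P\<^esub> f"

lemma residue_carrier: "carrier (R_ring lam) = range residue"
  by (simp add: R_ring_def FactRing_def A_RCOSETS_def' residue_def UNION_singleton_eq_range)

lemma residue_mult: "residue f \<otimes>\<^bsub>R_ring lam\<^esub> residue g = residue (f * g)"
  using J.rcoset_mult_add[of f g] by (simp add: R_ring_def FactRing_def residue_def)

lemma residue_add: "residue f \<oplus>\<^bsub>R_ring lam\<^esub> residue g = residue (f + g)"
  using J.a_rcos_sum[of f g] by (simp add: R_ring_def FactRing_def residue_def)

lemma residue_one: "\<one>\<^bsub>R_ring lam\<^esub> = residue 1"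
  by (simp add: R_ring_def FactRing_def residue_def)

lemma cring_R_ring: "cring (R_ring lam)"
  unfolding R_ring_def by (rule J.quotient_is_cring[OF P.is_cring])

lemma mem_residue: "h \<in> residue f \<longleftrightarrow> F_poly lam dvd h - f"
proof -
  have "h \<in> residue f \<longleftrightarrow> (\<exists>x\<in>J. h = x + f)"
    by (auto simp: residue_def a_r_coset_def')
  also have "\<dots> \<longleftrightarrow> h - f \<in> J" by (metis add_diff_cancel_right' diff_add_cancel)
  finally show ?thesis by (simp add: J_iff)
qed

lemma residue_eqI:
  assumes "F_poly lam dvd f - g" shows "residue f = residue g"
proof -
  have "h \<in> residue f \<longleftrightarrow> h \<in> residue g" for h
    unfolding mem_residue using dvd_add[OF _ assms, of "h - f"] dvd_diff[OF _ assms, of "h - g"] by auto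
  then show ?thesis by (rule Set.set_eqI)
qed

lemma branches_F_poly: "branches lam (F_poly lam) = (0, 0, 0, 0)"
  by (simp add: branches_line F_poly_def line_simps line_vars)

lemma line_eqD:
  assumes "F_poly lam dvd h - f" "i < 4" shows "line lam i h = line lam i f"
proof -
  obtain q where "h - f = F_poly lam * q" using assms(1) by (elim dvdE)
  then have "line lam i (h - f) = line lam i (F_poly lam) * line lam i q" by (simp add: line_simps)
  moreover have "line lam i (F_poly lam) = 0"
    using branches_F_poly assms(2) by (auto simp: branches_line less_Suc_eq numeral_eq_Suc)
  ultimately show ?thesis by (simp add: line_simps)
qed

text \<open>\<open>the_elem\<close> is legitimate because F vanishes on all four lines.\<close>

lemma R_embed_residue: "R_embed lam (residue f) = branches lam f"
proof -
  have "branches lam h = branches lam f" if "h \<in> residue f" for h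
    using line_eqD[of h f] that by (simp add: mem_residue branches_line)
  then have "branches lam ` residue f = (\<lambda>_. branches lam f) ` residue f" by (rule image_cong[OF refl])
  also have "\<dots> = {branches lam f}" by (rule image_constant[of f]) (simp add: mem_residue)
  finally show ?thesis by (simp add: R_embed_def)
qed

definition branch :: "nat \<Rightarrow> 'k fps fps set \<Rightarrow> 'k fps" where
  "branch i r = (case R_embed lam r of (f1, f2, f3, f4) \<Rightarrow>
     if i = 0 then f1 else if i = 1 then f2 else if i = 2 then f3 else f4)"

lemma branch_residue: "i < 4 \<Longrightarrow> branch i (residue f) = line lam i f"
  by (auto simp: branch_def R_embed_residue branches_line less_Suc_eq numeral_eq_Suc)

text \<open>Joint injectivity of the branches is \<open>F_poly_dvd\<close>, and the conductor
  exponent 3 is \<open>line_conductor\<close>. The common constant term is that of the power series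
  in X and Y.\<close>

lemma branched_R_ring: "branched_ring (R_ring lam) {0, 1, 2, 3} branch 3"
proof (intro branched_ring.intro cring_R_ring branched_ring_axioms.intro)
  have lt: "i < 4" if "i \<in> {0, 1, 2, 3}" for i :: nat using that by auto
  show "branch i (r \<oplus>\<^bsub>R_ring lam\<^esub> s) = branch i r + branch i s"
    "branch i (r \<otimes>\<^bsub>R_ring lam\<^esub> s) = branch i r * branch i s"
    if i: "i \<in> {0, 1, 2, 3}" and rs: "r \<in> carrier (R_ring lam)" "s \<in> carrier (R_ring lam)" for i r s
  proof -
    obtain f h where "r = residue f" "s = residue h" using rs residue_carrier by auto
    then show "branch i (r \<oplus>\<^bsub>R_ring lam\<^esub> s) = branch i r + branch i s"
      "branch i (r \<otimes>\<^bsub>R_ring lam\<^esub> s) = branch i r * branch i s"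
      using branch_residue[OF lt[OF i]] by (simp_all add: residue_add residue_mult line_simps)
  qed
  show "branch i \<one>\<^bsub>R_ring lam\<^esub> = 1" if "i \<in> {0, 1, 2, 3}" for i
    using branch_residue[OF lt[OF that]] by (simp add: residue_one line_simps)
  show "r = s" if r: "r \<in> carrier (R_ring lam)" and s: "s \<in> carrier (R_ring lam)"
    and eq: "\<And>i. i \<in> {0, 1, 2, 3} \<Longrightarrow> branch i r = branch i s" for r s
  proof -
    obtain f h where fh: "r = residue f" "s = residue h" using r s residue_carrier by auto
    have "line lam i (f - h) = 0" if "i \<in> {0, 1, 2, 3}" for i
      using eq[OF that] lt[OF that] by (simp add: fh branch_residue line_simps)
    then have "branches lam (f - h) = (0, 0, 0, 0)" by (simp add: branches_line)
    then show ?thesis unfolding fh by (intro residue_eqI F_poly_dvd[OF lam])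
  qed
  show "\<exists>r\<in>carrier (R_ring lam). branch i r = h" if "i \<in> {0, 1, 2, 3}" for i h
  proof -
    obtain f where "line lam i f = h" using line_surj by blast
    then show ?thesis
      using branch_residue[OF lt[OF that]] by (intro bexI[of _ "residue f"]) (simp_all add: residue_carrier)
  qed
  show "fps_nth (branch i r) 0 = fps_nth (branch j r) 0"
    if i: "i \<in> {0, 1, 2, 3}" and j: "j \<in> {0, 1, 2, 3}" and r: "r \<in> carrier (R_ring lam)" for i j r
  proof -
    obtain f where "r = residue f" using r residue_carrier by auto
    then show ?thesis
      using branch_residue[OF lt[OF i]] branch_residue[OF lt[OF j]] by (simp add: line_simps)
  qed
  show "\<exists>r\<in>carrier (R_ring lam). \<forall>i\<in>{0, 1, 2, 3}. branch i r = h i"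
    if h: "\<And>i. i \<in> {0, 1, 2, 3} \<Longrightarrow> fps_X ^ 3 dvd h i" for h :: "nat \<Rightarrow> 'k fps"
  proof -
    have "fps_X ^ 3 dvd h i" if "i < 4" for i
      using that by (intro h) auto
    then obtain f where "\<forall>i<4. line lam i f = h i" using line_conductor[OF lam] by blast
    then show ?thesis
      using lt by (intro bexI[of _ "residue f"]) (auto simp: branch_residue residue_carrier)
  qed
qed simp_all

sublocale R: branched_ring "R_ring lam" "{0, 1, 2, 3}" branch 3
  by (rule branched_R_ring)

text \<open>The projections and rings of the statement coincide literally with the abstract ones, so
  nothing has to be carried across an isomorphism.\<close>

lemma pr12_eq: "pr12 lam = R.pair_proj 0 1" and pr34_eq: "pr34 lam = R.pair_proj 2 3"
  by (auto simp: fun_eq_iff pr12_def pr34_def R.pair_proj_def branch_def split: prod.splits)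

lemma R12_eq: "R12 lam = R.pair_ring 0 1" and R34_eq: "R34 lam = R.pair_ring 2 3"
  by (simp_all add: R12_def R34_def R.pair_ring_def pr12_eq pr34_eq)

end

lemma infinite_fps: "infinite (UNIV :: 'k :: field fps set)"
proof -
  have "inj (\<lambda>n. fps_X ^ n :: 'k fps)"
    by (rule injI) (metis fps_X_power_nth zero_neq_one)
  then show ?thesis using infinite_UNIV_nat finite_imageD finite_subset by (metis subset_UNIV)
qed

theorem theorem1p1:
  fixes lam :: "'k :: alg_closed_field"
  assumes "lam \<noteq> 0" and "lam \<noteq> 1"
    and universe: "\<exists>u :: 'k fps \<Rightarrow> 'm. inj u"
  shows "equivalent_categories
    (CM (R_ring lam) :: (('k fps fps set, 'm) module, 'm \<Rightarrow> 'm) cat)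
    (Ext_elements (R_ring lam) (R12 lam) (R34 lam) (pr12 lam) (pr34 lam)
      :: (('k fps \<times> 'k fps, 'm) module \<times> ('k fps \<times> 'k fps, 'm) module
            \<times> ('k fps fps set, 'm, 'm) ext set, ('m \<Rightarrow> 'm) \<times> ('m \<Rightarrow> 'm)) cat)"
proof -
  interpret four_lines lam using assms(1,2) by (rule four_lines.intro)
  \<comment> \<open>The injection of k[[t]] makes the universe infinite, as the transport of
    push-outs requires.\<close>
  have "infinite (UNIV :: 'm set)"
    using universe infinite_fps[where 'k = 'k] finite_imageD finite_subset by (metis subset_UNIV)
  moreover obtain f g where "splitting (R_ring lam) {0, 1, 2, 3} branch 3
      (R.pair_ring 0 1) {0, 1} (\<lambda>k p. if k = 0 then fst p else snd p) 3
      (R.pair_ring 2 3) {0, 1} (\<lambda>k p. if k = 0 then fst p else snd p) 3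
      (R.pair_proj 0 1) (R.pair_proj 2 3) f g (3 + 3)"
    using R.splitting_pair_rings[of 0 1 2 3] by auto
  ultimately show ?thesis
    unfolding pr12_eq pr34_eq R12_eq R34_eq by (intro splitting.equivalent_CM_elements)
qed

end
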